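(* Let $d\ge2$ and $\Delta\in\mathbb{R}$. For every $\beta<\beta_c(\Delta)$ there exists $c=c(\beta,\Delta,d)>0$ such that $\langle\sigma_0\sigma_x\rangle^+_{\beta,\Delta}\le e^{-c\|x\|_\infty}$ for every $x\in\mathbb{Z}^d$.
   Context: Blume–Capel model: for a finite subgraph $G=(V,E)$ of $\mathbb{L}^d=(\mathbb{Z}^d,\mathbb{E}^d)$, $\beta>0$, $\Delta\in\mathbb{R}$, boundary condition $\eta\in\{-1,0,1\}^{\mathbb{Z}^d}$, $\mu^\eta_{G,\beta,\Delta}(\sigma)\propto\exp\big(\beta\sum_{xy\in E}\sigma_x\sigma_y+\Delta\sum_{x\in V}\sigma_x^2+\beta\sum_{xy\in\mathbb{E}^d,x\in V,y\notin V}\sigma_x\eta_y\big)$ on $\sigma\in\{-1,0,1\}^V$. $\langle\cdot\rangle^+_{\beta,\Delta}$ is the infinite-volume weak limit of the measures with boundary condition $\eta\equiv1$ on boxes $\Lambda_n=[-n,n]^d$. $\beta_c(\Delta)=\inf\{\beta>0:\langle\sigma_0\rangle^+_{\beta,\Delta}>0\}$. *)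

theory Defs
  imports "HOL-Analysis.Analysis"
begin

definition lat_adj :: "int^'d \<Rightarrow> int^'d \<Rightarrow> bool" where
  "lat_adj x y \<longleftrightarrow> (\<Sum>i\<in>UNIV. \<bar>x$i - y$i\<bar>) = 1"

definition box :: "nat \<Rightarrow> (int^'d) set" where
  "box n = {x. \<forall>i. \<bar>x$i\<bar> \<le> int n}"

definition plus_configs :: "nat \<Rightarrow> (int^'d \<Rightarrow> int) set" where
  "plus_configs n = {\<sigma>. (\<forall>x\<in>box n. \<sigma> x \<in> {-1,0,1}) \<and> (\<forall>x. x \<notin> box n \<longrightarrow> \<sigma> x = 1)}"

text \<open>Exponent of the Boltzmann weight: internal edges (each unordered edge counted once,
  hence the factor 1/2 over ordered pairs), the Delta term, and the boundary edges
  (x in Lambda_n, y outside, where sigma y = eta y = 1).\<close>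
definition bc_exponent :: "real \<Rightarrow> real \<Rightarrow> nat \<Rightarrow> (int^'d \<Rightarrow> int) \<Rightarrow> real" where
  "bc_exponent \<beta> \<Delta> n \<sigma> =
     \<beta> * ((1/2) * (\<Sum>x\<in>box n. \<Sum>y\<in>{y. lat_adj x y} \<inter> box n. real_of_int (\<sigma> x * \<sigma> y)))
     + \<Delta> * (\<Sum>x\<in>box n. real_of_int ((\<sigma> x)^2))
     + \<beta> * (\<Sum>x\<in>box n. \<Sum>y\<in>{y. lat_adj x y} - box n. real_of_int (\<sigma> x * \<sigma> y))"

text \<open>Expectation under the finite-volume Blume-Capel measure on Lambda_n with plus b.c.\<close>
definition bc_plus_exp :: "real \<Rightarrow> real \<Rightarrow> nat \<Rightarrow> ((int^'d \<Rightarrow> int) \<Rightarrow> real) \<Rightarrow> real" where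
  "bc_plus_exp \<beta> \<Delta> n f =
     (\<Sum>\<sigma>\<in>plus_configs n. f \<sigma> * exp (bc_exponent \<beta> \<Delta> n \<sigma>))
     / (\<Sum>\<sigma>\<in>(plus_configs n :: (int^'d \<Rightarrow> int) set). exp (bc_exponent \<beta> \<Delta> n \<sigma>))"

definition bc_plus_two_point :: "real \<Rightarrow> real \<Rightarrow> int^'d \<Rightarrow> int^'d \<Rightarrow> real" where
  "bc_plus_two_point \<beta> \<Delta> x y =
     lim (\<lambda>n. bc_plus_exp \<beta> \<Delta> n (\<lambda>\<sigma>. real_of_int (\<sigma> x * \<sigma> y)))"

definition bc_plus_magnetization :: "'d::finite itself \<Rightarrow> real \<Rightarrow> real \<Rightarrow> real" where
  "bc_plus_magnetization (d::'d::finite itself) \<beta> \<Delta> =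
     lim (\<lambda>n. bc_plus_exp \<beta> \<Delta> n (\<lambda>\<sigma>::int^'d \<Rightarrow> int. real_of_int (\<sigma> 0)))"

text \<open>beta_c(Delta) as an extended real (infimum of the empty set is +infinity).\<close>
definition bc_beta_c :: "'d::finite itself \<Rightarrow> real \<Rightarrow> ereal" where
  "bc_beta_c d \<Delta> = Inf (ereal ` {\<beta>. \<beta> > 0 \<and> bc_plus_magnetization d \<beta> \<Delta> > 0})"

definition sup_norm :: "int^'d \<Rightarrow> int" where
  "sup_norm x = Max (range (\<lambda>i. \<bar>x$i\<bar>))"

end

theory Submission
  imports Defs
begin

text \<open>
  Write m_n for the plus-boundary magnetization at the origin of the box of radius n. The
  two-point function is at most m_(|x|-1), because forcing all spins outside a box to be plus only
  increases correlations (Griffiths' inequality, valid for all Delta by Ginibre's argument).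

  To see that m_n decays exponentially as soon as it tends to zero at some larger beta, let Y be the
  model in the box of radius n and X the model in a smaller box of radius k. In X, explore the plus
  cluster of the outside one query at a time: first whether a site is occupied, then whether a bond
  between occupied sites is open in the Edwards--Sokal sense. Answer the same queries for Y with a
  monotone coupling. If the exploration misses the origin, the origin has mean zero in X, hence also
  in Y. An argument in the style of O'Donnell, Saks, Schramm and Servedio therefore bounds
  m_n (1 - m_k) by the sum over queries of the probability that the query is made in X times its
  covariance with the spin at the origin in Y. The first factor is a magnetization of a box of radius
  k minus the distance to the origin, the second is controlled by the corresponding bond term of the
  derivative of m_n in beta. Summing over k gives
  n m_n <= C (1 + m_0 + ... + m_(n-1)) (d m_n / d beta),
  from which the sharpness lemma of Duminil-Copin, Raoufi and Tassion concludes.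
\<close>

section \<open>Ginibre inequalities\<close>

text \<open>The vacant value 0 is the obstacle: correlation inequalities are needed for every
  measure conditioned on a partial history, and conditioning must stay inside the class covered by
  Ginibre's argument. This dictates the order of queries. Once both ends of a bond are known,
  closing it multiplies the weight by a constant and deletes the interaction, while opening it
  replaces the Boltzmann factor by a multiple of 1 + \<open>bond e \<sigma>\<close>; both operations
  stay in the class. Monotonicity of the answers then follows from Griffiths' second inequality,
  with no lattice condition. Two models are used so that the quantity estimated is explicit: the
  expected product of [origin reached in X] with the conditional mean of the spin in Y equals m_n
  under the coupling and m_k m_n under independence. Their difference m_n (1 - m_k) is what the
  query-by-query comparison bounds. Finally, the derivative in \<beta> sees only covariances with
  products of neighbouring spins, whereas queries test occupation and alignment. Passing from one to
  the other costs (1 + 4/p^2) / tanh \<beta>, where p is the occupation probability of an isolated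
  site.\<close>

definition spins :: "'v set \<Rightarrow> ('v \<Rightarrow> int) set" where
  "spins U = {\<sigma>. (\<forall>v\<in>U. \<sigma> v \<in> {-1,0,1}) \<and> (\<forall>v. v \<notin> U \<longrightarrow> \<sigma> v = 1)}"

lemma spins_value: "\<sigma> \<in> spins U \<Longrightarrow> \<sigma> v \<in> {-1,0,1}"
  unfolding spins_def by (cases "v \<in> U") auto

lemma spins_outside: "\<sigma> \<in> spins U \<Longrightarrow> v \<notin> U \<Longrightarrow> \<sigma> v = 1"
  unfolding spins_def by auto

text \<open>Spins outside the volume are frozen at 1, so the plus boundary condition is built into
  the configuration space and a smaller volume is a restriction of a larger one. This is what lets
  one weight function serve all volumes.\<close>

lemma spins_mono: "U' \<subseteq> U \<Longrightarrow> spins U' \<subseteq> spins U"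
proof
  fix \<sigma> assume "U' \<subseteq> U" and s: "\<sigma> \<in> spins U'"
  then show "\<sigma> \<in> spins U"
    using spins_value[OF s] spins_outside[OF s] unfolding spins_def by blast
qed

lemma spins_empty: "spins {} = {\<lambda>_. 1}"
  unfolding spins_def by auto

lemma spins_insert:
  assumes "v \<notin> U"
  shows "bij_betw (\<lambda>(s, \<sigma>). \<sigma>(v := s)) ({-1,0,1} \<times> spins U) (spins (insert v U))"
proof (rule bij_betw_byWitness[where f' = "\<lambda>\<sigma>. (\<sigma> v, \<sigma>(v := 1))"])
  show "\<forall>a\<in>{- 1, 0, 1} \<times> spins U.
       (case case a of (s, \<sigma>) \<Rightarrow> \<sigma>(v := s) of \<sigma> \<Rightarrow> (\<sigma> v, \<sigma>(v := 1))) = a"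
    using assms by (auto simp: fun_eq_iff spins_outside)
  show "\<forall>a'\<in>spins (insert v U). (case (a' v, a'(v := 1)) of (s, \<sigma>) \<Rightarrow> \<sigma>(v := s)) = a'"
    by (auto simp: fun_eq_iff)
  show "(\<lambda>(s, \<sigma>). \<sigma>(v := s)) ` ({- 1, 0, 1} \<times> spins U) \<subseteq> spins (insert v U)"
    by (auto simp: spins_def; blast)
  show "(\<lambda>\<sigma>. (\<sigma> v, \<sigma>(v := 1))) ` spins (insert v U) \<subseteq> {- 1, 0, 1} \<times> spins U"
    using assms unfolding spins_def by fastforce
qed

lemma sum_spins_insert:
  fixes F :: "('v \<Rightarrow> int) \<Rightarrow> real"
  assumes "v \<notin> U"
  shows "(\<Sum>\<sigma>\<in>spins (insert v U). F \<sigma>) = (\<Sum>s\<in>{-1,0,1}. \<Sum>\<sigma>\<in>spins U. F (\<sigma>(v := s)))"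
  using sum.reindex_bij_betw[OF spins_insert[OF assms], of F]
  by (simp add: sum.cartesian_product split_def)

lemma finite_spins: "finite U \<Longrightarrow> finite (spins U)"
proof (induction U rule: finite_induct)
  case (insert v U)
  then show ?case using bij_betw_finite[OF spins_insert[of v U]] by auto
qed (simp add: spins_empty)

section \<open>Polynomials with nonnegative coefficients in one and in two copies of the
  spins\<close>

inductive cone1 :: "(('v \<Rightarrow> int) \<Rightarrow> real) \<Rightarrow> bool" where
  cone1_const: "0 \<le> c \<Longrightarrow> cone1 (\<lambda>\<sigma>. c)"
| cone1_spin: "cone1 F \<Longrightarrow> cone1 (\<lambda>\<sigma>. real_of_int (\<sigma> v) * F \<sigma>)"
| cone1_add: "cone1 F \<Longrightarrow> cone1 G \<Longrightarrow> cone1 (\<lambda>\<sigma>. F \<sigma> + G \<sigma>)"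

text \<open>Ginibre's rotated variables: polynomials with nonnegative coefficients in the sums and
  differences of two copies. Generators are multiplied in one at a time so that every closure
  property is a plain induction.\<close>

inductive cone2 :: "(('v \<Rightarrow> int) \<Rightarrow> ('v \<Rightarrow> int) \<Rightarrow> real) \<Rightarrow> bool" where
  cone2_const: "0 \<le> c \<Longrightarrow> cone2 (\<lambda>\<sigma> \<tau>. c)"
| cone2_plus: "cone2 F \<Longrightarrow> cone2 (\<lambda>\<sigma> \<tau>. (real_of_int (\<sigma> v) + real_of_int (\<tau> v)) * F \<sigma> \<tau>)"
| cone2_minus: "cone2 F \<Longrightarrow> cone2 (\<lambda>\<sigma> \<tau>. (real_of_int (\<sigma> v) - real_of_int (\<tau> v)) * F \<sigma> \<tau>)"
| cone2_add: "cone2 F \<Longrightarrow> cone2 G \<Longrightarrow> cone2 (\<lambda>\<sigma> \<tau>. F \<sigma> \<tau> + G \<sigma> \<tau>)"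

lemma cone1_scale: "cone1 F \<Longrightarrow> 0 \<le> c \<Longrightarrow> cone1 (\<lambda>\<sigma>. c * F \<sigma>)"
proof (induction F rule: cone1.induct)
  case (cone1_const d) then show ?case by (simp add: cone1.cone1_const)
next
  case (cone1_spin F v)
  then show ?case using cone1.cone1_spin[of "\<lambda>\<sigma>. c * F \<sigma>" v] by (simp add: mult.left_commute)
next
  case (cone1_add F G)
  then show ?case using cone1.cone1_add[of "\<lambda>\<sigma>. c * F \<sigma>" "\<lambda>\<sigma>. c * G \<sigma>"] by (simp add: distrib_left)
qed

lemma cone1_mult: "cone1 F \<Longrightarrow> cone1 G \<Longrightarrow> cone1 (\<lambda>\<sigma>. F \<sigma> * G \<sigma>)"
proof (induction F rule: cone1.induct)
  case (cone1_const d) then show ?case by (simp add: cone1_scale)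
next
  case (cone1_spin F v)
  then show ?case using cone1.cone1_spin[of "\<lambda>\<sigma>. F \<sigma> * G \<sigma>" v] by (simp add: mult.assoc)
next
  case (cone1_add F F')
  then show ?case using cone1.cone1_add[of "\<lambda>\<sigma>. F \<sigma> * G \<sigma>" "\<lambda>\<sigma>. F' \<sigma> * G \<sigma>"] by (simp add: distrib_right)
qed

lemma cone1_sum: "(\<And>i. i \<in> I \<Longrightarrow> cone1 (F i)) \<Longrightarrow> cone1 (\<lambda>\<sigma>. \<Sum>i\<in>I. F i \<sigma>)"
proof (induction I rule: infinite_finite_induct)
  case (insert x A)
  then show ?case using cone1_add[of "F x" "\<lambda>\<sigma>. \<Sum>i\<in>A. F i \<sigma>"] by simp
qed (simp_all add: cone1_const)

lemma cone1_prod: "(\<And>i. i \<in> I \<Longrightarrow> cone1 (F i)) \<Longrightarrow> cone1 (\<lambda>\<sigma>. \<Prod>i\<in>I. F i \<sigma>)"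
proof (induction I rule: infinite_finite_induct)
  case (insert x A)
  then show ?case using cone1_mult[of "F x" "\<lambda>\<sigma>. \<Prod>i\<in>A. F i \<sigma>"] by simp
qed (simp_all add: cone1_const)

lemma cone1_power: "cone1 F \<Longrightarrow> cone1 (\<lambda>\<sigma>. F \<sigma> ^ n)"
  by (induction n) (auto intro: cone1_mult cone1_const)

lemma cone1_coord: "cone1 (\<lambda>\<sigma>. real_of_int (\<sigma> v))"
  using cone1_spin[OF cone1_const[of 1]] by simp

lemma cone2_scale: "cone2 F \<Longrightarrow> 0 \<le> c \<Longrightarrow> cone2 (\<lambda>\<sigma> \<tau>. c * F \<sigma> \<tau>)"
proof (induction F rule: cone2.induct)
  case (cone2_const d) then show ?case by (simp add: cone2.cone2_const)
next
  case (cone2_plus F v)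
  then show ?case using cone2.cone2_plus[of "\<lambda>\<sigma> \<tau>. c * F \<sigma> \<tau>" v] by (simp add: mult.left_commute)
next
  case (cone2_minus F v)
  then show ?case using cone2.cone2_minus[of "\<lambda>\<sigma> \<tau>. c * F \<sigma> \<tau>" v] by (simp add: mult.left_commute)
next
  case (cone2_add F G)
  then show ?case using cone2.cone2_add[of "\<lambda>\<sigma> \<tau>. c * F \<sigma> \<tau>" "\<lambda>\<sigma> \<tau>. c * G \<sigma> \<tau>"] by (simp add: distrib_left)
qed

lemma cone2_mult: "cone2 F \<Longrightarrow> cone2 G \<Longrightarrow> cone2 (\<lambda>\<sigma> \<tau>. F \<sigma> \<tau> * G \<sigma> \<tau>)"
proof (induction F rule: cone2.induct)
  case (cone2_const d) then show ?case by (simp add: cone2_scale)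
next
  case (cone2_plus F v)
  then show ?case using cone2.cone2_plus[of "\<lambda>\<sigma> \<tau>. F \<sigma> \<tau> * G \<sigma> \<tau>" v] by (simp add: mult.assoc)
next
  case (cone2_minus F v)
  then show ?case using cone2.cone2_minus[of "\<lambda>\<sigma> \<tau>. F \<sigma> \<tau> * G \<sigma> \<tau>" v] by (simp add: mult.assoc)
next
  case (cone2_add F F')
  then show ?case using cone2.cone2_add[of "\<lambda>\<sigma> \<tau>. F \<sigma> \<tau> * G \<sigma> \<tau>" "\<lambda>\<sigma> \<tau>. F' \<sigma> \<tau> * G \<sigma> \<tau>"]
    by (simp add: distrib_right)
qed

lemma cone2_power: "cone2 F \<Longrightarrow> cone2 (\<lambda>\<sigma> \<tau>. F \<sigma> \<tau> ^ n)"
  by (induction n) (auto intro: cone2_mult cone2_const)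

lemma cone2_sum: "(\<And>i. i \<in> I \<Longrightarrow> cone2 (F i)) \<Longrightarrow> cone2 (\<lambda>\<sigma> \<tau>. \<Sum>i\<in>I. F i \<sigma> \<tau>)"
proof (induction I rule: infinite_finite_induct)
  case (insert x A)
  then show ?case using cone2_add[of "F x" "\<lambda>\<sigma> \<tau>. \<Sum>i\<in>A. F i \<sigma> \<tau>"] by simp
qed (simp_all add: cone2_const)

text \<open>Sum and difference must be treated together, because the product rule mixes them: a F -
  a' F' = ((a + a')(F - F') + (a - a')(F + F')) / 2, and likewise for the sum with the two brackets
  exchanged.\<close>

lemma cone2_diff_add:
  "cone1 F \<Longrightarrow> cone2 (\<lambda>\<sigma> \<tau>. F \<sigma> - F \<tau>) \<and> cone2 (\<lambda>\<sigma> \<tau>. F \<sigma> + F \<tau>)"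
proof (induction F rule: cone1.induct)
  case (cone1_const c)
  then show ?case using cone2_const[of 0] cone2_const[of "c + c"] by simp
next
  case (cone1_spin F v)
  let ?p = "\<lambda>\<sigma> \<tau>. (real_of_int (\<sigma> v) + real_of_int (\<tau> v))"
  let ?m = "\<lambda>\<sigma> \<tau>. (real_of_int (\<sigma> v) - real_of_int (\<tau> v))"
  have a: "cone2 (\<lambda>\<sigma> \<tau>. (1/2) * (?p \<sigma> \<tau> * (F \<sigma> - F \<tau>) + ?m \<sigma> \<tau> * (F \<sigma> + F \<tau>)))"
    using cone1_spin.IH by (intro cone2_scale[OF cone2_add[OF cone2_plus cone2_minus]]) auto
  have b: "cone2 (\<lambda>\<sigma> \<tau>. (1/2) * (?p \<sigma> \<tau> * (F \<sigma> + F \<tau>) + ?m \<sigma> \<tau> * (F \<sigma> - F \<tau>)))"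
    using cone1_spin.IH by (intro cone2_scale[OF cone2_add[OF cone2_plus cone2_minus]]) auto
  have a': "(\<lambda>\<sigma> \<tau>. (1/2) * (?p \<sigma> \<tau> * (F \<sigma> - F \<tau>) + ?m \<sigma> \<tau> * (F \<sigma> + F \<tau>)))
     = (\<lambda>\<sigma> \<tau>. real_of_int (\<sigma> v) * F \<sigma> - real_of_int (\<tau> v) * F \<tau>)"
    by (intro ext) (simp add: field_simps)
  have b': "(\<lambda>\<sigma> \<tau>. (1/2) * (?p \<sigma> \<tau> * (F \<sigma> + F \<tau>) + ?m \<sigma> \<tau> * (F \<sigma> - F \<tau>)))
     = (\<lambda>\<sigma> \<tau>. real_of_int (\<sigma> v) * F \<sigma> + real_of_int (\<tau> v) * F \<tau>)"
    by (intro ext) (simp add: field_simps)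
  show ?case using a b unfolding a' b' by simp
next
  case (cone1_add F G)
  have "cone2 (\<lambda>\<sigma> \<tau>. (F \<sigma> - F \<tau>) + (G \<sigma> - G \<tau>))" "cone2 (\<lambda>\<sigma> \<tau>. (F \<sigma> + F \<tau>) + (G \<sigma> + G \<tau>))"
    using cone1_add by (auto intro!: cone2_add)
  then show ?case by (simp add: algebra_simps)
qed

section \<open>Positivity on the doubled system, Griffiths' inequalities and closure
  properties\<close>

definition ginibre :: "('v \<Rightarrow> int) set \<Rightarrow> (('v \<Rightarrow> int) \<Rightarrow> real) \<Rightarrow> bool" where
  "ginibre S w \<longleftrightarrow> finite S \<and> (\<forall>\<sigma>\<in>S. 0 \<le> w \<sigma>) \<and>
     (\<forall>F. cone2 F \<longrightarrow> 0 \<le> (\<Sum>\<sigma>\<in>S. \<Sum>\<tau>\<in>S. w \<sigma> * w \<tau> * F \<sigma> \<tau>))"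

lemma ginibre_cong:
  assumes "\<And>\<sigma>. \<sigma> \<in> S \<Longrightarrow> w \<sigma> = w' \<sigma>" "ginibre S w" shows "ginibre S w'"
proof -
  have "(\<Sum>\<sigma>\<in>S. \<Sum>\<tau>\<in>S. w \<sigma> * w \<tau> * F \<sigma> \<tau>) = (\<Sum>\<sigma>\<in>S. \<Sum>\<tau>\<in>S. w' \<sigma> * w' \<tau> * F \<sigma> \<tau>)" for F
    using assms(1) by (intro sum.cong) auto
  then show ?thesis using assms unfolding ginibre_def by simp
qed

text \<open>Twice the covariance is the doubled-system average of (F \<sigma> - F \<tau>)(G \<sigma>
  - G \<tau>), which lies in the cone. The form without division also covers weights of total mass
  0.\<close>

lemma gks_covariance:
  assumes "ginibre S w" "cone1 F" "cone1 G"
  shows "(\<Sum>\<sigma>\<in>S. w \<sigma> * F \<sigma>) * (\<Sum>\<sigma>\<in>S. w \<sigma> * G \<sigma>) \<le> (\<Sum>\<sigma>\<in>S. w \<sigma>) * (\<Sum>\<sigma>\<in>S. w \<sigma> * (F \<sigma> * G \<sigma>))"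
proof -
  have "cone2 (\<lambda>\<sigma> \<tau>. (F \<sigma> - F \<tau>) * (G \<sigma> - G \<tau>))"
    using assms by (intro cone2_mult) (auto dest: cone2_diff_add)
  then have "0 \<le> (\<Sum>\<sigma>\<in>S. \<Sum>\<tau>\<in>S. w \<sigma> * w \<tau> * ((F \<sigma> - F \<tau>) * (G \<sigma> - G \<tau>)))"
    using assms(1) unfolding ginibre_def by blast
  also have "\<dots> = (\<Sum>\<sigma>\<in>S. \<Sum>\<tau>\<in>S. (w \<sigma> * (F \<sigma> * G \<sigma>)) * w \<tau> + w \<sigma> * (w \<tau> * (F \<tau> * G \<tau>))
       - (w \<sigma> * F \<sigma>) * (w \<tau> * G \<tau>) - (w \<sigma> * G \<sigma>) * (w \<tau> * F \<tau>))"
    by (intro sum.cong refl) (simp add: algebra_simps)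
  also have "\<dots> = 2 * ((\<Sum>\<sigma>\<in>S. w \<sigma>) * (\<Sum>\<sigma>\<in>S. w \<sigma> * (F \<sigma> * G \<sigma>)) - (\<Sum>\<sigma>\<in>S. w \<sigma> * F \<sigma>) * (\<Sum>\<sigma>\<in>S. w \<sigma> * G \<sigma>))"
    by (simp only: sum.distrib sum_subtractf sum_product[symmetric]) (simp add: algebra_simps)
  finally show ?thesis by simp
qed

lemma gks_nonneg:
  assumes "ginibre S w" "cone1 F"
  shows "0 \<le> (\<Sum>\<sigma>\<in>S. w \<sigma> * F \<sigma>)"
proof (cases "(\<Sum>\<sigma>\<in>S. w \<sigma>) = 0")
  case True
  then have "\<forall>\<sigma>\<in>S. w \<sigma> = 0" using assms(1) unfolding ginibre_def by (simp add: sum_nonneg_eq_0_iff)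
  then show ?thesis by simp
next
  case False
  then have pos: "(\<Sum>\<sigma>\<in>S. w \<sigma>) > 0"
    using assms(1) sum_nonneg[of S w] unfolding ginibre_def by fastforce
  have "0 \<le> (\<Sum>\<sigma>\<in>S. \<Sum>\<tau>\<in>S. w \<sigma> * w \<tau> * (F \<sigma> + F \<tau>))"
    using assms cone2_diff_add[OF assms(2)] unfolding ginibre_def by blast
  also have "\<dots> = (\<Sum>\<sigma>\<in>S. \<Sum>\<tau>\<in>S. (w \<sigma> * F \<sigma>) * w \<tau> + w \<sigma> * (w \<tau> * F \<tau>))"
    by (intro sum.cong refl) (simp add: algebra_simps)
  also have "\<dots> = 2 * ((\<Sum>\<sigma>\<in>S. w \<sigma>) * (\<Sum>\<sigma>\<in>S. w \<sigma> * F \<sigma>))"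
    by (simp only: sum.distrib sum_product[symmetric]) (simp add: algebra_simps)
  finally show ?thesis using pos by (simp add: zero_le_mult_iff)
qed

lemma ginibre_scale: "ginibre S w \<Longrightarrow> 0 \<le> c \<Longrightarrow> ginibre S (\<lambda>\<sigma>. c * w \<sigma>)"
proof -
  assume w: "ginibre S w" and c: "0 \<le> c"
  have "(\<Sum>\<sigma>\<in>S. \<Sum>\<tau>\<in>S. (c * w \<sigma>) * (c * w \<tau>) * F \<sigma> \<tau>) = c * c * (\<Sum>\<sigma>\<in>S. \<Sum>\<tau>\<in>S. w \<sigma> * w \<tau> * F \<sigma> \<tau>)" for F
    by (simp add: sum_distrib_left mult_ac)
  then show ?thesis using w c unfolding ginibre_def by simp
qed

text \<open>The doubled factor exp (H \<sigma> + H \<tau>) is a limit of Taylor polynomials in H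
  \<sigma> + H \<tau>. These lie in the cone, and nonnegativity of the finite sums passes to the
  limit.\<close>

lemma ginibre_exp:
  assumes w: "ginibre S w" and H: "cone1 H"
  shows "ginibre S (\<lambda>\<sigma>. w \<sigma> * exp (H \<sigma>))"
  unfolding ginibre_def
proof (intro conjI ballI allI impI)
  show "finite S" using w unfolding ginibre_def by simp
  fix \<sigma> assume "\<sigma> \<in> S" then show "0 \<le> w \<sigma> * exp (H \<sigma>)" using w unfolding ginibre_def by simp
next
  fix F :: "('a \<Rightarrow> int) \<Rightarrow> ('a \<Rightarrow> int) \<Rightarrow> real" assume F: "cone2 F"
  let ?K = "\<lambda>\<sigma> \<tau>. H \<sigma> + H \<tau>"
  let ?X = "\<lambda>N. \<Sum>\<sigma>\<in>S. \<Sum>\<tau>\<in>S. w \<sigma> * w \<tau> * ((\<Sum>k<N. inverse (fact k) * ?K \<sigma> \<tau> ^ k) * F \<sigma> \<tau>)"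
  have "?X \<longlonglongrightarrow> (\<Sum>\<sigma>\<in>S. \<Sum>\<tau>\<in>S. w \<sigma> * w \<tau> * (exp (?K \<sigma> \<tau>) * F \<sigma> \<tau>))"
  proof (intro tendsto_sum tendsto_mult tendsto_const)
    fix \<sigma> \<tau>
    have "(\<lambda>k. ?K \<sigma> \<tau> ^ k /\<^sub>R fact k) sums exp (?K \<sigma> \<tau>)" by (rule exp_converges)
    then show "(\<lambda>N. \<Sum>k<N. inverse (fact k) * ?K \<sigma> \<tau> ^ k) \<longlonglongrightarrow> exp (?K \<sigma> \<tau>)"
      by (simp add: sums_def)
  qed
  moreover have "0 \<le> ?X N" for N
  proof -
    have "cone2 (\<lambda>\<sigma> \<tau>. (\<Sum>k<N. inverse (fact k) * ?K \<sigma> \<tau> ^ k) * F \<sigma> \<tau>)"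
      using cone2_diff_add[OF H] F by (intro cone2_mult[OF cone2_sum[OF cone2_scale[OF cone2_power]]]) auto
    then show ?thesis using w unfolding ginibre_def by blast
  qed
  ultimately have "0 \<le> (\<Sum>\<sigma>\<in>S. \<Sum>\<tau>\<in>S. w \<sigma> * w \<tau> * (exp (?K \<sigma> \<tau>) * F \<sigma> \<tau>))"
    by (intro LIMSEQ_le_const) auto
  also have "\<dots> = (\<Sum>\<sigma>\<in>S. \<Sum>\<tau>\<in>S. w \<sigma> * exp (H \<sigma>) * (w \<tau> * exp (H \<tau>)) * F \<sigma> \<tau>)"
    by (intro sum.cong refl) (simp add: exp_add mult_ac)
  finally show "0 \<le> (\<Sum>\<sigma>\<in>S. \<Sum>\<tau>\<in>S. w \<sigma> * exp (H \<sigma>) * (w \<tau> * exp (H \<tau>)) * F \<sigma> \<tau>)" .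
qed

text \<open>If b and b' are both \<plusminus>1, then (1 + b)(1 + b') = (b + b') + (b + b')^2 / 2, a
  cone element although b b' alone is not visibly one. The identity fails at b = 0, which is why an
  open bond may only join occupied sites.\<close>

lemma ginibre_one_plus:
  assumes w: "ginibre S w" and b: "cone1 b"
    and unit: "\<And>\<sigma>. \<sigma> \<in> S \<Longrightarrow> w \<sigma> \<noteq> 0 \<Longrightarrow> \<bar>b \<sigma>\<bar> = 1"
  shows "ginibre S (\<lambda>\<sigma>. w \<sigma> * (1 + b \<sigma>))"
  unfolding ginibre_def
proof (intro conjI ballI allI impI)
  show "finite S" using w unfolding ginibre_def by simp
  fix \<sigma> assume s: "\<sigma> \<in> S" 
  then have "0 \<le> w \<sigma>" "w \<sigma> \<noteq> 0 \<Longrightarrow> 0 \<le> 1 + b \<sigma>" using w unit[OF s] unfolding ginibre_def by auto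
  then show "0 \<le> w \<sigma> * (1 + b \<sigma>)" by (cases "w \<sigma> = 0") auto
next
  fix F :: "('a \<Rightarrow> int) \<Rightarrow> ('a \<Rightarrow> int) \<Rightarrow> real" assume F: "cone2 F"
  have "cone2 (\<lambda>\<sigma> \<tau>. ((b \<sigma> + b \<tau>) + (1/2) * (b \<sigma> + b \<tau>)^2) * F \<sigma> \<tau>)"
    using cone2_diff_add[OF b] F
    by (intro cone2_mult[OF cone2_add[OF _ cone2_scale[OF cone2_power]]]) auto
  then have "0 \<le> (\<Sum>\<sigma>\<in>S. \<Sum>\<tau>\<in>S. w \<sigma> * w \<tau> * (((b \<sigma> + b \<tau>) + (1/2) * (b \<sigma> + b \<tau>)^2) * F \<sigma> \<tau>))"
    using w unfolding ginibre_def by blast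
  also have "\<dots> = (\<Sum>\<sigma>\<in>S. \<Sum>\<tau>\<in>S. w \<sigma> * (1 + b \<sigma>) * (w \<tau> * (1 + b \<tau>)) * F \<sigma> \<tau>)"
  proof (intro sum.cong refl)
    fix \<sigma> \<tau> assume s: "\<sigma> \<in> S" "\<tau> \<in> S"
    show "w \<sigma> * w \<tau> * (((b \<sigma> + b \<tau>) + (1/2) * (b \<sigma> + b \<tau>)^2) * F \<sigma> \<tau>)
        = w \<sigma> * (1 + b \<sigma>) * (w \<tau> * (1 + b \<tau>)) * F \<sigma> \<tau>"
    proof (cases "w \<sigma> = 0 \<or> w \<tau> = 0")
      case False
      then have "b \<sigma> ^ 2 = 1" "b \<tau> ^ 2 = 1"
        using unit s by (metis power2_abs power_one)+
      then have "(b \<sigma> + b \<tau>) + (1/2) * (b \<sigma> + b \<tau>)^2 = (1 + b \<sigma>) * (1 + b \<tau>)"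
        by (simp add: power2_sum field_simps)
      then show ?thesis by simp
    qed auto
  qed
  finally show "0 \<le> (\<Sum>\<sigma>\<in>S. \<Sum>\<tau>\<in>S. w \<sigma> * (1 + b \<sigma>) * (w \<tau> * (1 + b \<tau>)) * F \<sigma> \<tau>)" .
qed

text \<open>If both spins are nonzero, either s + t or s - t vanishes; if one is zero, both are
  \<plusminus>1. Evenness of a pairs each term with its sign change, so only even powers
  survive.\<close>

lemma even_moment_nonneg:
  fixes a :: "int \<Rightarrow> real"
  assumes "a 0 \<ge> 0" "a 1 \<ge> 0" "a (-1) = a 1"
  shows "0 \<le> (\<Sum>s\<in>{-1,0,1}. \<Sum>t\<in>{-1,0,1}. a s * a t *
       ((real_of_int s + real_of_int t) ^ m * (real_of_int s - real_of_int t) ^ n))"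
proof -
  have 1: "0 \<le> (-1) ^ k + (1::real)" for k :: nat by (cases "even k") simp_all
  have 2: "0 \<le> (-2) ^ k + (2::real) ^ k" for k :: nat by (cases "even k") simp_all
  have "(\<Sum>s\<in>{-1,0,1}. \<Sum>t\<in>{-1,0,1}. a s * a t *
       ((real_of_int s + real_of_int t) ^ m * (real_of_int s - real_of_int t) ^ n))
     = a 1 * a 1 * (((-2) ^ m + 2 ^ m) * 0 ^ n + 0 ^ m * ((-2) ^ n + 2 ^ n))
     + a 0 * a 1 * (((-1) ^ m + 1) * ((-1) ^ n + 1)) + a 0 * a 0 * (0 ^ m * 0 ^ n)"
    using assms(3) by (simp add: algebra_simps)
  also have "\<dots> \<ge> 0"
    using assms by (intro add_nonneg_nonneg mult_nonneg_nonneg 1 2) simp_all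
  finally show ?thesis .
qed

text \<open>The exponents m and n are free so that the induction can absorb every factor of F
  involving \<open>v\<close>; at a constant only a one-site moment is left.\<close>

lemma cone2_sum_coordinate:
  fixes a :: "int \<Rightarrow> real"
  assumes a: "a 0 \<ge> 0" "a 1 \<ge> 0" "a (-1) = a 1" and "cone2 F"
  shows "cone2 (\<lambda>\<sigma> \<tau>. \<Sum>s\<in>{-1,0,1}. \<Sum>t\<in>{-1,0,1}. a s * a t *
       ((real_of_int s + real_of_int t) ^ m * (real_of_int s - real_of_int t) ^ n) * F (\<sigma>(v := s)) (\<tau>(v := t)))"
  using assms(4)
proof (induction F arbitrary: m n rule: cone2.induct)
  case (cone2_const c)
  then show ?case
    using cone2.cone2_const[OF mult_nonneg_nonneg[OF even_moment_nonneg[OF a, of m n] cone2_const(1)]]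
    by (simp only: sum_distrib_right)
next
  case (cone2_plus F u)
  show ?case
  proof (cases "u = v")
    case True
    then show ?thesis using cone2_plus.IH[of "Suc m" n] by (simp add: mult_ac)
  next
    case False
    then show ?thesis using cone2.cone2_plus[OF cone2_plus.IH[of m n], of u] by (simp add: algebra_simps)
  qed
next
  case (cone2_minus F u)
  show ?case
  proof (cases "u = v")
    case True
    then show ?thesis using cone2_minus.IH[of m "Suc n"] by (simp add: mult_ac)
  next
    case False
    then show ?thesis using cone2.cone2_minus[OF cone2_minus.IH[of m n], of u] by (simp add: algebra_simps)
  qed
next
  case (cone2_add F G)
  show ?case using cone2.cone2_add[OF cone2_add.IH(1)[of m n] cone2_add.IH(2)[of m n]]
    by (simp only: sum.distrib[symmetric] distrib_left[symmetric])
qed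

text \<open>Summing both copies of one site turns a cone element into a cone element of the
  remaining sites, so the sites can be integrated out one by one.\<close>

lemma ginibre_product:
  fixes a :: "'v \<Rightarrow> int \<Rightarrow> real"
  assumes "finite U" and "\<And>v. a v 0 \<ge> 0" "\<And>v. a v 1 \<ge> 0" "\<And>v. a v (-1) = a v 1"
  shows "ginibre (spins U) (\<lambda>\<sigma>. \<Prod>v\<in>U. a v (\<sigma> v))"
proof -
  have nn: "0 \<le> a v (\<sigma> v)" if "\<sigma> \<in> spins U" for \<sigma> v
    using spins_value[OF that, of v] assms(2,3)[of v] assms(4)[of v] by auto
  have "0 \<le> (\<Sum>\<sigma>\<in>spins U. \<Sum>\<tau>\<in>spins U. (\<Prod>v\<in>U. a v (\<sigma> v)) * (\<Prod>v\<in>U. a v (\<tau> v)) * F \<sigma> \<tau>)"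
    if "cone2 F" for F
    using assms(1) that
  proof (induction U arbitrary: F rule: finite_induct)
    case empty
    have "0 \<le> F (\<lambda>_. 1) (\<lambda>_. 1)" using empty by (induction rule: cone2.induct) auto
    then show ?case by (simp add: spins_empty)
  next
    case (insert v U)
    let ?P = "\<lambda>\<sigma>. \<Prod>u\<in>U. a u (\<sigma> u)"
    let ?F' = "\<lambda>\<sigma> \<tau>. \<Sum>s\<in>{-1,0,1}. \<Sum>t\<in>{-1,0,1}. a v s * a v t *
       ((real_of_int s + real_of_int t) ^ 0 * (real_of_int s - real_of_int t) ^ 0) * F (\<sigma>(v := s)) (\<tau>(v := t))"
    have P: "(\<Prod>u\<in>insert v U. a u ((\<sigma>(v := s)) u)) = a v s * ?P \<sigma>" for \<sigma> s
    proof -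
      have "(\<Prod>u\<in>U. a u ((\<sigma>(v := s)) u)) = ?P \<sigma>" using insert.hyps by (intro prod.cong) auto
      then show ?thesis using insert.hyps by simp
    qed
    have "0 \<le> (\<Sum>\<sigma>\<in>spins U. \<Sum>\<tau>\<in>spins U. ?P \<sigma> * ?P \<tau> * ?F' \<sigma> \<tau>)"
      using assms insert by (intro insert.IH cone2_sum_coordinate) auto
    also have "\<dots> = (\<Sum>\<sigma>\<in>spins (insert v U). \<Sum>\<tau>\<in>spins (insert v U).
       (\<Prod>u\<in>insert v U. a u (\<sigma> u)) * (\<Prod>u\<in>insert v U. a u (\<tau> u)) * F \<sigma> \<tau>)"
      unfolding sum_spins_insert[OF insert.hyps(2)] P
      by (simp add: sum_distrib_left sum.distrib algebra_simps)
    finally show ?case .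
  qed
  then show ?thesis
    unfolding ginibre_def using finite_spins[OF assms(1)] nn by (auto intro: prod_nonneg)
qed

section \<open>Exploration of one random history coupled to another\<close>

type_synonym 'q history = "('q \<times> bool) list"

definition below :: "'q history \<Rightarrow> 'q history \<Rightarrow> bool" where
  "below = list_all2 (\<lambda>a b. fst a = fst b \<and> (snd a \<longrightarrow> snd b))"

lemma below_refl: "below y y"
  unfolding below_def by (simp add: list.rel_refl)

lemma below_Cons: "below ((q, b) # y) ((q, b') # y') \<longleftrightarrow> (b \<longrightarrow> b') \<and> below y y'"
  unfolding below_def by auto

lemma below_queries: "below y y' \<Longrightarrow> map fst y = map fst y'"
  unfolding below_def by (induction rule: list_all2_induct) auto

lemma below_True: "below y y' \<Longrightarrow> (q, True) \<in> set y \<Longrightarrow> (q, True) \<in> set y'"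
  unfolding below_def by (induction rule: list_all2_induct) auto

text \<open>Expected value of \<phi> at the end of a run that answers \<open>q\<close> by True with
  probability \<open>p x q\<close>. The newest answer is at the head of the history, and the natural
  number is fuel that replaces a termination argument.\<close>

primrec explore ::
    "('q history \<Rightarrow> 'q option) \<Rightarrow> ('q history \<Rightarrow> 'q \<Rightarrow> real) \<Rightarrow> nat \<Rightarrow> ('q history \<Rightarrow> real) \<Rightarrow> 'q history \<Rightarrow> real" where
  "explore nxt p 0 \<phi> x = \<phi> x"
| "explore nxt p (Suc n) \<phi> x = (case nxt x of None \<Rightarrow> \<phi> x | Some q \<Rightarrow>
     p x q * explore nxt p n \<phi> ((q, True) # x) +
     (1 - p x q) * explore nxt p n \<phi> ((q, False) # x))"

definition queried :: "'q \<Rightarrow> 'q history \<Rightarrow> real" where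
  "queried q x = of_bool (q \<in> fst ` set x)"

text \<open>The query rule \<open>nxt\<close>, the probabilities \<open>p\<close> and the stopping
  value \<open>h\<close> belong to X; \<open>r\<close>, the conditional mean \<open>m\<close> and
  the covariances \<open>cv\<close> belong to Y. \<open>good\<close> restricts the order of queries,
  which both histories share, and \<open>ok\<close> singles out the Y-histories of positive
  probability. \<open>cv_total\<close> is the law of total covariance with its nonnegative
  between-branches part dropped.\<close>

locale exploration =
  fixes nxt :: "'q history \<Rightarrow> 'q option"
    and p r cv :: "'q history \<Rightarrow> 'q \<Rightarrow> real"
    and m h :: "'q history \<Rightarrow> real"
    and good :: "'q list \<Rightarrow> bool"
    and ok :: "'q history \<Rightarrow> bool"
  assumes nxt_good: "good (map fst x) \<Longrightarrow> nxt x = Some q \<Longrightarrow> good (q # map fst x)"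
    and good_new: "good (q # qs) \<Longrightarrow> q \<notin> set qs"
    and p_range: "0 \<le> p x q \<and> p x q \<le> 1"
    and h_range: "0 \<le> h x \<and> h x \<le> 1"
    and r_range: "0 \<le> r y q \<and> r y q \<le> 1"
    and ok_True: "good (q # map fst y) \<Longrightarrow> ok y \<Longrightarrow> 0 < r y q \<Longrightarrow> ok ((q, True) # y)"
    and ok_False: "good (q # map fst y) \<Longrightarrow> ok y \<Longrightarrow> r y q < 1 \<Longrightarrow> ok ((q, False) # y)"
    and m_split: "good (q # map fst y) \<Longrightarrow> ok y \<Longrightarrow>
        m y = r y q * m ((q, True) # y) + (1 - r y q) * m ((q, False) # y)"
    and m_mono: "good (map fst y) \<Longrightarrow> ok y \<Longrightarrow> ok y' \<Longrightarrow> below y y' \<Longrightarrow> m y \<le> m y'"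
    and r_mono: "good (map fst y) \<Longrightarrow> ok y \<Longrightarrow> ok y' \<Longrightarrow> below y y' \<Longrightarrow> r y q \<le> r y' q"
    and cv_query: "good (q # map fst y) \<Longrightarrow> ok y \<Longrightarrow>
        cv y q = r y q * (1 - r y q) * (m ((q, True) # y) - m ((q, False) # y))"
    and cv_total: "good (q # map fst y) \<Longrightarrow> ok y \<Longrightarrow>
        r y q * cv ((q, True) # y) q' + (1 - r y q) * cv ((q, False) # y) q' \<le> cv y q'"
begin

text \<open>Expectation of \<open>h\<close> of the X-history times \<open>m\<close> of the Y-history
  when each pair of answers is read off a single uniform variable, so that both are True with
  probability min p r. The queries are chosen by X alone.\<close>

primrec coupled :: "nat \<Rightarrow> 'q history \<Rightarrow> 'q history \<Rightarrow> real" where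
  "coupled 0 x y = h x * m y"
| "coupled (Suc n) x y = (case nxt x of None \<Rightarrow> h x * m y | Some q \<Rightarrow>
     min (p x q) (r y q) * coupled n ((q, True) # x) ((q, True) # y) +
     (p x q - min (p x q) (r y q)) * coupled n ((q, True) # x) ((q, False) # y) +
     (r y q - min (p x q) (r y q)) * coupled n ((q, False) # x) ((q, True) # y) +
     (1 - p x q - r y q + min (p x q) (r y q)) * coupled n ((q, False) # x) ((q, False) # y))"

abbreviation "run \<equiv> explore nxt p"

lemma ok_split:
  "good (q # map fst y) \<Longrightarrow> ok y \<Longrightarrow> 0 < r y q \<and> b \<or> r y q < 1 \<and> \<not> b \<Longrightarrow> ok ((q, b) # y)"
  using ok_True ok_False by (cases b) auto

text \<open>Raising the Y-history raises \<open>m\<close> at every leaf, and the weight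
  \<open>h\<close> in [0,1] can only shrink the total increase. The proof couples X with two copies
  of Y at once.\<close>

lemma coupled_mono:
  "good (map fst x) \<Longrightarrow> map fst x = map fst y \<Longrightarrow> ok y \<Longrightarrow> ok y' \<Longrightarrow> below y y' \<Longrightarrow>
   0 \<le> coupled n x y' - coupled n x y \<and> coupled n x y' - coupled n x y \<le> m y' - m y"
proof (induction n arbitrary: x y y')
  case 0
  then have "m y \<le> m y'" using m_mono by metis
  then show ?case using h_range[of x]
    by (simp add: right_diff_distrib[symmetric] mult_left_le_one_le)
next
  case (Suc n)
  have gy: "good (map fst y)" using Suc.prems by simp
  have my: "m y \<le> m y'" using m_mono[OF gy] Suc.prems by blast
  show ?case
  proof (cases "nxt x")
    case None
    then show ?thesis using h_range[of x] my
      by (simp add: right_diff_distrib[symmetric] mult_left_le_one_le)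
  next
    case (Some q)
    define a where "a = p x q"
    define b where "b = r y q"
    define b' where "b' = r y' q"
    have gq: "good (q # map fst x)" using nxt_good Suc.prems Some by blast
    have gqy: "good (q # map fst y)" using gq Suc.prems by simp
    have gqy': "good (q # map fst y')" using gq Suc.prems below_queries by metis
    have a: "0 \<le> a" "a \<le> 1" and b: "0 \<le> b" "b \<le> 1" and b': "0 \<le> b'" "b' \<le> 1"
      using p_range r_range unfolding a_def b_def b'_def by auto
    have bb: "b \<le> b'" unfolding b_def b'_def using r_mono[OF gy] Suc.prems by blast
    define D where "D = (\<lambda>c i j. coupled n ((q, c) # x) ((q, j) # y') - coupled n ((q, c) # x) ((q, i) # y))"
    define M where "M = (\<lambda>i j. m ((q, j) # y') - m ((q, i) # y))"
    \<comment> \<open>A branch of weight 0 may carry an impossible history, so the induction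
      hypothesis is used only when l > 0.\<close>
    have step: "0 \<le> l * D c i j \<and> l * D c i j \<le> l * M i j"
      if "0 \<le> l" "i \<longrightarrow> j" "l > 0 \<Longrightarrow> 0 < b \<and> i \<or> b < 1 \<and> \<not> i" "l > 0 \<Longrightarrow> 0 < b' \<and> j \<or> b' < 1 \<and> \<not> j" for l c i j
    proof (cases "l > 0")
      case True
      have oks: "ok ((q, i) # y)" "ok ((q, j) # y')"
        using ok_split[OF gqy] ok_split[OF gqy'] that True Suc.prems unfolding b_def b'_def by blast+
      have "0 \<le> D c i j \<and> D c i j \<le> M i j"
        unfolding D_def M_def using Suc.IH[of "(q, c) # x" "(q, i) # y" "(q, j) # y'"] oks gq that Suc.prems
        by (simp add: below_Cons)
      then show ?thesis using True by (simp add: mult_left_mono)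
    qed (use that in simp)
    \<comment> \<open>The six terms are the possible triples of answers of x, y, y' when one uniform
      variable is compared with a, b and b'. The triples with y answered True and y' answered False
      are absent because b \<le> b'.\<close>
    have e1: "coupled (Suc n) x y' - coupled (Suc n) x y =
        min a b * D True True True + (min a b' - min a b) * D True False True
      + (a - min a b') * D True False False + (b - min a b) * D False True True
      + ((b' - min a b') - (b - min a b)) * D False False True
      + (1 - a - b' + min a b') * D False False False"
      using Some unfolding D_def a_def b_def b'_def by (simp add: algebra_simps)
    have e2: "m y' - m y =
        min a b * M True True + (min a b' - min a b) * M False True
      + (a - min a b') * M False False + (b - min a b) * M True True
      + ((b' - min a b') - (b - min a b)) * M False True
      + (1 - a - b' + min a b') * M False False"
      unfolding m_split[OF gqy \<open>ok y\<close>] m_split[OF gqy' \<open>ok y'\<close>] M_def b_def[symmetric] b'_def[symmetric]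
      by (simp add: algebra_simps)
    have s1: "0 \<le> min a b * D True True True \<and> min a b * D True True True \<le> min a b * M True True"
      by (rule step) (use a b b' bb in auto)
    have s2: "0 \<le> (min a b' - min a b) * D True False True \<and>
        (min a b' - min a b) * D True False True \<le> (min a b' - min a b) * M False True"
      by (rule step) (use a b b' bb in \<open>auto simp: min_def split: if_splits\<close>)
    have s3: "0 \<le> (a - min a b') * D True False False \<and>
        (a - min a b') * D True False False \<le> (a - min a b') * M False False"
      by (rule step) (use a b b' bb in \<open>auto simp: min_def split: if_splits\<close>)
    have s4: "0 \<le> (b - min a b) * D False True True \<and>
        (b - min a b) * D False True True \<le> (b - min a b) * M True True"
      by (rule step) (use a b b' bb in \<open>auto simp: min_def split: if_splits\<close>)
    have s5: "0 \<le> ((b' - min a b') - (b - min a b)) * D False False True \<and>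
        ((b' - min a b') - (b - min a b)) * D False False True \<le> ((b' - min a b') - (b - min a b)) * M False True"
      by (rule step) (use a b b' bb in \<open>auto simp: min_def split: if_splits\<close>)
    have s6: "0 \<le> (1 - a - b' + min a b') * D False False False \<and>
        (1 - a - b' + min a b') * D False False False \<le> (1 - a - b' + min a b') * M False False"
      by (rule step) (use a b b' bb in \<open>auto simp: min_def split: if_splits\<close>)
    show ?thesis unfolding e1 e2 using s1 s2 s3 s4 s5 s6 by linarith
  qed
qed

text \<open>The inequality of O'Donnell, Saks, Schramm and Servedio for two models. Replacing the
  coupled answers by independent ones at a single query costs at most the covariance of that query
  with the observable of Y, and the cost is paid only on runs that make the query.\<close>

lemma coupled_minus_independent:
  assumes "finite Q"
  shows "good (map fst x) \<Longrightarrow> map fst x = map fst y \<Longrightarrow> ok y \<Longrightarrow>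
     (\<And>q qs. good (q # qs) \<Longrightarrow> q \<in> Q) \<Longrightarrow>
     coupled n x y - run n h x * m y \<le> (\<Sum>q\<in>Q. (run n (queried q) x - queried q x) * cv y q)"
proof (induction n arbitrary: x y)
  case 0
  then show ?case by simp
next
  case (Suc n)
  show ?case
  proof (cases "nxt x")
    case None
    then show ?thesis by simp
  next
    case (Some q)
    define a where "a = p x q"
    define b where "b = r y q"
    have gq: "good (q # map fst x)" using nxt_good Suc.prems Some by blast
    have gqy: "good (q # map fst y)" using gq Suc.prems by simp
    have qQ: "q \<in> Q" using Suc.prems gq by blast
    have a: "0 \<le> a" "a \<le> 1" and b: "0 \<le> b" "b \<le> 1"
      using p_range r_range unfolding a_def b_def by auto
    define G where "G = (\<lambda>i j. coupled n ((q, i) # x) ((q, j) # y))"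
    define H where "H = (\<lambda>i. run n h ((q, i) # x))"
    define M where "M = (\<lambda>j. m ((q, j) # y))"
    \<comment> \<open>This is the covariance of the two coupled answers; it is at most the variance
      b (1 - b) of the Y-answer.\<close>
    define \<kappa> where "\<kappa> = min a b - a * b"
    define R where "R = (\<lambda>i q'. run n (queried q') ((q, i) # x) - queried q' ((q, i) # x))"
    define C where "C = (\<lambda>j q'. cv ((q, j) # y) q')"
    define W where "W = (\<lambda>i. if i then a else 1 - a)"
    define V where "V = (\<lambda>j. if j then b else 1 - b)"
    have R_nn: "0 \<le> R i q'" for i q'
    proof -
      have "queried q' z \<le> run n (queried q') z" for n z
      proof (induction n arbitrary: z)
        case (Suc n)
        show ?case
        proof (cases "nxt z")
          case (Some q)
          have "queried q' z \<le> queried q' ((q, b) # z)" for b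
            by (auto simp: queried_def)
          then have "queried q' z \<le> run n (queried q') ((q, b) # z)" for b
            using Suc[of "(q, b) # z"] order_trans by blast
          then have "p z q * queried q' z + (1 - p z q) * queried q' z \<le>
             p z q * run n (queried q') ((q, True) # z) + (1 - p z q) * run n (queried q') ((q, False) # z)"
            using p_range[of z q] by (intro add_mono mult_left_mono) auto
          then show ?thesis using Some by (simp add: algebra_simps)
        qed simp
      qed simp
      then show ?thesis unfolding R_def by simp
    qed
    \<comment> \<open>The coupled law of the two answers is the product law plus \<kappa> on the
      diagonal and minus \<kappa> off it, which produces the mixed second difference.\<close>
    have main: "coupled (Suc n) x y - run (Suc n) h x * m y =
       \<kappa> * (G True True - G True False - (G False True - G False False))
       + (\<Sum>i\<in>{True,False}. \<Sum>j\<in>{True,False}. W i * (V j * (G i j - H i * M j)))"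
      using Some unfolding m_split[OF gqy \<open>ok y\<close>]
      by (simp add: G_def H_def M_def \<kappa>_def W_def V_def a_def b_def algebra_simps)
    have k0: "0 \<le> \<kappa>"
    proof -
      have "a * b \<le> a" "a * b \<le> b" using a b by (auto simp: mult_left_le mult_left_le_one_le)
      then show ?thesis unfolding \<kappa>_def by simp
    qed
    have kb: "\<kappa> \<le> b * (1 - b)"
    proof (cases "a \<le> b")
      case True
      have "a * (1 - b) \<le> b * (1 - b)" using True b by (intro mult_right_mono) auto
      then show ?thesis using True unfolding \<kappa>_def by (simp add: algebra_simps)
    next
      case False
      then have "b * (1 - a) \<le> b * (1 - b)" using b by (intro mult_left_mono) auto
      then show ?thesis using False unfolding \<kappa>_def by (simp add: algebra_simps)
    qed
    have first: "\<kappa> * (G True True - G True False - (G False True - G False False)) \<le> cv y q"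
    proof (cases "0 < b \<and> b < 1")
      case True
      have oks: "ok ((q, True) # y)" "ok ((q, False) # y)"
        using ok_split[OF gqy] True Suc.prems unfolding b_def by blast+
      \<comment> \<open>The increment for i = True is at most that of \<open>m\<close>, and the
        increment for i = False, which is subtracted, is nonnegative. Hence the second difference is
        at most M True - M False.\<close>
      have l: "0 \<le> G i True - G i False \<and> G i True - G i False \<le> M True - M False" for i
        unfolding G_def M_def using coupled_mono[of "(q, i) # x" "(q, False) # y" "(q, True) # y" n] oks gq
          Suc.prems by (simp add: below_Cons below_refl)
      have "\<kappa> * (G True True - G True False - (G False True - G False False)) \<le> \<kappa> * (M True - M False)"
        using l[of True] l[of False] k0 by (intro mult_left_mono) auto
      also have "\<dots> \<le> b * (1 - b) * (M True - M False)"
        using l[of True] kb by (intro mult_right_mono) auto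
      finally show ?thesis using cv_query[OF gqy \<open>ok y\<close>] unfolding M_def b_def by simp
    next
      case False
      then have "b * (1 - b) = 0" using b by auto
      then have "\<kappa> = 0" "cv y q = 0"
        using k0 kb cv_query[OF gqy \<open>ok y\<close>] unfolding b_def by auto
      then show ?thesis by simp
    qed
    have second: "V j * (G i j - H i * M j) \<le> V j * (\<Sum>q'\<in>Q. R i q' * C j q')" for i j
    proof (cases "V j > 0")
      case True
      then have "ok ((q, j) # y)"
        using ok_split[OF gqy \<open>ok y\<close>, of j] unfolding V_def b_def by (auto split: if_splits)
      then have "G i j - H i * M j \<le> (\<Sum>q'\<in>Q. R i q' * C j q')"
        unfolding G_def H_def M_def R_def C_def using Suc.IH[of "(q, i) # x" "(q, j) # y"] gq Suc.prems by simp
      then show ?thesis using True by simp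
    next
      case False
      then have "V j = 0" using b unfolding V_def by (auto split: if_splits)
      then show ?thesis by simp
    qed
    have W: "0 \<le> W i" for i using a unfolding W_def by auto
    have "(\<Sum>i\<in>{True,False}. \<Sum>j\<in>{True,False}. W i * (V j * (G i j - H i * M j)))
       \<le> (\<Sum>i\<in>{True,False}. \<Sum>j\<in>{True,False}. W i * (V j * (\<Sum>q'\<in>Q. R i q' * C j q')))"
      by (intro sum_mono mult_left_mono second W)
    also have "\<dots> = (\<Sum>q'\<in>Q. \<Sum>i\<in>{True,False}. (W i * R i q') * (\<Sum>j\<in>{True,False}. V j * C j q'))"
      by (simp add: sum_distrib_left sum.distrib algebra_simps)
    also have "\<dots> \<le> (\<Sum>q'\<in>Q. \<Sum>i\<in>{True,False}. (W i * R i q') * cv y q')"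
    proof (intro sum_mono mult_left_mono mult_nonneg_nonneg W R_nn)
      fix q'
      show "(\<Sum>j\<in>{True,False}. V j * C j q') \<le> cv y q'"
        using cv_total[OF gqy \<open>ok y\<close>, of q'] unfolding V_def C_def b_def by simp
    qed
    finally have "coupled (Suc n) x y - run (Suc n) h x * m y
        \<le> cv y q + (\<Sum>q'\<in>Q. \<Sum>i\<in>{True,False}. (W i * R i q') * cv y q')"
      using main first by linarith
    also have "cv y q = (\<Sum>q'\<in>Q. of_bool (q' = q) * cv y q')"
      using qQ assms by (simp add: of_bool_def if_distrib[of "\<lambda>c. c * _"] sum.delta cong: if_cong)
    also have "(\<Sum>q'\<in>Q. of_bool (q' = q) * cv y q') + (\<Sum>q'\<in>Q. \<Sum>i\<in>{True,False}. (W i * R i q') * cv y q')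
       = (\<Sum>q'\<in>Q. (of_bool (q' = q) + (\<Sum>i\<in>{True,False}. W i * R i q')) * cv y q')"
      by (simp add: sum.distrib[symmetric] algebra_simps)
    also have "\<dots> = (\<Sum>q'\<in>Q. (run (Suc n) (queried q') x - queried q' x) * cv y q')"
    proof (intro sum.cong refl)
      fix q'
      have new: "q \<notin> fst ` set x" using good_new[OF gq] by simp
      have cons: "queried q' ((q, i) # x) = of_bool (q' = q) + queried q' x" for i
        using new unfolding queried_def by auto
      \<comment> \<open>The query just made contributes exactly 1 for q' = q because queries are
        never repeated.\<close>
      have "of_bool (q' = q) + (\<Sum>i\<in>{True,False}. W i * R i q') = run (Suc n) (queried q') x - queried q' x"
        using Some unfolding R_def cons by (simp add: W_def a_def algebra_simps)
      then show "(of_bool (q' = q) + (\<Sum>i\<in>{True,False}. W i * R i q')) * cv y q'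
        = (run (Suc n) (queried q') x - queried q' x) * cv y q'" by simp
    qed
    finally show ?thesis .
  qed
qed

end

section \<open>Conditioned Blume--Capel weights and their monotonicity\<close>

definition avg :: "'c set \<Rightarrow> ('c \<Rightarrow> real) \<Rightarrow> ('c \<Rightarrow> real) \<Rightarrow> real" where
  "avg S w F = (\<Sum>\<sigma>\<in>S. w \<sigma> * F \<sigma>) / (\<Sum>\<sigma>\<in>S. w \<sigma>)"

lemma avg_cong:
  assumes "\<And>\<sigma>. \<sigma> \<in> S \<Longrightarrow> w \<sigma> = c * w' \<sigma>" "c \<noteq> 0" "\<And>\<sigma>. \<sigma> \<in> S \<Longrightarrow> F \<sigma> = F' \<sigma>"
  shows "avg S w F = avg S w' F'"
proof -
  have "(\<Sum>\<sigma>\<in>S. w \<sigma> * F \<sigma>) = c * (\<Sum>\<sigma>\<in>S. w' \<sigma> * F' \<sigma>)" "(\<Sum>\<sigma>\<in>S. w \<sigma>) = c * (\<Sum>\<sigma>\<in>S. w' \<sigma>)"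
    using assms by (simp_all add: sum_distrib_left mult.assoc)
  then show ?thesis using assms(2) unfolding avg_def by simp
qed

lemma avg_gks:
  assumes "ginibre S w" "cone1 F" "cone1 G" "0 < (\<Sum>\<sigma>\<in>S. w \<sigma>)"
  shows "avg S w F * avg S w G \<le> avg S w (\<lambda>\<sigma>. F \<sigma> * G \<sigma>)"
  using gks_covariance[OF assms(1-3)] assms(4) unfolding avg_def
  by (simp add: field_simps)

lemma avg_nonneg:
  assumes "ginibre S w" "cone1 F" shows "0 \<le> avg S w F"
  using gks_nonneg[OF assms] assms(1) unfolding avg_def ginibre_def by (simp add: sum_nonneg)

text \<open>Griffiths' second inequality read as a comparison of measures: reweighting by a cone
  element raises averages of cone elements. Enlarging the set of open bonds, freezing sites at plus
  and switching on interactions are all of this form.\<close>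

lemma avg_tilt:
  assumes "ginibre S w" "cone1 F" "cone1 G" "0 < (\<Sum>\<sigma>\<in>S. w \<sigma> * G \<sigma>)" "0 < (\<Sum>\<sigma>\<in>S. w \<sigma>)"
  shows "avg S w F \<le> avg S (\<lambda>\<sigma>. w \<sigma> * G \<sigma>) F"
  using gks_covariance[OF assms(1-3)] assms(4,5) unfolding avg_def
  by (simp add: field_simps)

text \<open>The function 1 - G is not in the cone, but subtracting from the full average reduces the
  comparison to the covariance of F and G.\<close>

lemma avg_complement:
  assumes "ginibre S w" "cone1 F" "cone1 G"
    and "0 < (\<Sum>\<sigma>\<in>S. w \<sigma> * G \<sigma>)" "0 < (\<Sum>\<sigma>\<in>S. w \<sigma> * (1 - G \<sigma>))"
  shows "avg S (\<lambda>\<sigma>. w \<sigma> * (1 - G \<sigma>)) F \<le> avg S (\<lambda>\<sigma>. w \<sigma> * G \<sigma>) F"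
proof -
  have a: "(\<Sum>\<sigma>\<in>S. w \<sigma> * (1 - G \<sigma>)) = (\<Sum>\<sigma>\<in>S. w \<sigma>) - (\<Sum>\<sigma>\<in>S. w \<sigma> * G \<sigma>)"
    by (simp add: sum_subtractf right_diff_distrib)
  have b: "(\<Sum>\<sigma>\<in>S. w \<sigma> * (1 - G \<sigma>) * F \<sigma>) = (\<Sum>\<sigma>\<in>S. w \<sigma> * F \<sigma>) - (\<Sum>\<sigma>\<in>S. w \<sigma> * (F \<sigma> * G \<sigma>))"
    by (simp add: sum_subtractf algebra_simps)
  have c: "(\<Sum>\<sigma>\<in>S. w \<sigma> * G \<sigma> * F \<sigma>) = (\<Sum>\<sigma>\<in>S. w \<sigma> * (F \<sigma> * G \<sigma>))"
    by (simp add: algebra_simps)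
  show ?thesis
    using gks_covariance[OF assms(1-3)] assms(4,5) unfolding avg_def a b c
    by (simp add: field_simps)
qed

section \<open>Canonical form of a conditioned weight\<close>

definition bond :: "'v set \<Rightarrow> ('v \<Rightarrow> int) \<Rightarrow> real" where
  "bond e \<sigma> = (\<Prod>v\<in>e. real_of_int (\<sigma> v))"

lemma cone1_bond: "cone1 (bond e)"
  unfolding bond_def[abs_def] by (intro cone1_prod cone1_coord)

lemma bond_values: "\<sigma> \<in> spins U \<Longrightarrow> bond e \<sigma> \<in> {-1,0,1}"
  unfolding bond_def
proof (induction e rule: infinite_finite_induct)
  case (insert v e)
  then show ?case using spins_value[of \<sigma> U v] by auto
qed auto

lemma bond_abs:
  assumes "\<sigma> \<in> spins U" "\<And>v. v \<in> e \<Longrightarrow> \<sigma> v \<noteq> 0" shows "\<bar>bond e \<sigma>\<bar> = 1"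
proof -
  have "bond e \<sigma> \<noteq> 0" using assms(2) unfolding bond_def by (cases "finite e") auto
  then show ?thesis using bond_values[OF assms(1), of e] by auto
qed

datatype 'v query = Site 'v | Bond "'v set"

text \<open>\<open>V\<close> is a reference volume. Bonds in \<open>Es\<close> may leave it; with
  outside spins frozen at 1 they become boundary terms, so the same weight on a subset U gives the
  plus model in U up to a constant factor.\<close>

locale blume_capel =
  fixes V :: "'v set" and Es :: "'v set set" and \<beta> \<Delta> :: real
  assumes finite_V: "finite V" and finite_Es: "finite Es" and card_bond: "\<And>e. e \<in> Es \<Longrightarrow> card e = 2"
    and beta_pos: "0 < \<beta>"
begin

definition site_weight :: "bool option \<Rightarrow> int \<Rightarrow> real" where
  "site_weight b s = (case b of None \<Rightarrow> 1 | Some True \<Rightarrow> (real_of_int s)\<^sup>2 | Some False \<Rightarrow> 1 - (real_of_int s)\<^sup>2)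
     * exp (\<Delta> * (real_of_int s)\<^sup>2)"

text \<open>R holds the bonds that still interact and Op those found open. On occupied ends 1 +
  \<open>bond e \<sigma>\<close> is twice the indicator of alignment; closed bonds leave no factor
  at all.\<close>

definition canon :: "'v set \<Rightarrow> ('v \<Rightarrow> bool option) \<Rightarrow> 'v set set \<Rightarrow> 'v set set \<Rightarrow> ('v \<Rightarrow> int) \<Rightarrow> real" where
  "canon U st R Op \<sigma> = (\<Prod>v\<in>U. site_weight (st v) (\<sigma> v)) * exp (\<beta> * (\<Sum>e\<in>R. bond e \<sigma>)) * (\<Prod>e\<in>Op. 1 + bond e \<sigma>)"

definition occupied :: "'v set \<Rightarrow> ('v \<Rightarrow> bool option) \<Rightarrow> 'v set set \<Rightarrow> bool" where
  "occupied U st Op \<longleftrightarrow> finite Op \<and> (\<forall>e\<in>Op. \<forall>v\<in>e. v \<in> U \<longrightarrow> st v = Some True)"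

lemma canon_support:
  assumes "finite U" "canon U st R Op \<sigma> \<noteq> 0" "\<sigma> \<in> spins U" "v \<in> U"
  shows "st v = Some True \<Longrightarrow> \<sigma> v \<noteq> 0" "st v = Some False \<Longrightarrow> \<sigma> v = 0"
proof -
  have "site_weight (st v) (\<sigma> v) \<noteq> 0"
    using assms unfolding canon_def by auto
  then show "st v = Some True \<Longrightarrow> \<sigma> v \<noteq> 0" "st v = Some False \<Longrightarrow> \<sigma> v = 0"
    using spins_value[OF assms(3), of v] unfolding site_weight_def by auto
qed

text \<open>Even one-site weights give a product, the remaining bonds an exponential of a cone
  element, and each open bond a factor 1 + b with b = \<plusminus>1 on the support.\<close>

lemma canon_ginibre:
  assumes fin: "finite U" and "occupied U st Op"
  shows "ginibre (spins U) (canon U st R Op)"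
proof -
  have "finite Op" using assms unfolding occupied_def by simp
  then show ?thesis using assms(2)
  proof (induction Op rule: finite_induct)
    case empty
    have "ginibre (spins U) (\<lambda>\<sigma>. \<Prod>v\<in>U. site_weight (st v) (\<sigma> v))"
      by (rule ginibre_product[OF fin]) (auto simp: site_weight_def split: option.splits bool.splits)
    then have "ginibre (spins U) (\<lambda>\<sigma>. (\<Prod>v\<in>U. site_weight (st v) (\<sigma> v)) * exp (\<beta> * (\<Sum>e\<in>R. bond e \<sigma>)))"
      by (rule ginibre_exp) (use beta_pos in \<open>auto intro!: cone1_scale cone1_sum cone1_bond\<close>)
    then show ?case by (rule ginibre_cong[rotated]) (simp add: canon_def)
  next
    case (insert e Op)
    have "ginibre (spins U) (\<lambda>\<sigma>. canon U st R Op \<sigma> * (1 + bond e \<sigma>))"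
    proof (rule ginibre_one_plus[OF _ cone1_bond])
      show "ginibre (spins U) (canon U st R Op)" using insert unfolding occupied_def by auto
      fix \<sigma> assume s: "\<sigma> \<in> spins U" "canon U st R Op \<sigma> \<noteq> 0"
      show "\<bar>bond e \<sigma>\<bar> = 1"
      proof (rule bond_abs[OF s(1)])
        fix v assume "v \<in> e"
        then show "\<sigma> v \<noteq> 0"
          using insert.prems canon_support(1)[OF fin s(2,1), of v] spins_outside[OF s(1), of v]
          unfolding occupied_def by (cases "v \<in> U") auto
      qed
    qed
    then show ?case by (rule ginibre_cong[rotated]) (use insert.hyps in \<open>simp add: canon_def mult_ac\<close>)
  qed
qed

lemma canon_pos:
  assumes fin: "finite U" and "occupied U st Op"
  shows "0 < (\<Sum>\<sigma>\<in>spins U. canon U st R Op \<sigma>)"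
proof -
  \<comment> \<open>Plus everywhere except at the sites known to be vacant: each open bond then
    contributes a positive factor.\<close>
  define \<sigma> where "\<sigma> = (\<lambda>v. if v \<in> U \<and> st v = Some False then 0 else 1::int)"
  have s: "\<sigma> \<in> spins U" unfolding \<sigma>_def spins_def by auto
  have "0 < site_weight (st v) (\<sigma> v)" if "v \<in> U" for v
    using that unfolding \<sigma>_def site_weight_def by (auto split: option.splits bool.splits)
  then have "0 < (\<Prod>v\<in>U. site_weight (st v) (\<sigma> v))" by (intro prod_pos) auto
  moreover have "0 \<le> bond e \<sigma>" for e unfolding bond_def \<sigma>_def by (intro prod_nonneg) auto
  then have "0 < (\<Prod>e\<in>Op. 1 + bond e \<sigma>)" by (intro prod_pos) (smt (verit))
  ultimately have "0 < canon U st R Op \<sigma>" unfolding canon_def by simp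
  moreover have "0 \<le> canon U st R Op \<sigma>" if "\<sigma> \<in> spins U" for \<sigma>
    using canon_ginibre[OF assms] that unfolding ginibre_def by blast
  ultimately show ?thesis using s finite_spins[OF fin] by (intro sum_pos2[of _ \<sigma>]) auto
qed

text \<open>Forgetting the status of \<open>v\<close> gives one weight of which the vacant and the
  occupied versions are the complementary reweightings by 1 - s^2 and s^2, s being the spin at
  \<open>v\<close>. No open bond meets the vacant site, so both versions remain in the
  class.\<close>

lemma canon_fill_site:
  assumes fin: "finite U" and occ: "occupied U st Op" and F: "cone1 F" and v: "v \<in> U" "st v = Some False"
  shows "avg (spins U) (canon U st R Op) F \<le> avg (spins U) (canon U (st(v := Some True)) R Op) F"
proof -
  let ?w = "canon U (st(v := None)) R Op"
  have out: "v \<notin> e" if "e \<in> Op" for e using occ v that unfolding occupied_def by auto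
  have occ': "occupied U (st(v := b)) Op" for b using occ out unfolding occupied_def by auto
  have w: "canon U (st(v := b)) R Op \<sigma> = ?w \<sigma> * (case b of None \<Rightarrow> 1 | Some True \<Rightarrow> (real_of_int (\<sigma> v))\<^sup>2
     | Some False \<Rightarrow> 1 - (real_of_int (\<sigma> v))\<^sup>2)" for b \<sigma>
  proof -
    have "(\<Prod>u\<in>U - {v}. site_weight ((st(v := b)) u) (\<sigma> u)) = (\<Prod>u\<in>U - {v}. site_weight ((st(v := None)) u) (\<sigma> u))"
      by (intro prod.cong) auto
    then show ?thesis unfolding canon_def prod.remove[OF fin v(1)]
      by (simp add: site_weight_def)
  qed
  have st: "st = st(v := Some False)" using v by auto
  have F0: "canon U st R Op = (\<lambda>\<sigma>. ?w \<sigma> * (1 - (real_of_int (\<sigma> v))\<^sup>2))"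
    using w[of "Some False"] by (subst st) (simp add: fun_eq_iff)
  have F1: "canon U (st(v := Some True)) R Op = (\<lambda>\<sigma>. ?w \<sigma> * (real_of_int (\<sigma> v))\<^sup>2)"
    using w[of "Some True"] by (simp add: fun_eq_iff)
  show ?thesis
    unfolding F0 F1
  proof (rule avg_complement[OF canon_ginibre[OF fin occ'] F])
    show "cone1 (\<lambda>\<sigma>. (real_of_int (\<sigma> v))\<^sup>2)" by (intro cone1_power cone1_coord)
    show "0 < (\<Sum>\<sigma>\<in>spins U. ?w \<sigma> * (real_of_int (\<sigma> v))\<^sup>2)"
      using canon_pos[OF fin occ', of "Some True" R] F1 by simp
    show "0 < (\<Sum>\<sigma>\<in>spins U. ?w \<sigma> * (1 - (real_of_int (\<sigma> v))\<^sup>2))"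
      using canon_pos[OF fin occ, of R] F0 by simp
  qed
qed

lemma canon_fill_sites:
  assumes fin: "finite U" and occ: "occupied U st Op" and F: "cone1 F"
    and D: "finite D" "D \<subseteq> {v\<in>U. st v = Some False}"
  shows "avg (spins U) (canon U st R Op) F
     \<le> avg (spins U) (canon U (\<lambda>v. if v \<in> D then Some True else st v) R Op) F"
  using D
proof (induction D rule: finite_induct)
  case (insert v D)
  let ?st = "\<lambda>u. if u \<in> D then Some True else st u"
  have occ': "occupied U ?st Op" using occ unfolding occupied_def by auto
  have e: "(\<lambda>u. if u \<in> insert v D then Some True else st u) = ?st(v := Some True)" by auto
  have "avg (spins U) (canon U ?st R Op) F \<le> avg (spins U) (canon U (?st(v := Some True)) R Op) F"
    by (rule canon_fill_site[OF fin occ' F]) (use insert in auto)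
  then show ?case using insert unfolding e by force
qed simp

lemma canon_open_bonds:
  assumes fin: "finite U" and occ: "occupied U st Op'" and F: "cone1 F" and sub: "Op \<subseteq> Op'"
  shows "avg (spins U) (canon U st R Op) F \<le> avg (spins U) (canon U st R Op') F"
proof -
  have occ': "occupied U st Op" using occ sub finite_subset unfolding occupied_def by blast
  have f': "finite Op'" using occ unfolding occupied_def by simp
  have e: "canon U st R Op' = (\<lambda>\<sigma>. canon U st R Op \<sigma> * (\<Prod>e\<in>Op' - Op. 1 + bond e \<sigma>))"
    unfolding canon_def prod.subset_diff[OF sub f'] by (simp add: fun_eq_iff mult_ac)
  show ?thesis unfolding e
  proof (rule avg_tilt[OF canon_ginibre[OF fin occ'] F])
    show "cone1 (\<lambda>\<sigma>. \<Prod>e\<in>Op' - Op. 1 + bond e \<sigma>)"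
      by (intro cone1_prod cone1_add[OF cone1_const[of 1] cone1_bond]) auto
    show "0 < (\<Sum>\<sigma>\<in>spins U. canon U st R Op \<sigma> * (\<Prod>e\<in>Op' - Op. 1 + bond e \<sigma>))"
      using canon_pos[OF fin occ, of R] unfolding e by simp
    show "0 < (\<Sum>\<sigma>\<in>spins U. canon U st R Op \<sigma>)" by (rule canon_pos[OF fin occ'])
  qed
qed

section \<open>Edwards--Sokal queries and histories as reweightings\<close>

definition answer :: "'v query \<Rightarrow> ('v \<Rightarrow> int) \<Rightarrow> real" where
  "answer q \<sigma> = (case q of Site v \<Rightarrow> (real_of_int (\<sigma> v))\<^sup>2
     | Bond e \<Rightarrow> (1 - exp (- 2 * \<beta>)) * ((bond e \<sigma> + (bond e \<sigma>)\<^sup>2) / 2))"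

definition base_weight :: "('v \<Rightarrow> int) \<Rightarrow> real" where
  "base_weight \<sigma> = exp (\<Delta> * (\<Sum>v\<in>V. (real_of_int (\<sigma> v))\<^sup>2) + \<beta> * (\<Sum>e\<in>Es. bond e \<sigma>))"

text \<open>\<open>answer\<close> is the probability of True given the spins: occupation for a site
  and, for a bond, 1 - exp (-2\<beta>) if the product of its spins is 1 and 0 otherwise. Multiplying
  by the likelihood of the answers integrates out the bond randomness, so a history is a reweighting
  of the spin measure.\<close>

fun weight :: "'v query history \<Rightarrow> ('v \<Rightarrow> int) \<Rightarrow> real" where
  "weight [] \<sigma> = base_weight \<sigma>"
| "weight ((q, b) # H) \<sigma> = weight H \<sigma> * (if b then answer q \<sigma> else 1 - answer q \<sigma>)"

abbreviation "mean U H \<equiv> avg (spins U) (weight H)"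

text \<open>The condition involves the queries but not the answers, so it passes between coupled
  histories. A bond is asked only after both of its ends.\<close>

fun good :: "'v query list \<Rightarrow> bool" where
  "good [] = True"
| "good (q # qs) \<longleftrightarrow> good qs \<and> q \<notin> set qs \<and> (case q of Site v \<Rightarrow> v \<in> \<Union>Es
     | Bond e \<Rightarrow> e \<in> Es \<and> (\<forall>v\<in>e. Site v \<in> set qs))"

definition valid :: "'v set \<Rightarrow> 'v query history \<Rightarrow> bool" where
  "valid U H \<longleftrightarrow> 0 < (\<Sum>\<sigma>\<in>spins U. weight H \<sigma>)"

definition status :: "'v query history \<Rightarrow> 'v \<Rightarrow> bool option" where
  "status H v = (if (Site v, True) \<in> set H then Some True else if (Site v, False) \<in> set H then Some False else None)"

definition open_bonds :: "'v query history \<Rightarrow> 'v set set" where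
  "open_bonds H = {e. (Bond e, True) \<in> set H}"

text \<open>A queried bond loses its Boltzmann factor whichever way it was answered; an open one
  reappears among the factors 1 + \<open>bond e \<sigma>\<close>.\<close>

definition active :: "'v query history \<Rightarrow> 'v set set" where
  "active H = Es - {e. Bond e \<in> fst ` set H}"

lemma exp_range: "0 < exp (- 2 * \<beta>)" "exp (- 2 * \<beta>) < 1"
  using beta_pos by auto

lemma answer_range:
  assumes "\<sigma> \<in> spins U" shows "0 \<le> answer q \<sigma> \<and> answer q \<sigma> \<le> 1"
proof (cases q)
  case (Site v)
  then show ?thesis using spins_value[OF assms, of v] by (auto simp: answer_def)
next
  case (Bond e)
  then show ?thesis using bond_values[OF assms, of e] exp_range by (auto simp: answer_def)
qed

lemma cone1_answer: "cone1 (answer q)"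
proof (cases q)
  case (Site v)
  then show ?thesis using cone1_power[OF cone1_coord, of v 2] unfolding answer_def[abs_def] by simp
next
  case (Bond e)
  have "cone1 (\<lambda>\<sigma>. ((1 - exp (- 2 * \<beta>)) / 2) * (bond e \<sigma> + (bond e \<sigma>)\<^sup>2))"
    using exp_range by (intro cone1_scale cone1_add cone1_bond cone1_power) auto
  then show ?thesis using Bond unfolding answer_def[abs_def] by simp
qed

lemma weight_nonneg: "\<sigma> \<in> spins U \<Longrightarrow> 0 \<le> weight H \<sigma>"
proof (induction H)
  case (Cons a H)
  obtain q b where [simp]: "a = (q, b)" by force
  show ?case using Cons answer_range[of \<sigma> U q] by auto
qed (simp add: base_weight_def)

lemma weight_factor: "weight H \<sigma> \<noteq> 0 \<Longrightarrow> (q, b) \<in> set H \<Longrightarrow> (if b then answer q \<sigma> else 1 - answer q \<sigma>) \<noteq> 0"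
proof (induction H)
  case (Cons a H)
  then show ?case by (cases a) auto
qed simp

lemma valid_witness:
  assumes "finite U" shows "valid U H \<longleftrightarrow> (\<exists>\<sigma>\<in>spins U. weight H \<sigma> \<noteq> 0)"
proof
  show "valid U H \<Longrightarrow> \<exists>\<sigma>\<in>spins U. weight H \<sigma> \<noteq> 0"
    unfolding valid_def using sum.neutral[of "spins U" "weight H"] by fastforce
  assume "\<exists>\<sigma>\<in>spins U. weight H \<sigma> \<noteq> 0"
  then obtain \<sigma> where "\<sigma> \<in> spins U" "weight H \<sigma> \<noteq> 0" by blast
  then show "valid U H"
    using finite_spins[OF assms] weight_nonneg[of \<sigma> U H] weight_nonneg[of _ U H]
    unfolding valid_def by (intro sum_pos2[of _ \<sigma>]) (auto simp: less_le)
qed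

lemma valid_tl: "finite U \<Longrightarrow> valid U (a # H) \<Longrightarrow> valid U H"
  by (cases a) (auto simp: valid_witness)

lemma bond_finite: "e \<in> Es \<Longrightarrow> finite e"
  using card_bond card.infinite by fastforce

lemma good_bond: "good qs \<Longrightarrow> Bond e \<in> set qs \<Longrightarrow> e \<in> Es \<and> (\<forall>v\<in>e. Site v \<in> set qs)"
  by (induction qs) auto

lemma status_queried: "Site v \<in> set (map fst H) \<Longrightarrow> status H v \<noteq> None"
proof -
  assume "Site v \<in> set (map fst H)"
  then obtain b where "(Site v, b) \<in> set H" by auto
  then show ?thesis unfolding status_def by (cases b) auto
qed

text \<open>A configuration of positive weight witnesses both claims: an open bond has nonzero spins
  at its ends, and a vacant site cannot lie outside U, where all spins are 1.\<close>

lemma valid_occupied: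
  assumes fin: "finite U" and good: "good (map fst H)" and valid: "valid U H"
  shows "occupied U (status H) (open_bonds H)"
    and "(Site v, False) \<in> set H \<Longrightarrow> v \<in> U"
proof -
  obtain \<sigma> where s: "\<sigma> \<in> spins U" "weight H \<sigma> \<noteq> 0" using valid valid_witness[OF fin] by auto
  have zero: "\<sigma> v = 0" if "(Site v, False) \<in> set H" for v
    using weight_factor[OF s(2) that] spins_value[OF s(1), of v] by (auto simp: answer_def)
  show "(Site v, False) \<in> set H \<Longrightarrow> v \<in> U" using zero[of v] spins_outside[OF s(1), of v] by auto
  show "occupied U (status H) (open_bonds H)"
    unfolding occupied_def
  proof (intro conjI ballI impI)
    have "open_bonds H \<subseteq> (\<lambda>q. case q of Bond e \<Rightarrow> e | Site v \<Rightarrow> {v}) ` fst ` set H"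
      unfolding open_bonds_def by force
    then show "finite (open_bonds H)" by (rule finite_subset) auto
    fix e v assume e: "e \<in> open_bonds H" and v: "v \<in> e"
    then have eH: "(Bond e, True) \<in> set H" unfolding open_bonds_def by simp
    then have q: "e \<in> Es" "Site v \<in> set (map fst H)"
      using good_bond[OF good, of e] v by force+
    have "bond e \<sigma> \<noteq> 0" using weight_factor[OF s(2) eH] by (auto simp: answer_def)
    then have "\<sigma> v \<noteq> 0" using v bond_finite[OF q(1)] unfolding bond_def by auto
    then have "(Site v, False) \<notin> set H" using zero by blast
    then show "status H v = Some True" using status_queried[OF q(2)] unfolding status_def by (auto split: if_splits)
  qed
qed

lemma occupied_nonzero:
  assumes "finite U" "canon U st R Op \<sigma> \<noteq> 0" "\<sigma> \<in> spins U" "v \<in> U \<Longrightarrow> st v = Some True"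
  shows "\<sigma> v \<noteq> 0"
  using assms canon_support(1)[OF assms(1-3), of v] spins_outside[OF assms(3), of v] by (cases "v \<in> U") auto

text \<open>The step that keeps conditioning inside the Ginibre class. A site answer only changes a
  status; a bond answer combines with exp (\<beta> b) to a constant times 1 + b or times 1, because
  the occupation of both ends is already part of the history.\<close>

lemma weight_canon:
  assumes fin: "finite U" and sub: "U \<subseteq> V"
  shows "good (map fst H) \<Longrightarrow> valid U H \<Longrightarrow>
    \<exists>c>0. \<forall>\<sigma>\<in>spins U. weight H \<sigma> = c * canon U (status H) (active H) (open_bonds H) \<sigma>"
proof (induction H)
  case Nil
  have "weight [] \<sigma> = exp (\<Delta> * real (card (V - U))) * canon U (status []) (active []) (open_bonds []) \<sigma>"
    if s: "\<sigma> \<in> spins U" for \<sigma>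
  proof -
    have "(\<Sum>v\<in>V. (real_of_int (\<sigma> v))\<^sup>2) = (\<Sum>v\<in>V - U. (real_of_int (\<sigma> v))\<^sup>2) + (\<Sum>v\<in>U. (real_of_int (\<sigma> v))\<^sup>2)"
      using sum.subset_diff[OF sub finite_V] by blast
    also have "(\<Sum>v\<in>V - U. (real_of_int (\<sigma> v))\<^sup>2) = real (card (V - U))"
      using spins_outside[OF s] by simp
    finally show ?thesis
      unfolding canon_def status_def active_def open_bonds_def site_weight_def
      by (simp add: base_weight_def distrib_left exp_add sum_distrib_left exp_sum[OF fin])
  qed
  then show ?case by (intro exI[of _ "exp (\<Delta> * real (card (V - U)))"]) auto
next
  case (Cons a H)
  obtain q b where a [simp]: "a = (q, b)" by force
  have gH: "good (map fst H)" and vH: "valid U H"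
    using Cons.prems valid_tl[OF fin] by auto
  obtain c where c: "c > 0" "\<And>\<sigma>. \<sigma> \<in> spins U \<Longrightarrow> weight H \<sigma> = c * canon U (status H) (active H) (open_bonds H) \<sigma>"
    using Cons.IH[OF gH vH] by auto
  note occ = valid_occupied[OF fin Cons.prems]
  show ?case
  proof (cases q)
    case (Site v)
    have new: "(Site v, b') \<notin> set H" for b' using Cons.prems Site by force
    have st: "status (a # H) = (status H)(v := Some b)" and sv: "status H v = None"
      using new unfolding status_def by (auto simp: Site fun_eq_iff)
    have AO: "active (a # H) = active H" "open_bonds (a # H) = open_bonds H"
      unfolding active_def open_bonds_def by (auto simp: Site)
    have "weight (a # H) \<sigma> = c * canon U (status (a # H)) (active (a # H)) (open_bonds (a # H)) \<sigma>"
      if s: "\<sigma> \<in> spins U" for \<sigma>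
    proof (cases "v \<in> U")
      case True
      have "(\<Prod>u\<in>U - {v}. site_weight (((status H)(v := Some b)) u) (\<sigma> u)) = (\<Prod>u\<in>U - {v}. site_weight (status H u) (\<sigma> u))"
        by (intro prod.cong) auto
      then show ?thesis unfolding st AO canon_def prod.remove[OF fin True]
        using c(2)[OF s] by (simp add: sv Site answer_def site_weight_def canon_def prod.remove[OF fin True])
    next
      case False
      \<comment> \<open>A site outside U always carries spin 1, so a history of positive probability
        answers True and no factor appears.\<close>
      then have b: "b" using occ(2)[of v] by (cases b) (auto simp: Site)
      have "(\<Prod>u\<in>U. site_weight (((status H)(v := Some b)) u) (\<sigma> u)) = (\<Prod>u\<in>U. site_weight (status H u) (\<sigma> u))"
        using False by (intro prod.cong) auto
      then show ?thesis unfolding st AO canon_def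
        using c(2)[OF s] b spins_outside[OF s False] by (simp add: Site answer_def canon_def)
    qed
    then show ?thesis using c(1) by blast
  next
    case (Bond e)
    have e: "e \<in> Es" "Bond e \<notin> set (map fst H)" "\<And>v. v \<in> e \<Longrightarrow> Site v \<in> set (map fst H)"
      using Cons.prems by (auto simp: Bond)
    have st: "status (a # H) = status H" unfolding status_def by (auto simp: Bond fun_eq_iff)
    have eA: "e \<in> active H" and A: "active (a # H) = active H - {e}" and fA: "finite (active H)"
      using e finite_Es unfolding active_def by (auto simp: Bond)
    have eO: "e \<notin> open_bonds H" using e unfolding open_bonds_def by force
    have fO: "finite (open_bonds H)" using valid_occupied(1)[OF fin gH vH] unfolding occupied_def by simp
    define L where "L = (\<lambda>\<sigma>. canon U (status H) (active H - {e}) (open_bonds H) \<sigma>)"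
    have L: "canon U (status H) (active H) (open_bonds H) \<sigma> = L \<sigma> * exp (\<beta> * bond e \<sigma>)" for \<sigma>
      unfolding L_def canon_def by (simp add: sum.remove[OF fA eA] distrib_left exp_add)
    let ?k = "1 - exp (- 2 * \<beta>)"
    show ?thesis
    proof (cases b)
      case True
      have O: "open_bonds (a # H) = insert e (open_bonds H)"
        unfolding open_bonds_def using True by (auto simp: Bond)
      have "weight (a # H) \<sigma> = (c * (exp \<beta> * ?k / 2)) * canon U (status (a # H)) (active (a # H)) (open_bonds (a # H)) \<sigma>"
        if s: "\<sigma> \<in> spins U" for \<sigma>
      proof -
        \<comment> \<open>Both ends are occupied on the support, so b = \<plusminus>1, and both
          sides vanish at -1 and agree at 1.\<close>
        have "L \<sigma> * (exp (\<beta> * bond e \<sigma>) * (?k * ((bond e \<sigma> + (bond e \<sigma>)\<^sup>2) / 2))) = L \<sigma> * (exp \<beta> * ?k / 2 * (1 + bond e \<sigma>))"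
        proof (cases "L \<sigma> = 0")
          case False
          have "\<bar>bond e \<sigma>\<bar> = 1"
          proof (rule bond_abs[OF s])
            fix v assume "v \<in> e"
            then show "\<sigma> v \<noteq> 0"
              using occupied_nonzero[OF fin _ s, of "status H" "active H - {e}" "open_bonds H" v] False occ(1)
              unfolding L_def occupied_def O st by auto
          qed
          then have "bond e \<sigma> = 1 \<or> bond e \<sigma> = -1" by auto
          then show ?thesis by auto
        qed simp
        moreover have "canon U (status H) (active H - {e}) (insert e (open_bonds H)) \<sigma> = L \<sigma> * (1 + bond e \<sigma>)"
          unfolding L_def canon_def using fO eO by (simp add: mult_ac)
        ultimately show ?thesis
          unfolding st A O using c(2)[OF s] True by (simp add: Bond L answer_def mult_ac)
      qed
      moreover have "c * (exp \<beta> * ?k / 2) > 0" using c(1) exp_range by simp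
      ultimately show ?thesis by blast
    next
      case False
      have O: "open_bonds (a # H) = open_bonds H"
        unfolding open_bonds_def using False by (auto simp: Bond)
      define all where "all \<longleftrightarrow> (\<forall>v\<in>e. v \<in> U \<longrightarrow> status H v = Some True)"
      \<comment> \<open>Between occupied ends a closed bond contributes exp (-\<beta>) for either
        sign: exp \<beta> times exp (-2\<beta>) if aligned, exp (-\<beta>) itself otherwise. With a
        vacant end the factor is 1. All ends have been queried, so the history together with U
        decides which case holds.\<close>
      define d where "d = (if all then exp (- \<beta>) else 1)"
      have "weight (a # H) \<sigma> = (c * d) * canon U (status (a # H)) (active (a # H)) (open_bonds (a # H)) \<sigma>"
        if s: "\<sigma> \<in> spins U" for \<sigma>
      proof -
        have "L \<sigma> * (exp (\<beta> * bond e \<sigma>) * (1 - ?k * ((bond e \<sigma> + (bond e \<sigma>)\<^sup>2) / 2))) = L \<sigma> * d"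
        proof (cases "L \<sigma> = 0")
          case L0: False
          show ?thesis
          proof (cases all)
            case True
            have "\<bar>bond e \<sigma>\<bar> = 1"
            proof (rule bond_abs[OF s])
              fix v assume "v \<in> e"
              then show "\<sigma> v \<noteq> 0"
                using occupied_nonzero[OF fin _ s, of "status H" "active H - {e}" "open_bonds H" v] L0 True
                unfolding L_def all_def by auto
            qed
            then have "bond e \<sigma> = 1 \<or> bond e \<sigma> = -1" by auto
            moreover have "exp \<beta> * exp (- 2 * \<beta>) = exp (- \<beta>)" by (simp add: exp_add[symmetric])
            moreover have "exp \<beta> * (1 - ?k * ((1 + 1\<^sup>2) / 2)) = exp \<beta> * exp (- 2 * \<beta>)" by (simp add: field_simps)
            ultimately show ?thesis using True by (elim disjE) (simp_all only: d_def, simp_all)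
          next
            case False
            then obtain v where v: "v \<in> e" "v \<in> U" "status H v \<noteq> Some True" unfolding all_def by blast
            then have "status H v = Some False" using status_queried[OF e(3)[OF v(1)]] by auto
            then have "\<sigma> v = 0" using canon_support(2)[OF fin L0[unfolded L_def] s v(2)] by simp
            then have "bond e \<sigma> = 0" using v(1) bond_finite[OF e(1)] unfolding bond_def by force
            then show ?thesis using False by (simp add: d_def)
          qed
        qed simp
        then show ?thesis
          unfolding st A O using c(2)[OF s] False by (simp add: Bond L L_def[symmetric] answer_def mult_ac)
      qed
      moreover have "c * d > 0" using c(1) by (simp add: d_def)
      ultimately show ?thesis by blast
    qed
  qed
qed

lemma weight_ginibre:
  assumes fin: "finite U" and "U \<subseteq> V" "good (map fst H)" "valid U H"
  shows "ginibre (spins U) (weight H)"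
proof -
  obtain c where c: "c > 0" "\<And>\<sigma>. \<sigma> \<in> spins U \<Longrightarrow> weight H \<sigma> = c * canon U (status H) (active H) (open_bonds H) \<sigma>"
    using weight_canon[OF assms] by auto
  have "ginibre (spins U) (\<lambda>\<sigma>. c * canon U (status H) (active H) (open_bonds H) \<sigma>)"
    using canon_ginibre[OF fin valid_occupied(1)[OF fin assms(3,4)]] c(1) by (intro ginibre_scale) auto
  then show ?thesis by (rule ginibre_cong[rotated]) (simp add: c(2))
qed

text \<open>The lower history is raised to the upper one by first filling vacant sites and then
  opening bonds. The order matters: the bonds open in \<open>x\<close> may have ends that are vacant
  in \<open>y\<close>.\<close>

lemma mean_history_mono:
  assumes fin: "finite U" and sub: "U \<subseteq> V" and gy: "good (map fst y)" and vy: "valid U y" and vx: "valid U x"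
    and le: "below y x" and F: "cone1 F"
  shows "mean U y F \<le> mean U x F"
proof -
  have q: "map fst y = map fst x" by (rule below_queries[OF le])
  have gx: "good (map fst x)" using gy q by simp
  obtain c where c: "c > 0" "\<And>\<sigma>. \<sigma> \<in> spins U \<Longrightarrow> weight y \<sigma> = c * canon U (status y) (active y) (open_bonds y) \<sigma>"
    using weight_canon[OF fin sub gy vy] by auto
  obtain d where d: "d > 0" "\<And>\<sigma>. \<sigma> \<in> spins U \<Longrightarrow> weight x \<sigma> = d * canon U (status x) (active x) (open_bonds x) \<sigma>"
    using weight_canon[OF fin sub gx vx] by auto
  have occy: "occupied U (status y) (open_bonds y)" by (rule valid_occupied(1)[OF fin gy vy])
  have occx: "occupied U (status x) (open_bonds x)" by (rule valid_occupied(1)[OF fin gx vx])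
  have A: "active x = active y" unfolding active_def using q by (metis set_map)
  have O: "open_bonds y \<subseteq> open_bonds x" unfolding open_bonds_def using below_True[OF le] by blast
  define D where "D = {v\<in>U. status y v = Some False \<and> status x v = Some True}"
  define st where "st = (\<lambda>v. if v \<in> D then Some True else status y v)"
  have st: "st v = status x v" if "v \<in> U" for v
  proof -
    have "Site v \<in> fst ` set y \<longleftrightarrow> Site v \<in> fst ` set x"
      using q by (metis list.set_map)
    moreover have "Site v \<in> fst ` set z \<longleftrightarrow> (Site v, True) \<in> set z \<or> (Site v, False) \<in> set z" for z :: "'v query history"
      unfolding ex_bool_eq[of "\<lambda>b. (Site v, b) \<in> set z", symmetric] by force
    ultimately have iff: "(Site v, True) \<in> set y \<or> (Site v, False) \<in> set y \<longleftrightarrow> (Site v, True) \<in> set x \<or> (Site v, False) \<in> set x"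
      by simp
    have "(Site v, True) \<in> set y \<Longrightarrow> (Site v, True) \<in> set x" using below_True[OF le] .
    then show ?thesis using that iff unfolding st_def D_def status_def by (auto split: if_splits)
  qed
  have eq: "canon U st R Op = canon U (status x) R Op" for R Op
    unfolding canon_def using st by (intro ext) (simp cong: prod.cong)
  have "mean U y F = avg (spins U) (canon U (status y) (active y) (open_bonds y)) F"
    using c by (intro avg_cong[where c = c]) auto
  also have "\<dots> \<le> avg (spins U) (canon U st (active y) (open_bonds y)) F"
    unfolding st_def by (rule canon_fill_sites[OF fin occy F]) (use fin in \<open>auto simp: D_def\<close>)
  also have "\<dots> \<le> avg (spins U) (canon U (status x) (active y) (open_bonds x)) F"
    unfolding eq by (rule canon_open_bonds[OF fin occx F O])
  also have "\<dots> = mean U x F"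
    using d A by (intro avg_cong[where c = d, symmetric]) auto
  finally show ?thesis .
qed

section \<open>Comparison of volumes\<close>

lemma sum_spins_restrict:
  fixes U :: "'v set"
  assumes "finite U" "U' \<subseteq> U"
  shows "(\<Sum>\<sigma>\<in>spins U. f \<sigma> * (\<Prod>v\<in>U - U'. (real_of_int (\<sigma> v) + (real_of_int (\<sigma> v))\<^sup>2) / 2)) = (\<Sum>\<sigma>\<in>spins U'. f \<sigma>)"
proof -
  let ?G = "\<lambda>\<sigma>::'v \<Rightarrow> int. \<Prod>v\<in>U - U'. (real_of_int (\<sigma> v) + (real_of_int (\<sigma> v))\<^sup>2) / 2"
  have "?G \<sigma> = of_bool (\<sigma> \<in> spins U')" if s: "\<sigma> \<in> spins U" for \<sigma>
  proof (cases "\<sigma> \<in> spins U'")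
    case True
    then show ?thesis using spins_outside[OF True] by simp
  next
    case False
    then obtain v where v: "v \<in> U - U'" "\<sigma> v \<noteq> 1"
      using s assms unfolding spins_def by auto
    then have "(real_of_int (\<sigma> v) + (real_of_int (\<sigma> v))\<^sup>2) / 2 = 0" using spins_value[OF s, of v] by auto
    then have "?G \<sigma> = 0" using v assms by (metis (no_types, lifting) finite_Diff prod_zero)
    then show ?thesis using False by simp
  qed
  then have "(\<Sum>\<sigma>\<in>spins U. f \<sigma> * ?G \<sigma>) = (\<Sum>\<sigma>\<in>spins U. if \<sigma> \<in> spins U' then f \<sigma> else 0)"
    by (intro sum.cong) (auto simp: of_bool_def)
  also have "\<dots> = (\<Sum>\<sigma>\<in>spins U \<inter> spins U'. f \<sigma>)"
    using finite_spins[OF assms(1)] by (simp add: sum.inter_restrict)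
  also have "spins U \<inter> spins U' = spins U'" using spins_mono[OF assms(2)] by auto
  finally show ?thesis .
qed

lemma valid_mono: "finite U \<Longrightarrow> U' \<subseteq> U \<Longrightarrow> valid U' H \<Longrightarrow> valid U H"
  using valid_witness spins_mono finite_subset by (metis subsetD)

text \<open>The indicator that all spins of U - U' are plus is the product of (s + s^2) / 2, a cone
  element; restricting to U' is therefore an upward tilt.\<close>

lemma mean_volume_mono:
  assumes fin: "finite U" and sub: "U \<subseteq> V" "U' \<subseteq> U" and gx: "good (map fst x)" and vx: "valid U' x" and F: "cone1 F"
  shows "mean U x F \<le> mean U' x F"
proof -
  let ?G = "\<lambda>\<sigma>::'v \<Rightarrow> int. \<Prod>v\<in>U - U'. (real_of_int (\<sigma> v) + (real_of_int (\<sigma> v))\<^sup>2) / 2"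
  have v: "valid U x" by (rule valid_mono[OF fin sub(2) vx])
  have "cone1 (\<lambda>\<sigma>::'v \<Rightarrow> int. (1/2) * (real_of_int (\<sigma> v) + (real_of_int (\<sigma> v))\<^sup>2))" for v
    by (intro cone1_scale cone1_add cone1_coord cone1_power) auto
  then have G: "cone1 ?G" by (intro cone1_prod) simp
  have r: "(\<Sum>\<sigma>\<in>spins U. f \<sigma> * ?G \<sigma>) = (\<Sum>\<sigma>\<in>spins U'. f \<sigma>)" for f
    by (rule sum_spins_restrict[OF fin sub(2)])
  have "mean U x F \<le> avg (spins U) (\<lambda>\<sigma>. weight x \<sigma> * ?G \<sigma>) F"
    using weight_ginibre[OF fin sub(1) gx v] F G vx v r by (intro avg_tilt) (auto simp: valid_def)
  also have "\<dots> = mean U' x F"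
    using r[of "\<lambda>\<sigma>. weight x \<sigma> * F \<sigma>"] r[of "weight x"] unfolding avg_def by (simp add: mult_ac)
  finally show ?thesis .
qed

end

section \<open>Exploring the plus region from outside\<close>

context blume_capel
begin

text \<open>No connectivity is recorded: only bonds with an explored end are queried, so every open
  bond found is joined to the outside.\<close>

definition explored :: "'v set \<Rightarrow> 'v query history \<Rightarrow> 'v set" where
  "explored \<Gamma> H = - \<Gamma> \<union> \<Union>(open_bonds H)"

definition frontier :: "'v set \<Rightarrow> 'v query history \<Rightarrow> 'v set set" where
  "frontier \<Gamma> H = {e \<in> Es. Bond e \<notin> fst ` set H \<and> e \<inter> explored \<Gamma> H \<noteq> {} \<and> \<not> e \<subseteq> explored \<Gamma> H}"

definition next_query :: "'v set \<Rightarrow> 'v query history \<Rightarrow> 'v query option" where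
  "next_query \<Gamma> H = (if frontier \<Gamma> H = {} then None else
     let e = SOME e. e \<in> frontier \<Gamma> H in
     if \<forall>v\<in>e. Site v \<in> fst ` set H then Some (Bond e)
     else Some (Site (SOME v. v \<in> e \<and> Site v \<notin> fst ` set H)))"

lemma next_query_None: "next_query \<Gamma> H = None \<longleftrightarrow> frontier \<Gamma> H = {}"
  unfolding next_query_def Let_def by auto

lemma next_query_Some:
  assumes "next_query \<Gamma> H = Some q"
  obtains e v where "e \<in> frontier \<Gamma> H" "q = Site v" "v \<in> e" "Site v \<notin> fst ` set H"
  | e where "e \<in> frontier \<Gamma> H" "q = Bond e" "\<forall>v\<in>e. Site v \<in> fst ` set H"
proof -
  define e where "e = (SOME e. e \<in> frontier \<Gamma> H)"
  have ne: "frontier \<Gamma> H \<noteq> {}" using assms unfolding next_query_def by auto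
  then have e: "e \<in> frontier \<Gamma> H" unfolding e_def by (simp add: some_in_eq)
  show thesis
  proof (cases "\<forall>v\<in>e. Site v \<in> fst ` set H")
    case True
    then have "q = Bond e" using assms ne unfolding next_query_def Let_def e_def by simp
    then show thesis using that(2) e True by blast
  next
    case False
    define v where "v = (SOME v. v \<in> e \<and> Site v \<notin> fst ` set H)"
    have v: "v \<in> e \<and> Site v \<notin> fst ` set H" unfolding v_def by (rule someI_ex) (use False in blast)
    have "q = Site v" using assms ne False unfolding next_query_def Let_def v_def e_def by auto
    then show thesis using that(1) e v by blast
  qed
qed

lemma next_query_good:
  assumes "good (map fst H)" "next_query \<Gamma> H = Some q"
  shows "good (q # map fst H)"
  using assms(2)
proof (cases rule: next_query_Some)
  case (1 e v)
  then show ?thesis using assms(1) by (auto simp: frontier_def)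
next
  case (2 e)
  then show ?thesis using assms(1) by (auto simp: frontier_def)
qed

fun reachable :: "'v set \<Rightarrow> 'v query history \<Rightarrow> bool" where
  "reachable \<Gamma> [] = True"
| "reachable \<Gamma> ((q, b) # H) \<longleftrightarrow> reachable \<Gamma> H \<and> next_query \<Gamma> H = Some q"

lemma reachable_good: "reachable \<Gamma> H \<Longrightarrow> good (map fst H)"
  by (induction \<Gamma> H rule: reachable.induct) (auto simp del: good.simps(2) dest: next_query_good)

lemma explored_mono: "explored \<Gamma> H \<subseteq> explored \<Gamma> (a # H)"
  unfolding explored_def open_bonds_def by auto

lemma bond_pair:
  assumes "e \<in> Es" "u \<in> e"
  obtains w where "e = {u, w}" "u \<noteq> w"
  using card_bond[OF assms(1)] assms(2) by (auto simp: card_2_iff doubleton_eq_iff)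

text \<open>An open bond forces the product of its spins to be 1. When it was queried one end was
  already explored, hence plus, so the other end is plus as well.\<close>

lemma reachable_plus:
  "reachable \<Gamma> H \<Longrightarrow> \<sigma> \<in> spins \<Gamma> \<Longrightarrow> weight H \<sigma> \<noteq> 0 \<Longrightarrow> v \<in> explored \<Gamma> H \<Longrightarrow> \<sigma> v = 1"
proof (induction H arbitrary: v)
  case Nil
  then show ?case using spins_outside by (auto simp: explored_def open_bonds_def)
next
  case (Cons a H)
  obtain q b where a [simp]: "a = (q, b)" by force
  have IH: "u \<in> explored \<Gamma> H \<Longrightarrow> \<sigma> u = 1" for u using Cons by simp
  show ?case
  proof (cases "v \<in> explored \<Gamma> H")
    case False
    then obtain e where e: "q = Bond e" "b" "v \<in> e" 
      using Cons.prems unfolding explored_def open_bonds_def by auto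
    have "e \<in> frontier \<Gamma> H"
      using Cons.prems(1) e by (auto elim!: next_query_Some)
    then obtain u where u: "u \<in> e" "u \<in> explored \<Gamma> H" "e \<in> Es" unfolding frontier_def by blast
    obtain w where w: "e = {u, w}" "u \<noteq> w" using bond_pair[OF u(3,1)] by blast
    have "bond e \<sigma> = 1"
      using Cons.prems(3) e bond_values[OF Cons.prems(2), of e] by (auto simp: answer_def)
    then have "\<sigma> w = 1" using IH[OF u(2)] w unfolding bond_def by simp
    then show ?thesis using IH[OF u(2)] w e(3) by auto
  qed (use IH in blast)
qed

text \<open>Charging a site query to an adjacent bond with an explored end allows a union bound. The
  bond meets \<Gamma> because a frontier bond is not contained in the explored region, which
  includes the complement of \<Gamma>.\<close>

lemma reachable_Site:
  "reachable \<Gamma> H \<Longrightarrow> Site v \<in> fst ` set H \<Longrightarrow> \<exists>e\<in>Es. v \<in> e \<and> e \<inter> \<Gamma> \<noteq> {} \<and> e \<inter> explored \<Gamma> H \<noteq> {}"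
proof (induction H)
  case (Cons a H)
  obtain q b where a [simp]: "a = (q, b)" by force
  have sub: "explored \<Gamma> H \<subseteq> explored \<Gamma> (a # H)" by (rule explored_mono)
  show ?case
  proof (cases "q = Site v")
    case True
    have "next_query \<Gamma> H = Some (Site v)" using Cons.prems True by simp
    then obtain e where "e \<in> frontier \<Gamma> H" "v \<in> e"
      by (rule next_query_Some) auto
    moreover have "- \<Gamma> \<subseteq> explored \<Gamma> H" unfolding explored_def by blast
    ultimately show ?thesis using sub unfolding frontier_def by blast
  next
    case False
    then have "reachable \<Gamma> H" "Site v \<in> fst ` set H" using Cons.prems by auto
    then show ?thesis using Cons.IH sub by blast
  qed
qed simp

lemma reachable_Bond:
  "reachable \<Gamma> H \<Longrightarrow> Bond e \<in> fst ` set H \<Longrightarrow> e \<in> Es \<and> e \<inter> \<Gamma> \<noteq> {} \<and> e \<inter> explored \<Gamma> H \<noteq> {}"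
proof (induction H)
  case (Cons a H)
  obtain q b where a [simp]: "a = (q, b)" by force
  have sub: "explored \<Gamma> H \<subseteq> explored \<Gamma> (a # H)" by (rule explored_mono)
  show ?case
  proof (cases "q = Bond e")
    case True
    have "next_query \<Gamma> H = Some (Bond e)" using Cons.prems True by simp
    then have "e \<in> frontier \<Gamma> H"
      by (rule next_query_Some) auto
    moreover have "- \<Gamma> \<subseteq> explored \<Gamma> H" unfolding explored_def by blast
    ultimately show ?thesis using sub unfolding frontier_def by blast
  next
    case False
    then have "reachable \<Gamma> H" "Bond e \<in> fst ` set H" using Cons.prems by auto
    then show ?thesis using Cons.IH sub by blast
  qed
qed simp

lemma mean_explored:
  assumes "finite \<Gamma>" "reachable \<Gamma> H" "valid \<Gamma> H" "v \<in> explored \<Gamma> H"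
  shows "mean \<Gamma> H (\<lambda>\<sigma>. real_of_int (\<sigma> v)) = 1"
proof -
  have "(\<Sum>\<sigma>\<in>spins \<Gamma>. weight H \<sigma> * real_of_int (\<sigma> v)) = (\<Sum>\<sigma>\<in>spins \<Gamma>. weight H \<sigma>)"
  proof (intro sum.cong refl)
    fix \<sigma> assume "\<sigma> \<in> spins \<Gamma>"
    then show "weight H \<sigma> * real_of_int (\<sigma> v) = weight H \<sigma>"
      using reachable_plus[OF assms(2) _ _ assms(4), of \<sigma>] by (cases "weight H \<sigma> = 0") auto
  qed
  then show ?thesis using assms(3) unfolding avg_def valid_def by simp
qed

text \<open>Once the frontier is empty, no surviving interaction links the explored and the unexplored
  region, so the weight is invariant under a global sign change in the unexplored region.\<close>

lemma mean_unexplored: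
  assumes fin: "finite \<Gamma>" and sub: "\<Gamma> \<subseteq> V" and reach: "reachable \<Gamma> H" and valid: "valid \<Gamma> H"
    and empty: "frontier \<Gamma> H = {}" and v: "v \<notin> explored \<Gamma> H"
  shows "mean \<Gamma> H (\<lambda>\<sigma>. real_of_int (\<sigma> v)) = 0"
proof -
  define A where "A = explored \<Gamma> H"
  define flip where "flip = (\<lambda>\<sigma>::'v \<Rightarrow> int. \<lambda>u. if u \<in> A then \<sigma> u else - \<sigma> u)"
  have A: "- \<Gamma> \<subseteq> A" unfolding A_def explored_def by blast
  have inv: "flip (flip \<sigma>) = \<sigma>" for \<sigma> unfolding flip_def by auto
  have into: "flip \<sigma> \<in> spins \<Gamma>" if "\<sigma> \<in> spins \<Gamma>" for \<sigma>
    using that A spins_value[OF that] unfolding flip_def spins_def by auto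
  have bij: "bij_betw flip (spins \<Gamma>) (spins \<Gamma>)"
    using inv into by (intro bij_betw_byWitness[where f' = flip]) auto
  obtain c where c: "c > 0" "\<And>\<sigma>. \<sigma> \<in> spins \<Gamma> \<Longrightarrow> weight H \<sigma> = c * canon \<Gamma> (status H) (active H) (open_bonds H) \<sigma>"
    using weight_canon[OF fin sub reachable_good[OF reach] valid] by auto
  have b1: "bond e (flip \<sigma>) = bond e \<sigma>" if "e \<subseteq> A" for e \<sigma>
    using that unfolding bond_def flip_def by (intro prod.cong) auto
  have b2: "bond e (flip \<sigma>) = bond e \<sigma>" if e: "e \<in> active H" for e \<sigma>
  proof (cases "e \<subseteq> A")
    case False
    have eE: "e \<in> Es" using e unfolding active_def by simp
    \<comment> \<open>An unqueried bond meeting both regions would lie in the frontier. A bond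
      outside \<open>A\<close> changes two signs, which cancel.\<close>
    have "e \<inter> A = {}" using False e empty unfolding active_def frontier_def A_def by auto
    then have "bond e (flip \<sigma>) = (\<Prod>v\<in>e. - real_of_int (\<sigma> v))"
      unfolding bond_def flip_def by (intro prod.cong) auto
    also have "\<dots> = bond e \<sigma>" using card_bond[OF eE] by (simp add: prod_uminus bond_def)
    finally show ?thesis .
  qed (rule b1)
  have s: "site_weight b (flip \<sigma> u) = site_weight b (\<sigma> u)" for b \<sigma> u
    unfolding flip_def site_weight_def by (auto split: option.split bool.split)
  have "canon \<Gamma> (status H) (active H) (open_bonds H) (flip \<sigma>) = canon \<Gamma> (status H) (active H) (open_bonds H) \<sigma>" for \<sigma>
  proof -
    have "(\<Prod>e\<in>open_bonds H. 1 + bond e (flip \<sigma>)) = (\<Prod>e\<in>open_bonds H. 1 + bond e \<sigma>)"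
      using b1 by (intro prod.cong) (auto simp: A_def explored_def)
    moreover have "(\<Sum>e\<in>active H. bond e (flip \<sigma>)) = (\<Sum>e\<in>active H. bond e \<sigma>)"
      using b2 by (intro sum.cong) auto
    ultimately show ?thesis unfolding canon_def s by simp
  qed
  then have w: "weight H (flip \<sigma>) = weight H \<sigma>" if "\<sigma> \<in> spins \<Gamma>" for \<sigma>
    using c(2)[OF that] c(2)[OF into[OF that]] by simp
  have "(\<Sum>\<sigma>\<in>spins \<Gamma>. weight H \<sigma> * real_of_int (\<sigma> v)) = (\<Sum>\<sigma>\<in>spins \<Gamma>. weight H (flip \<sigma>) * real_of_int (flip \<sigma> v))"
    by (rule sum.reindex_bij_betw[OF bij, symmetric])
  also have "\<dots> = (\<Sum>\<sigma>\<in>spins \<Gamma>. - (weight H \<sigma> * real_of_int (\<sigma> v)))"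
    using w v by (intro sum.cong) (auto simp: flip_def A_def)
  finally show ?thesis unfolding avg_def by (simp add: sum_negf)
qed

section \<open>Conditional means along the exploration\<close>

lemma mean_True:
  assumes "finite U" "valid U H"
  shows "mean U H (answer q) * mean U ((q, True) # H) F = mean U H (\<lambda>\<sigma>. answer q \<sigma> * F \<sigma>)"
proof (cases "(\<Sum>\<sigma>\<in>spins U. weight H \<sigma> * answer q \<sigma>) = 0")
  case True
  have "\<forall>\<sigma>\<in>spins U. weight H \<sigma> * answer q \<sigma> = 0"
    using True sum_nonneg_eq_0_iff[OF finite_spins[OF assms(1)], of "\<lambda>\<sigma>. weight H \<sigma> * answer q \<sigma>"]
      weight_nonneg answer_range by (metis (no_types, lifting) mult_nonneg_nonneg)
  then have "(\<Sum>\<sigma>\<in>spins U. weight H \<sigma> * (answer q \<sigma> * F \<sigma>)) = 0"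
    by (intro sum.neutral) auto
  then show ?thesis using True unfolding avg_def by simp
qed (simp add: avg_def mult_ac)

lemma mean_False:
  assumes "finite U" "valid U H"
  shows "(1 - mean U H (answer q)) * mean U ((q, False) # H) F = mean U H (\<lambda>\<sigma>. (1 - answer q \<sigma>) * F \<sigma>)"
proof -
  have Z: "1 - mean U H (answer q) = (\<Sum>\<sigma>\<in>spins U. weight H \<sigma> * (1 - answer q \<sigma>)) / (\<Sum>\<sigma>\<in>spins U. weight H \<sigma>)"
    using assms(2) unfolding avg_def valid_def
    by (simp add: right_diff_distrib sum_subtractf diff_divide_distrib)
  show ?thesis
  proof (cases "(\<Sum>\<sigma>\<in>spins U. weight H \<sigma> * (1 - answer q \<sigma>)) = 0")
    case True
    have "0 \<le> weight H \<sigma> * (1 - answer q \<sigma>)" if "\<sigma> \<in> spins U" for \<sigma>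
      using weight_nonneg[OF that] answer_range[OF that] by simp
    then have "\<forall>\<sigma>\<in>spins U. weight H \<sigma> * (1 - answer q \<sigma>) = 0"
      using True sum_nonneg_eq_0_iff[OF finite_spins[OF assms(1)], of "\<lambda>\<sigma>. weight H \<sigma> * (1 - answer q \<sigma>)"] by blast
    then have "(\<Sum>\<sigma>\<in>spins U. weight H \<sigma> * ((1 - answer q \<sigma>) * F \<sigma>)) = 0"
      by (intro sum.neutral) auto
    then show ?thesis using True unfolding Z unfolding avg_def by simp
  next
    case False
    then show ?thesis unfolding Z unfolding avg_def by (simp add: mult_ac)
  qed
qed

lemma mean_add: "mean U H (\<lambda>\<sigma>. F \<sigma> + G \<sigma>) = mean U H F + mean U H G"
  unfolding avg_def by (simp add: distrib_left sum.distrib add_divide_distrib)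

lemma mean_split:
  assumes "finite U" "valid U H"
  shows "mean U H F = mean U H (answer q) * mean U ((q, True) # H) F
     + (1 - mean U H (answer q)) * mean U ((q, False) # H) F"
  unfolding mean_True[OF assms] mean_False[OF assms] mean_add[symmetric]
  by (simp add: algebra_simps)

lemma mean_range:
  assumes "\<And>\<sigma>. \<sigma> \<in> spins U \<Longrightarrow> 0 \<le> F \<sigma> \<and> F \<sigma> \<le> 1" shows "0 \<le> mean U H F \<and> mean U H F \<le> 1"
proof -
  have "0 \<le> (\<Sum>\<sigma>\<in>spins U. weight H \<sigma> * F \<sigma>)" using assms weight_nonneg by (intro sum_nonneg) auto
  moreover have "(\<Sum>\<sigma>\<in>spins U. weight H \<sigma> * F \<sigma>) \<le> (\<Sum>\<sigma>\<in>spins U. weight H \<sigma>)"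
    using assms weight_nonneg by (intro sum_mono) (auto simp: mult_left_le)
  ultimately show ?thesis unfolding avg_def by (auto simp: divide_le_eq_1)
qed

lemma mean_answer_range: "0 \<le> mean U H (answer q) \<and> mean U H (answer q) \<le> 1"
  using mean_range answer_range by blast

lemma valid_True:
  assumes "valid U H" "0 < mean U H (answer q)" shows "valid U ((q, True) # H)"
  using assms unfolding valid_def avg_def by (auto simp: zero_less_divide_iff)

lemma valid_False:
  assumes "valid U H" "mean U H (answer q) < 1" shows "valid U ((q, False) # H)"
  using assms unfolding valid_def avg_def
  by (auto simp: right_diff_distrib sum_subtractf field_simps)

definition all_queries :: "'v query set" where
  "all_queries = Site ` \<Union>Es \<union> Bond ` Es"

lemma finite_all_queries: "finite all_queries"
  unfolding all_queries_def using finite_Es bond_finite by auto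

lemma good_all_queries: "good (q # qs) \<Longrightarrow> q \<in> all_queries"
  unfolding all_queries_def by (cases q) auto

text \<open>Queries are never repeated, so as much fuel as there are queries is enough for every run
  to stop by itself.\<close>

lemma remaining_decreases:
  assumes "reachable \<Gamma> H" "next_query \<Gamma> H = Some q"
  shows "card (all_queries - fst ` set ((q, b) # H)) < card (all_queries - fst ` set H)"
proof (rule psubset_card_mono)
  have g: "good (q # map fst H)" using next_query_good reachable_good assms by blast
  have "q \<in> all_queries" "q \<notin> fst ` set H" using good_all_queries[OF g] g by auto
  then show "all_queries - fst ` set ((q, b) # H) \<subset> all_queries - fst ` set H" by auto
qed (simp add: finite_all_queries)

text \<open>The conditional mean of the spin is a martingale along the run, and at the end it is 1
  or 0 according to whether \<open>v\<close> was explored. So the probability of reaching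
  \<open>v\<close> is exactly its magnetization.\<close>

lemma run_explored:
  assumes fin: "finite \<Gamma>" and sub: "\<Gamma> \<subseteq> V"
  shows "reachable \<Gamma> x \<Longrightarrow> valid \<Gamma> x \<Longrightarrow> card (all_queries - fst ` set x) \<le> n \<Longrightarrow>
    explore (next_query \<Gamma>) (\<lambda>x q. mean \<Gamma> x (answer q)) n (\<lambda>H. of_bool (v \<in> explored \<Gamma> H)) x
    = mean \<Gamma> x (\<lambda>\<sigma>. real_of_int (\<sigma> v))"
proof (induction n arbitrary: x)
  case 0
  have "next_query \<Gamma> x = None"
    using remaining_decreases[OF 0(1)] 0(3) by (metis less_nat_zero_code le_zero_eq not_None_eq)
  then show ?case
    using mean_explored[OF fin 0(1,2)] mean_unexplored[OF fin sub 0(1,2)] next_query_None by auto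
next
  case (Suc n)
  show ?case
  proof (cases "next_query \<Gamma> x")
    case None
    then have "frontier \<Gamma> x = {}" using next_query_None by blast
    then show ?thesis
      using None mean_explored[OF fin Suc.prems(1,2)] mean_unexplored[OF fin sub Suc.prems(1,2)] by simp
  next
    case (Some q)
    let ?p = "mean \<Gamma> x (answer q)"
    let ?r = "\<lambda>b. explore (next_query \<Gamma>) (\<lambda>x q. mean \<Gamma> x (answer q)) n
        (\<lambda>H. of_bool (v \<in> explored \<Gamma> H)) ((q, b) # x)"
    have card: "card (all_queries - fst ` set ((q, b) # x)) \<le> n" for b
      using remaining_decreases[OF Suc.prems(1) Some, of b] Suc.prems(3) by linarith
    have reach: "reachable \<Gamma> ((q, b) # x)" for b using Suc.prems(1) Some by simp
    have 1: "?p * ?r True = ?p * mean \<Gamma> ((q, True) # x) (\<lambda>\<sigma>. real_of_int (\<sigma> v))"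
      using Suc.IH[OF reach _ card, of True] valid_True[OF Suc.prems(2), of q] mean_answer_range[of \<Gamma> x q]
      by (cases "?p = 0") (simp_all add: less_le del: weight.simps)
    have 2: "(1 - ?p) * ?r False = (1 - ?p) * mean \<Gamma> ((q, False) # x) (\<lambda>\<sigma>. real_of_int (\<sigma> v))"
      using Suc.IH[OF reach _ card, of False] valid_False[OF Suc.prems(2), of q] mean_answer_range[of \<Gamma> x q]
      by (cases "?p = 1") (simp_all add: less_le del: weight.simps)
    show ?thesis using Some 1 2 mean_split[OF fin Suc.prems(2), of "\<lambda>\<sigma>. real_of_int (\<sigma> v)" q]
      by (simp only: explore.simps option.case)
  qed
qed

lemma run_mono:
  assumes "\<And>H. reachable \<Gamma> H \<Longrightarrow> \<phi> H \<le> \<psi> H"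
  shows "reachable \<Gamma> x \<Longrightarrow> explore (next_query \<Gamma>) (\<lambda>x q. mean \<Gamma> x (answer q)) n \<phi> x
     \<le> explore (next_query \<Gamma>) (\<lambda>x q. mean \<Gamma> x (answer q)) n \<psi> x"
proof (induction n arbitrary: x)
  case (Suc n)
  show ?case
  proof (cases "next_query \<Gamma> x")
    case (Some q)
    then have "reachable \<Gamma> ((q, b) # x)" for b using Suc.prems by simp
    then show ?thesis using Some Suc.IH mean_answer_range[of \<Gamma> x q]
      by (auto intro!: add_mono mult_left_mono)
  qed (use Suc assms in auto)
qed (use assms in auto)

end

lemma explore_sum:
  "explore nxt p n (\<lambda>H. \<Sum>i\<in>I. \<phi> i H) x = (\<Sum>i\<in>I. explore nxt p n (\<phi> i) x)"
proof (induction n arbitrary: x)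
  case (Suc n)
  then show ?case by (simp add: sum.distrib sum_distrib_left split: option.split)
qed simp

context blume_capel
begin

section \<open>Covariances, revealment and the exploration inequality\<close>

definition cov :: "'v set \<Rightarrow> 'v query history \<Rightarrow> (('v \<Rightarrow> int) \<Rightarrow> real) \<Rightarrow> (('v \<Rightarrow> int) \<Rightarrow> real) \<Rightarrow> real" where
  "cov U H F G = mean U H (\<lambda>\<sigma>. F \<sigma> * G \<sigma>) - mean U H F * mean U H G"

lemma valid_Nil: "finite U \<Longrightarrow> valid U []"
  using valid_witness[of U "[]"] by (auto simp: base_weight_def spins_def intro!: exI[of _ "\<lambda>_. 1"])

lemma covariance_nonneg:
  assumes "finite U" "U \<subseteq> V" "cone1 F" "cone1 G"
  shows "0 \<le> cov U [] F G"
  using avg_gks[OF weight_ginibre[OF assms(1,2), of "[]"] assms(3,4)] valid_Nil[OF assms(1)]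
  unfolding cov_def valid_def by simp

text \<open>The law of total covariance for one query; the last summand is the covariance of the two
  conditional means.\<close>

lemma covariance_split:
  fixes y and q :: "'v query"
  assumes "finite U" "valid U y"
  defines "r \<equiv> mean U y (answer q)"
  shows "cov U y F G = r * cov U ((q, True) # y) F G + (1 - r) * cov U ((q, False) # y) F G
    + r * (1 - r) * ((mean U ((q, True) # y) F - mean U ((q, False) # y) F)
       * (mean U ((q, True) # y) G - mean U ((q, False) # y) G))"
  unfolding cov_def mean_split[OF assms(1,2), of F q] mean_split[OF assms(1,2), of G q]
    mean_split[OF assms(1,2), of "\<lambda>\<sigma>. F \<sigma> * G \<sigma>" q] r_def[symmetric]
  by (simp add: algebra_simps)

lemma covariance_answer:
  fixes y and q :: "'v query"
  assumes "finite U" "valid U y"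
  defines "r \<equiv> mean U y (answer q)"
  shows "cov U y F (answer q) = r * (1 - r) * (mean U ((q, True) # y) F - mean U ((q, False) # y) F)"
proof -
  have "mean U y (\<lambda>\<sigma>. F \<sigma> * answer q \<sigma>) = r * mean U ((q, True) # y) F"
    using mean_True[OF assms(1,2), of q F] unfolding r_def by (simp add: mult.commute)
  then show ?thesis
    unfolding cov_def mean_split[OF assms(1,2), of F q] r_def[symmetric] by (simp add: algebra_simps)
qed

text \<open>X is the plus model in \<Gamma>, Y the plus model in U. The between-branches term
  discarded in \<open>cv_total\<close> is a product of two nonnegative increments, by monotonicity
  in the history.\<close>

lemma exploration_bc:
  assumes fin: "finite U" and sub: "U \<subseteq> V" and F: "cone1 F"
  shows "exploration (next_query \<Gamma>) (\<lambda>x q. mean \<Gamma> x (answer q)) (\<lambda>y q. mean U y (answer q))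
     (\<lambda>y q. cov U y F (answer q)) (\<lambda>y. mean U y F) (\<lambda>H. of_bool (v \<in> explored \<Gamma> H)) good (valid U)"
proof unfold_locales
  fix x q assume "good (map fst x)" "next_query \<Gamma> x = Some q"
  then show "good (q # map fst x)" by (rule next_query_good)
next
  fix q :: "'v query" and qs assume "good (q # qs)" then show "q \<notin> set qs" by simp
next
  fix x q
  show "0 \<le> mean \<Gamma> x (answer q) \<and> mean \<Gamma> x (answer q) \<le> 1" by (rule mean_answer_range)
  show "0 \<le> mean U x (answer q) \<and> mean U x (answer q) \<le> 1" by (rule mean_answer_range)
  show "(0::real) \<le> of_bool (v \<in> explored \<Gamma> x) \<and> of_bool (v \<in> explored \<Gamma> x) \<le> (1::real)" by simp
next
  fix y q assume v: "valid U y"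
  show "0 < mean U y (answer q) \<Longrightarrow> valid U ((q, True) # y)" by (rule valid_True[OF v])
  show "mean U y (answer q) < 1 \<Longrightarrow> valid U ((q, False) # y)" by (rule valid_False[OF v])
  show "mean U y F = mean U y (answer q) * mean U ((q, True) # y) F
     + (1 - mean U y (answer q)) * mean U ((q, False) # y) F" by (rule mean_split[OF fin v])
  show "cov U y F (answer q) = mean U y (answer q) * (1 - mean U y (answer q)) *
     (mean U ((q, True) # y) F - mean U ((q, False) # y) F)" by (rule covariance_answer[OF fin v])
next
  fix y y' q assume "good (map fst y)" "valid U y" "valid U y'" "below y y'"
  then show "mean U y F \<le> mean U y' F" "mean U y (answer q) \<le> mean U y' (answer q)"
    using mean_history_mono[OF fin sub] F cone1_answer by blast+
next
  fix q q' y assume g: "good (q # map fst y)" and v: "valid U y"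
  let ?r = "mean U y (answer q)"
  have "0 \<le> ?r * (1 - ?r) * ((mean U ((q, True) # y) F - mean U ((q, False) # y) F)
       * (mean U ((q, True) # y) (answer q') - mean U ((q, False) # y) (answer q')))"
  proof (cases "0 < ?r \<and> ?r < 1")
    case True
    then have "valid U ((q, True) # y)" "valid U ((q, False) # y)"
      using valid_True[OF v] valid_False[OF v] by blast+
    then have "mean U ((q, False) # y) G \<le> mean U ((q, True) # y) G" if "cone1 G" for G
      using g that by (intro mean_history_mono[OF fin sub]) (auto simp: below_Cons below_refl)
    then show ?thesis using True F cone1_answer by (intro mult_nonneg_nonneg) auto
  next
    case False
    then have zero: "?r * (1 - ?r) = 0" using mean_answer_range[of U y q] by auto
    show ?thesis unfolding zero by simp
  qed
  then show "?r * cov U ((q, True) # y) F (answer q') + (1 - ?r) * cov U ((q, False) # y) F (answer q')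
     \<le> cov U y F (answer q')"
    using covariance_split[OF fin v, of F "answer q'" q] by linarith
qed

text \<open>Union-bound estimate for the probability that e is queried: the magnetization of each
  end is the probability that it is explored. Bonds lying entirely outside \<Gamma> are never
  queried, hence the value 0.\<close>

definition reveal :: "'v set \<Rightarrow> 'v set \<Rightarrow> real" where
  "reveal \<Gamma> e = (if e \<inter> \<Gamma> = {} then 0 else \<Sum>v\<in>e. mean \<Gamma> [] (\<lambda>\<sigma>. real_of_int (\<sigma> v)))"

lemma run_queried:
  assumes fin: "finite \<Gamma>" and sub: "\<Gamma> \<subseteq> V"
  defines "run \<equiv> explore (next_query \<Gamma>) (\<lambda>x q. mean \<Gamma> x (answer q)) (card all_queries)"
  shows "run (queried (Bond e)) [] \<le> reveal \<Gamma> e"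
    and "run (queried (Site v)) [] \<le> (\<Sum>e | e \<in> Es \<and> v \<in> e. reveal \<Gamma> e)"
proof -
  let ?A = "\<lambda>u H. of_bool (u \<in> explored \<Gamma> H) :: real"
  let ?R = "\<lambda>e H. if e \<inter> \<Gamma> = {} then 0 else \<Sum>u\<in>e. ?A u H"
  have A: "run (?A u) [] = mean \<Gamma> [] (\<lambda>\<sigma>. real_of_int (\<sigma> u))" for u
    unfolding run_def by (rule run_explored[OF fin sub]) (auto simp: valid_Nil[OF fin])
  have zero: "run (\<lambda>_. 0) [] = 0"
    using explore_sum[of "next_query \<Gamma>" "\<lambda>x q. mean \<Gamma> x (answer q)" "card all_queries" "\<lambda>_ _. 0" "{}" "[]"]
    unfolding run_def by simp
  have R: "run (?R e) [] = reveal \<Gamma> e" for e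
    unfolding reveal_def using A zero by (simp add: run_def explore_sum)
  have touch: "1 \<le> ?R e H" if t: "e \<in> Es" "e \<inter> \<Gamma> \<noteq> {}" "e \<inter> explored \<Gamma> H \<noteq> {}" for e H
  proof -
    obtain u where "u \<in> e" "u \<in> explored \<Gamma> H" using t(3) by blast
    then have "?A u H \<le> (\<Sum>u\<in>e. ?A u H)" using bond_finite[OF t(1)] by (intro member_le_sum) auto
    then show ?thesis using t \<open>u \<in> explored \<Gamma> H\<close> by simp
  qed
  have nn: "0 \<le> ?R e H" for e H by (auto intro: sum_nonneg)
  have "run (queried (Bond e)) [] \<le> run (?R e) []"
    unfolding run_def
  proof (rule run_mono)
    fix H assume "reachable \<Gamma> H"
    then show "queried (Bond e) H \<le> ?R e H"
      using reachable_Bond[of \<Gamma> H e] touch[of e H] nn[of e H] unfolding queried_def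
      by (cases "Bond e \<in> fst ` set H") auto
  qed simp
  then show "run (queried (Bond e)) [] \<le> reveal \<Gamma> e" using R by simp
  have "run (queried (Site v)) [] \<le> run (\<lambda>H. \<Sum>e | e \<in> Es \<and> v \<in> e. ?R e H) []"
    unfolding run_def
  proof (rule run_mono)
    fix H assume reach: "reachable \<Gamma> H"
    show "queried (Site v) H \<le> (\<Sum>e | e \<in> Es \<and> v \<in> e. ?R e H)"
    proof (cases "Site v \<in> fst ` set H")
      case True
      then obtain e where e: "e \<in> Es" "v \<in> e" "e \<inter> \<Gamma> \<noteq> {}" "e \<inter> explored \<Gamma> H \<noteq> {}"
        using reachable_Site[OF reach] by blast
      have "1 \<le> ?R e H" by (rule touch) (use e in auto)
      also have "\<dots> \<le> (\<Sum>e | e \<in> Es \<and> v \<in> e. ?R e H)"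
        using e finite_Es by (intro member_le_sum[of e "{e. e \<in> Es \<and> v \<in> e}" "\<lambda>e. ?R e H"] nn) auto
      finally show ?thesis using True by (simp add: queried_def)
    next
      case False
      then have "queried (Site v) H = 0" by (simp add: queried_def)
      moreover have "0 \<le> (\<Sum>e | e \<in> Es \<and> v \<in> e. ?R e H)" by (intro sum_nonneg nn)
      ultimately show ?thesis by linarith
    qed
  qed simp
  also have "\<dots> = (\<Sum>e | e \<in> Es \<and> v \<in> e. run (?R e) [])"
    unfolding run_def by (rule explore_sum)
  finally show "run (queried (Site v)) [] \<le> (\<Sum>e | e \<in> Es \<and> v \<in> e. reveal \<Gamma> e)" using R by simp
qed

theorem exploration_inequality:
  fixes v :: 'v
  assumes fin: "finite U" and sub: "\<Gamma> \<subseteq> U" "U \<subseteq> V"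
  defines "f \<equiv> \<lambda>\<sigma>. real_of_int (\<sigma> v)"
  shows "mean U [] f * (1 - mean \<Gamma> [] f) \<le> (\<Sum>e\<in>Es. reveal \<Gamma> e *
     (cov U [] f (answer (Bond e)) + (\<Sum>u\<in>e. cov U [] f (answer (Site u)))))"
proof -
  have f: "cone1 f" unfolding f_def by (rule cone1_coord)
  have finG: "finite \<Gamma>" and subG: "\<Gamma> \<subseteq> V" using fin sub finite_subset by auto
  interpret exploration "next_query \<Gamma>" "\<lambda>x q. mean \<Gamma> x (answer q)" "\<lambda>y q. mean U y (answer q)"
     "\<lambda>y q. cov U y f (answer q)" "\<lambda>y. mean U y f" "\<lambda>H. of_bool (v \<in> explored \<Gamma> H)" good "valid U"
    by (rule exploration_bc[OF fin sub(2) f])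
  have compare: "0 \<le> mean U y G \<and> mean U y G \<le> mean \<Gamma> x G"
    if "reachable \<Gamma> x" "valid \<Gamma> x" "valid U y" "below y x" "cone1 G" for x y G
  proof -
    have gx: "good (map fst x)" by (rule reachable_good[OF that(1)])
    then have gy: "good (map fst y)" using below_queries[OF that(4)] by simp
    have vx: "valid U x" by (rule valid_mono[OF fin sub(1) that(2)])
    have "mean U y G \<le> mean U x G" by (rule mean_history_mono[OF fin sub(2) gy that(3) vx that(4,5)])
    also have "\<dots> \<le> mean \<Gamma> x G" by (rule mean_volume_mono[OF fin sub(2,1) gx that(2,5)])
    finally show ?thesis using avg_nonneg[OF weight_ginibre[OF fin sub(2) gy that(3)] that(5)] by simp
  qed
  \<comment> \<open>If X stops without reaching \<open>v\<close>, its mean at \<open>v\<close> is 0,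
    and the mean in Y lies between 0 and that. So the indicator may be dropped at every
    leaf.\<close>
  have leaf: "of_bool (v \<in> explored \<Gamma> x) * mean U y f = mean U y f"
    if "reachable \<Gamma> x" "valid \<Gamma> x" "valid U y" "below y x" "next_query \<Gamma> x = None" for x y
  proof (cases "v \<in> explored \<Gamma> x")
    case False
    then have "mean \<Gamma> x f = 0"
      using mean_unexplored[OF finG subG that(1,2)] that(5) next_query_None unfolding f_def by blast
    then show ?thesis using compare[OF that(1-4) f] by simp
  qed simp
  \<comment> \<open>Under domination r \<le> p at each query, so the branch (False in X, True in Y)
    has weight 0 and y stays below x. What remains is the plain conditional expansion of the mean in
    Y.\<close>
  have dominated: "reachable \<Gamma> x \<Longrightarrow> valid \<Gamma> x \<Longrightarrow> valid U y \<Longrightarrow> below y x \<Longrightarrow>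
     card (all_queries - fst ` set x) \<le> n \<Longrightarrow> coupled n x y = mean U y f" for n x y
  proof (induction n arbitrary: x y)
    case 0
    have "next_query \<Gamma> x = None"
      using remaining_decreases[OF 0(1)] 0(5) by (metis less_nat_zero_code le_zero_eq not_None_eq)
    then show ?case using leaf[OF 0(1-4)] by simp
  next
    case (Suc n)
    show ?case
    proof (cases "next_query \<Gamma> x")
      case None
      then show ?thesis using leaf[OF Suc.prems(1-4)] by simp
    next
      case (Some q)
      define p where "p = mean \<Gamma> x (answer q)"
      define r where "r = mean U y (answer q)"
      have rp: "0 \<le> r" "r \<le> p" "p \<le> 1"
        using compare[OF Suc.prems(1-4) cone1_answer[of q]] mean_answer_range[of \<Gamma> x q]
        unfolding p_def r_def by auto
      have card: "card (all_queries - fst ` set ((q, b) # x)) \<le> n" for b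
        using remaining_decreases[OF Suc.prems(1) Some, of b] Suc.prems(5) by linarith
      have reach: "reachable \<Gamma> ((q, b) # x)" for b using Suc.prems(1) Some by simp
      have bel: "below ((q, b) # y) ((q, b') # x)" if "b \<longrightarrow> b'" for b b'
        using Suc.prems(4) that by (simp add: below_Cons)
      note vx1 = valid_True[OF Suc.prems(2), of q, folded p_def]
      note vx0 = valid_False[OF Suc.prems(2), of q, folded p_def]
      note vy1 = valid_True[OF Suc.prems(3), of q, folded r_def]
      note vy0 = valid_False[OF Suc.prems(3), of q, folded r_def]
      have 1: "r * coupled n ((q, True) # x) ((q, True) # y) = r * mean U ((q, True) # y) f"
        using Suc.IH[OF reach vx1 vy1 bel card] rp by (cases "r = 0") (auto simp del: weight.simps)
      have 2: "(p - r) * coupled n ((q, True) # x) ((q, False) # y) = (p - r) * mean U ((q, False) # y) f"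
        using Suc.IH[OF reach vx1 vy0 bel card] rp by (cases "r = p") (auto simp del: weight.simps)
      have 3: "(1 - p) * coupled n ((q, False) # x) ((q, False) # y) = (1 - p) * mean U ((q, False) # y) f"
        using Suc.IH[OF reach vx0 vy0 bel card] rp by (cases "p = 1") (auto simp del: weight.simps)
      have "coupled (Suc n) x y = r * coupled n ((q, True) # x) ((q, True) # y)
         + (p - r) * coupled n ((q, True) # x) ((q, False) # y)
         + (1 - p) * coupled n ((q, False) # x) ((q, False) # y)"
        using Some rp by (simp add: p_def[symmetric] r_def[symmetric] min_absorb2)
      also have "\<dots> = r * mean U ((q, True) # y) f + (1 - r) * mean U ((q, False) # y) f"
        unfolding 1 2 3 by (simp add: algebra_simps)
      also have "\<dots> = mean U y f"
        using mean_split[OF fin Suc.prems(3), of f q] unfolding r_def by simp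
      finally show ?thesis .
    qed
  qed
  let ?N = "card all_queries"
  let ?c = "\<lambda>q. cov U [] f (answer q)"
  have cnn: "0 \<le> ?c q" for q by (rule covariance_nonneg[OF fin sub(2) f cone1_answer])
  have vG: "valid \<Gamma> []" and vL: "valid U []" using valid_Nil fin finG by auto
  have "coupled ?N [] [] = mean U [] f"
    by (rule dominated) (use vG vL in \<open>auto simp: below_refl\<close>)
  moreover have "run ?N (\<lambda>H. of_bool (v \<in> explored \<Gamma> H)) [] = mean \<Gamma> [] f"
    unfolding f_def by (rule run_explored[OF finG subG]) (use vG in auto)
  moreover have "coupled ?N [] [] - run ?N (\<lambda>H. of_bool (v \<in> explored \<Gamma> H)) [] * mean U [] f
     \<le> (\<Sum>q\<in>all_queries. (run ?N (queried q) [] - queried q []) * ?c q)"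
    by (rule coupled_minus_independent[OF finite_all_queries]) (use vL good_all_queries in auto)
  ultimately have "mean U [] f * (1 - mean \<Gamma> [] f) \<le> (\<Sum>q\<in>all_queries. run ?N (queried q) [] * ?c q)"
    by (simp add: queried_def algebra_simps)
  also have "\<dots> = (\<Sum>v\<in>\<Union>Es. run ?N (queried (Site v)) [] * ?c (Site v)) + (\<Sum>e\<in>Es. run ?N (queried (Bond e)) [] * ?c (Bond e))"
    unfolding all_queries_def using finite_Es bond_finite
    by (subst sum.union_disjoint) (auto simp: sum.reindex inj_on_def)
  also have "\<dots> \<le> (\<Sum>v\<in>\<Union>Es. (\<Sum>e | e \<in> Es \<and> v \<in> e. reveal \<Gamma> e) * ?c (Site v)) + (\<Sum>e\<in>Es. reveal \<Gamma> e * ?c (Bond e))"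
    using run_queried[OF finG subG] by (intro add_mono sum_mono mult_right_mono cnn) auto
  also have "(\<Sum>v\<in>\<Union>Es. (\<Sum>e | e \<in> Es \<and> v \<in> e. reveal \<Gamma> e) * ?c (Site v))
     = (\<Sum>v\<in>\<Union>Es. \<Sum>e | e \<in> Es \<and> v \<in> e. reveal \<Gamma> e * ?c (Site v))"
    by (simp add: sum_distrib_right)
  \<comment> \<open>Exchanging the order of incidences moves the site terms onto bonds, so that all
    covariances can later be compared with the bond terms of the derivative.\<close>
  also have "\<dots> = (\<Sum>e\<in>Es. \<Sum>v | v \<in> \<Union>Es \<and> v \<in> e. reveal \<Gamma> e * ?c (Site v))"
    by (rule sum.swap_restrict) (use finite_Es bond_finite in auto)
  also have "\<dots> = (\<Sum>e\<in>Es. reveal \<Gamma> e * (\<Sum>v\<in>e. ?c (Site v)))"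
  proof (intro sum.cong refl)
    fix e assume "e \<in> Es"
    then have "{v. v \<in> \<Union>Es \<and> v \<in> e} = e" by auto
    then show "(\<Sum>v | v \<in> \<Union>Es \<and> v \<in> e. reveal \<Gamma> e * ?c (Site v)) = reveal \<Gamma> e * (\<Sum>v\<in>e. ?c (Site v))"
      by (simp add: sum_distrib_left)
  qed
  finally show ?thesis by (simp add: sum.distrib[symmetric] distrib_left add.commute del: weight.simps)
qed

end

section \<open>Influences versus bond covariances\<close>

lemma bond_two: "e = {u, w} \<Longrightarrow> u \<noteq> w \<Longrightarrow> bond e \<sigma> = real_of_int (\<sigma> u) * real_of_int (\<sigma> w)"
  unfolding bond_def by simp

context blume_capel
begin

lemma mean_scale: "mean U H (\<lambda>\<sigma>. c * F \<sigma>) = c * mean U H F"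
  unfolding avg_def by (simp add: sum_distrib_left mult.left_commute)

lemma mean_cong: "(\<And>\<sigma>. \<sigma> \<in> spins U \<Longrightarrow> F \<sigma> = G \<sigma>) \<Longrightarrow> mean U H F = mean U H G"
  unfolding avg_def by simp

lemma covariance_add: "cov U H F (\<lambda>\<sigma>. G \<sigma> + G' \<sigma>) = cov U H F G + cov U H F G'"
  unfolding cov_def by (simp add: distrib_left mean_add)

lemma covariance_scale: "cov U H F (\<lambda>\<sigma>. c * G \<sigma>) = c * cov U H F G"
  unfolding cov_def by (simp add: mult.left_commute mean_scale right_diff_distrib)

text \<open>The indicator that the product of the two spins is 1, written as a polynomial so that it
  visibly lies in the cone.\<close>

definition aligned :: "'v set \<Rightarrow> ('v \<Rightarrow> int) \<Rightarrow> real" where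
  "aligned e \<sigma> = (bond e \<sigma> + (bond e \<sigma>)\<^sup>2) / 2"

lemma cone1_aligned: "cone1 (aligned e)"
proof -
  have "cone1 (\<lambda>\<sigma>. (1/2) * (bond e \<sigma> + (bond e \<sigma>)\<^sup>2))"
    by (intro cone1_scale cone1_add cone1_bond cone1_power) auto
  then show ?thesis unfolding aligned_def[abs_def] by simp
qed

lemma two_aligned: "(\<lambda>\<sigma>. 2 * aligned e \<sigma>) = (\<lambda>\<sigma>. bond e \<sigma> + (bond e \<sigma>)\<^sup>2)"
  unfolding aligned_def by (simp add: fun_eq_iff)

lemma answer_Bond: "answer (Bond e) \<sigma> = (1 - exp (- 2 * \<beta>)) * aligned e \<sigma>"
  unfolding answer_def aligned_def by simp

text \<open>Alignment of a bond forces both of its sites to be occupied. The inequality is Ginibre's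
  inequality for the measure conditioned on the occupation event X.\<close>

lemma covariance_occupation_le:
  assumes fin: "finite U" and sub: "U \<subseteq> V" and F: "cone1 F" and e: "e \<in> Es" and H: "good (map fst H)"
    and X: "\<And>\<sigma>. \<sigma> \<in> spins U \<Longrightarrow> weight H \<sigma> = weight [] \<sigma> * X \<sigma>"
    and B: "\<And>\<sigma>. \<sigma> \<in> spins U \<Longrightarrow> X \<sigma> * aligned e \<sigma> = aligned e \<sigma>"
    and one: "X (\<lambda>_. 1) = 1"
  shows "mean U [] (aligned e) * cov U [] F X \<le> mean U [] X * cov U [] F (aligned e)"
proof -
  have s1: "(\<lambda>_. 1) \<in> spins U" unfolding spins_def by auto
  then have "valid U H"
    unfolding valid_witness[OF fin] using X[OF s1] one by (intro bexI[OF _ s1]) (simp add: base_weight_def)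
  then have g: "ginibre (spins U) (weight H)" by (rule weight_ginibre[OF fin sub H])
  let ?Z = "\<Sum>\<sigma>\<in>spins U. weight [] \<sigma>"
  let ?S = "\<lambda>G. \<Sum>\<sigma>\<in>spins U. weight [] \<sigma> * G \<sigma>"
  have Z: "?Z > 0" using valid_Nil[OF fin] unfolding valid_def .
  have 1: "(\<Sum>\<sigma>\<in>spins U. weight H \<sigma>) = ?S X" using X by (intro sum.cong) auto
  have 2: "(\<Sum>\<sigma>\<in>spins U. weight H \<sigma> * F \<sigma>) = ?S (\<lambda>\<sigma>. F \<sigma> * X \<sigma>)"
    using X by (intro sum.cong) (auto simp: mult_ac)
  have 3: "(\<Sum>\<sigma>\<in>spins U. weight H \<sigma> * aligned e \<sigma>) = ?S (aligned e)"
    using X B by (intro sum.cong) (simp_all add: mult.assoc)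
  have 4: "(\<Sum>\<sigma>\<in>spins U. weight H \<sigma> * (F \<sigma> * aligned e \<sigma>)) = ?S (\<lambda>\<sigma>. F \<sigma> * aligned e \<sigma>)"
  proof (intro sum.cong refl)
    fix \<sigma> assume s: "\<sigma> \<in> spins U"
    have "weight H \<sigma> * (F \<sigma> * aligned e \<sigma>) = weight [] \<sigma> * (F \<sigma> * (X \<sigma> * aligned e \<sigma>))"
      unfolding X[OF s] by (simp add: mult_ac)
    then show "weight H \<sigma> * (F \<sigma> * aligned e \<sigma>) = weight [] \<sigma> * (F \<sigma> * aligned e \<sigma>)"
      unfolding B[OF s] .
  qed
  have "?S (\<lambda>\<sigma>. F \<sigma> * X \<sigma>) * ?S (aligned e) \<le> ?S X * ?S (\<lambda>\<sigma>. F \<sigma> * aligned e \<sigma>)"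
    using gks_covariance[OF g F cone1_aligned[of e]] unfolding 1 2 3 4 .
  then have "(?S (\<lambda>\<sigma>. F \<sigma> * X \<sigma>) * ?S (aligned e)) / (?Z * ?Z) \<le> (?S X * ?S (\<lambda>\<sigma>. F \<sigma> * aligned e \<sigma>)) / (?Z * ?Z)"
    using Z by (intro divide_right_mono) auto
  then have "mean U [] (\<lambda>\<sigma>. F \<sigma> * X \<sigma>) * mean U [] (aligned e) \<le> mean U [] X * mean U [] (\<lambda>\<sigma>. F \<sigma> * aligned e \<sigma>)"
    unfolding avg_def by simp
  then show ?thesis unfolding cov_def by (simp add: algebra_simps del: weight.simps)
qed

lemma covariance_site_le:
  assumes fin: "finite U" and sub: "U \<subseteq> V" and F: "cone1 F" and e: "e \<in> Es" and u: "u \<in> e"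
  shows "mean U [] (aligned e) * cov U [] F (answer (Site u))
     \<le> mean U [] (answer (Site u)) * cov U [] F (aligned e)"
proof (rule covariance_occupation_le[OF fin sub F e])
  show "good (map fst [(Site u, True)])" using e u by auto
  show "weight [(Site u, True)] \<sigma> = weight [] \<sigma> * answer (Site u) \<sigma>" for \<sigma> by simp
  show "answer (Site u) (\<lambda>_. 1) = 1" by (simp add: answer_def)
  fix \<sigma> assume s: "\<sigma> \<in> spins U"
  obtain w where w: "e = {u, w}" "u \<noteq> w" using bond_pair[OF e u] by blast
  show "answer (Site u) \<sigma> * aligned e \<sigma> = aligned e \<sigma>"
    unfolding answer_def aligned_def bond_two[OF w] using spins_value[OF s, of u] by auto
qed

text \<open>Here the occupation event is that both ends are nonzero, realised by the history that
  answers both site queries by True.\<close>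

lemma covariance_square_le:
  assumes fin: "finite U" and sub: "U \<subseteq> V" and F: "cone1 F" and e: "e \<in> Es"
  shows "mean U [] (aligned e) * cov U [] F (\<lambda>\<sigma>. (bond e \<sigma>)\<^sup>2)
     \<le> mean U [] (\<lambda>\<sigma>. (bond e \<sigma>)\<^sup>2) * cov U [] F (aligned e)"
proof -
  obtain u where u: "u \<in> e" using card_bond[OF e] by fastforce
  obtain w where w: "e = {u, w}" "u \<noteq> w" using bond_pair[OF e u] by blast
  show ?thesis
  proof (rule covariance_occupation_le[OF fin sub F e])
    show "good (map fst [(Site u, True), (Site w, True)])" using e w by auto
    show "weight [(Site u, True), (Site w, True)] \<sigma> = weight [] \<sigma> * (bond e \<sigma>)\<^sup>2" for \<sigma>
      unfolding bond_two[OF w] by (simp add: answer_def power_mult_distrib)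
    show "(bond e (\<lambda>_. 1))\<^sup>2 = 1" unfolding bond_two[OF w] by simp
    fix \<sigma> assume s: "\<sigma> \<in> spins U"
    show "(bond e \<sigma>)\<^sup>2 * aligned e \<sigma> = aligned e \<sigma>"
      using bond_values[OF s, of e] unfolding aligned_def by auto
  qed
qed

lemma base_canon:
  assumes fin: "finite U" and sub: "U \<subseteq> V"
  obtains c where "c > 0" "\<And>\<sigma>. \<sigma> \<in> spins U \<Longrightarrow> weight [] \<sigma> = c * canon U (\<lambda>_. None) Es {} \<sigma>"
proof -
  have "status [] = (\<lambda>_. None)" "active [] = Es" "open_bonds [] = {}"
    unfolding status_def active_def open_bonds_def by auto
  then show thesis using weight_canon[OF fin sub, of "[]"] valid_Nil[OF fin] that
    by (auto simp del: weight.simps)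
qed

lemma occupied_empty: "occupied U st {}"
  unfolding occupied_def by simp

text \<open>For the weight with e deleted the bond has nonnegative mean. Expressed in the full
  weight this says cosh \<beta> times the mean of b dominates sinh \<beta> times the mean of
  b^2.\<close>

lemma mean_bond_ge:
  assumes fin: "finite U" and sub: "U \<subseteq> V" and e: "e \<in> Es"
  shows "tanh \<beta> * mean U [] (\<lambda>\<sigma>. (bond e \<sigma>)\<^sup>2) \<le> mean U [] (bond e)"
proof -
  obtain c where c: "c > 0" "\<And>\<sigma>. \<sigma> \<in> spins U \<Longrightarrow> weight [] \<sigma> = c * canon U (\<lambda>_. None) Es {} \<sigma>"
    using base_canon[OF fin sub] by blast
  let ?w = "canon U (\<lambda>_. None) (Es - {e}) {}"
  have w: "canon U (\<lambda>_. None) Es {} \<sigma> = ?w \<sigma> * exp (\<beta> * bond e \<sigma>)" for \<sigma>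
    unfolding canon_def by (simp add: sum.remove[OF finite_Es e] distrib_left exp_add)
  have "0 \<le> (\<Sum>\<sigma>\<in>spins U. ?w \<sigma> * bond e \<sigma>)"
    by (rule gks_nonneg[OF canon_ginibre[OF fin occupied_empty] cone1_bond])
  then have "0 \<le> c * (\<Sum>\<sigma>\<in>spins U. ?w \<sigma> * bond e \<sigma>)" using c(1) by simp
  also have "\<dots> = (\<Sum>\<sigma>\<in>spins U. cosh \<beta> * (weight [] \<sigma> * bond e \<sigma>) - sinh \<beta> * (weight [] \<sigma> * (bond e \<sigma>)\<^sup>2))"
    unfolding sum_distrib_left
  proof (intro sum.cong refl)
    fix \<sigma> assume s: "\<sigma> \<in> spins U"
    \<comment> \<open>The right factor is b exp (-\<beta> b), written as a polynomial in b for b in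
      {-1, 0, 1}.\<close>
    have "exp (\<beta> * bond e \<sigma>) * (cosh \<beta> * bond e \<sigma> - sinh \<beta> * (bond e \<sigma>)\<^sup>2) = bond e \<sigma>"
    proof -
      have "exp \<beta> * (cosh \<beta> - sinh \<beta>) = 1" by (simp add: cosh_minus_sinh exp_add[symmetric])
      moreover have "exp (- \<beta>) * (cosh \<beta> + sinh \<beta>) = 1" by (simp add: cosh_plus_sinh exp_add[symmetric])
      moreover have "exp (- \<beta>) * (- cosh \<beta> - sinh \<beta>) = - (exp (- \<beta>) * (cosh \<beta> + sinh \<beta>))"
        by (simp add: algebra_simps)
      ultimately show ?thesis using bond_values[OF s, of e] by auto
    qed
    then have "c * (?w \<sigma> * bond e \<sigma>) = c * (?w \<sigma> * (exp (\<beta> * bond e \<sigma>) * (cosh \<beta> * bond e \<sigma> - sinh \<beta> * (bond e \<sigma>)\<^sup>2)))"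
      by simp
    then show "c * (?w \<sigma> * bond e \<sigma>) = cosh \<beta> * (weight [] \<sigma> * bond e \<sigma>) - sinh \<beta> * (weight [] \<sigma> * (bond e \<sigma>)\<^sup>2)"
      unfolding c(2)[OF s] w by (simp add: algebra_simps)
  qed
  also have "\<dots> = cosh \<beta> * (\<Sum>\<sigma>\<in>spins U. weight [] \<sigma> * bond e \<sigma>) - sinh \<beta> * (\<Sum>\<sigma>\<in>spins U. weight [] \<sigma> * (bond e \<sigma>)\<^sup>2)"
    by (simp add: sum_subtractf sum_distrib_left)
  finally have "tanh \<beta> * (\<Sum>\<sigma>\<in>spins U. weight [] \<sigma> * (bond e \<sigma>)\<^sup>2) \<le> (\<Sum>\<sigma>\<in>spins U. weight [] \<sigma> * bond e \<sigma>)"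
    unfolding tanh_def by (simp add: field_simps)
  then show ?thesis
    using valid_Nil[OF fin] unfolding avg_def valid_def by (simp add: divide_right_mono)
qed

text \<open>Probability that a site without interactions carries a nonzero spin.\<close>

definition occupation :: real where
  "occupation = 2 * exp \<Delta> / (1 + 2 * exp \<Delta>)"

lemma occupation_range: "0 < occupation" "occupation < 1"
proof -
  have "0 < 1 + 2 * exp \<Delta>" by (simp add: add_pos_pos)
  then show "0 < occupation" "occupation < 1" unfolding occupation_def by simp_all
qed

text \<open>Switching on the interactions only raises occupation. The full Boltzmann factor must be
  a cone element for this, so on {-1, 0, 1} the exponential is replaced by 1 + b sinh \<beta> + b^2
  (cosh \<beta> - 1).\<close>

lemma mean_site_ge:
  assumes fin: "finite U" and sub: "U \<subseteq> V"
  shows "occupation \<le> mean U [] (\<lambda>\<sigma>. (real_of_int (\<sigma> u))\<^sup>2)"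
proof (cases "u \<in> U")
  case False
  have "mean U [] (\<lambda>\<sigma>. (real_of_int (\<sigma> u))\<^sup>2) = mean U [] (\<lambda>\<sigma>. 1)"
    by (rule mean_cong) (simp add: spins_outside[OF _ False])
  also have "\<dots> = 1" using valid_Nil[OF fin] unfolding avg_def valid_def by simp
  finally show ?thesis using occupation_range by simp
next
  case True
  let ?F = "\<lambda>\<sigma>::'v \<Rightarrow> int. (real_of_int (\<sigma> u))\<^sup>2"
  let ?G = "\<lambda>\<sigma>::'v \<Rightarrow> int. \<Prod>e\<in>Es. 1 + (sinh \<beta> * bond e \<sigma> + (cosh \<beta> - 1) * (bond e \<sigma>)\<^sup>2)"
  let ?w = "canon U (\<lambda>_. None) {} {}"
  obtain c where c: "c > 0" "\<And>\<sigma>. \<sigma> \<in> spins U \<Longrightarrow> weight [] \<sigma> = c * canon U (\<lambda>_. None) Es {} \<sigma>"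
    using base_canon[OF fin sub] by blast
  have w: "canon U (\<lambda>_. None) Es {} \<sigma> = ?w \<sigma> * ?G \<sigma>" if s: "\<sigma> \<in> spins U" for \<sigma>
  proof -
    have "exp (\<beta> * bond e \<sigma>) = 1 + (sinh \<beta> * bond e \<sigma> + (cosh \<beta> - 1) * (bond e \<sigma>)\<^sup>2)" for e
      using bond_values[OF s, of e] by (auto simp: cosh_plus_sinh cosh_minus_sinh algebra_simps)
    then have "exp (\<beta> * (\<Sum>e\<in>Es. bond e \<sigma>)) = ?G \<sigma>"
      by (simp add: sum_distrib_left exp_sum[OF finite_Es])
    then show ?thesis unfolding canon_def by simp
  qed
  have G: "cone1 ?G"
    using beta_pos cosh_real_ge_1[of \<beta>]
    by (intro cone1_prod cone1_add[OF cone1_const cone1_add[OF cone1_scale cone1_scale]] cone1_bond cone1_power) auto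
  define L where "L = U - {u}"
  have L: "U = insert u L" "u \<notin> L" using True unfolding L_def by auto
  define P where "P = (\<lambda>\<sigma>::'v \<Rightarrow> int. \<Prod>v\<in>L. site_weight None (\<sigma> v))"
  have wL: "?w (\<sigma>(u := s)) = site_weight None s * P \<sigma>" for \<sigma> s
  proof -
    have "(\<Prod>v\<in>L. site_weight None ((\<sigma>(u := s)) v)) = P \<sigma>"
      unfolding P_def using L(2) by (intro prod.cong) auto
    then show ?thesis unfolding canon_def using L fin by simp
  qed
  define T where "T = (\<Sum>\<sigma>\<in>spins L. P \<sigma>)"
  have 1: "(\<Sum>\<sigma>\<in>spins U. ?w \<sigma>) = (1 + 2 * exp \<Delta>) * T"
    unfolding L(1) sum_spins_insert[OF L(2)] unfolding L(1)[symmetric] wL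
    by (simp add: site_weight_def T_def sum_distrib_left algebra_simps sum.distrib[symmetric])
  have 2: "(\<Sum>\<sigma>\<in>spins U. ?w \<sigma> * ?F \<sigma>) = 2 * exp \<Delta> * T"
    unfolding L(1) sum_spins_insert[OF L(2)] unfolding L(1)[symmetric] wL
    by (simp add: site_weight_def T_def sum_distrib_left algebra_simps sum.distrib[symmetric])
  have pos: "0 < (\<Sum>\<sigma>\<in>spins U. ?w \<sigma>)" by (rule canon_pos[OF fin occupied_empty])
  have T: "T \<noteq> 0" using pos unfolding 1 by auto
  have "occupation = avg (spins U) ?w ?F"
    unfolding avg_def 1 2 occupation_def using T by simp
  also have "\<dots> \<le> avg (spins U) (\<lambda>\<sigma>. ?w \<sigma> * ?G \<sigma>) ?F"
  proof (rule avg_tilt[OF canon_ginibre[OF fin occupied_empty] _ G _ pos])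
    show "cone1 ?F" by (intro cone1_power cone1_coord)
    have "(\<Sum>\<sigma>\<in>spins U. ?w \<sigma> * ?G \<sigma>) = (\<Sum>\<sigma>\<in>spins U. canon U (\<lambda>_. None) Es {} \<sigma>)"
      using w by (intro sum.cong) auto
    then show "0 < (\<Sum>\<sigma>\<in>spins U. ?w \<sigma> * ?G \<sigma>)" using canon_pos[OF fin occupied_empty] by simp
  qed
  also have "\<dots> = mean U [] ?F"
    using c w by (intro avg_cong[where c = c, symmetric]) auto
  finally show ?thesis .
qed

lemma mean_aligned_ge:
  assumes fin: "finite U" and sub: "U \<subseteq> V" and e: "e \<in> Es"
  shows "occupation\<^sup>2 / 2 \<le> mean U [] (aligned e)"
proof -
  obtain u where u: "u \<in> e" using card_bond[OF e] by fastforce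
  obtain w where w: "e = {u, w}" "u \<noteq> w" using bond_pair[OF e u] by blast
  have g: "ginibre (spins U) (weight [])" by (rule weight_ginibre[OF fin sub]) (auto simp: valid_Nil[OF fin])
  let ?s = "\<lambda>v \<sigma>::'v \<Rightarrow> int. (real_of_int (\<sigma> v))\<^sup>2"
  have s: "cone1 (\<lambda>\<sigma>. ?s v \<sigma>)" for v :: 'v by (intro cone1_power cone1_coord)
  have "occupation\<^sup>2 \<le> mean U [] (?s u) * mean U [] (?s w)"
    unfolding power2_eq_square[of occupation] using occupation_range mean_site_ge[OF fin sub]
    by (intro mult_mono) (auto intro: order_trans[OF less_imp_le])
  also have "\<dots> \<le> mean U [] (\<lambda>\<sigma>. ?s u \<sigma> * ?s w \<sigma>)"
    using avg_gks[OF g s s] valid_Nil[OF fin] unfolding valid_def by blast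
  also have "\<dots> = mean U [] (\<lambda>\<sigma>. (bond e \<sigma>)\<^sup>2)"
    by (simp add: bond_two[OF w] power_mult_distrib)
  also have "\<dots> \<le> 2 * mean U [] (aligned e)"
  proof -
    have "0 \<le> mean U [] (bond e)" by (rule avg_nonneg[OF g cone1_bond])
    moreover have "2 * mean U [] (aligned e) = mean U [] (bond e) + mean U [] (\<lambda>\<sigma>. (bond e \<sigma>)\<^sup>2)"
      unfolding mean_scale[symmetric] mean_add[symmetric] two_aligned by (rule refl)
    ultimately show ?thesis by linarith
  qed
  finally show ?thesis by simp
qed

text \<open>The bond covariance is 2 cov(aligned) - cov(b^2), so the subtracted term must be a
  definite fraction smaller. That fraction comes from the preference tanh \<beta> for alignment
  among occupied pairs.\<close>

theorem influence_le_bond: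
  assumes fin: "finite U" and sub: "U \<subseteq> V" and F: "cone1 F" and e: "e \<in> Es"
  shows "cov U [] F (answer (Bond e)) + (\<Sum>u\<in>e. cov U [] F (answer (Site u)))
     \<le> (1 + 4 / occupation\<^sup>2) / tanh \<beta> * cov U [] F (bond e)"
proof -
  define C where "C = cov U [] F (aligned e)"
  define D where "D = cov U [] F (\<lambda>\<sigma>. (bond e \<sigma>)\<^sup>2)"
  define b where "b = mean U [] (aligned e)"
  define q where "q = mean U [] (\<lambda>\<sigma>. (bond e \<sigma>)\<^sup>2)"
  define t where "t = tanh \<beta>"
  have t: "0 < t" "t < 1" using beta_pos tanh_real_lt_1 unfolding t_def by auto
  have C: "0 \<le> C" unfolding C_def by (rule covariance_nonneg[OF fin sub F cone1_aligned])
  have b: "occupation\<^sup>2 / 2 \<le> b" unfolding b_def by (rule mean_aligned_ge[OF fin sub e])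
  then have b0: "0 < b" using occupation_range zero_less_power[of occupation 2] by linarith
  have two: "2 * b = mean U [] (bond e) + q"
    unfolding b_def q_def mean_scale[symmetric] mean_add[symmetric] two_aligned by (rule refl)
  \<comment> \<open>Thus q / b is at most 2 / (1 + t), strictly below 2; this is the gap that makes
    2 C - D a positive multiple of C.\<close>
  then have q: "q * (1 + t) \<le> 2 * b"
    using mean_bond_ge[OF fin sub e] unfolding q_def t_def by (simp add: algebra_simps)
  have "2 * C = cov U [] F (bond e) + D"
    unfolding C_def D_def covariance_scale[symmetric] covariance_add[symmetric] two_aligned by (rule refl)
  then have cov: "cov U [] F (bond e) = 2 * C - D" by simp
  have D: "b * D \<le> q * C" unfolding b_def D_def q_def C_def by (rule covariance_square_le[OF fin sub F e])
  have "b * (1 + t) * D \<le> (1 + t) * (q * C)" using mult_left_mono[OF D, of "1 + t"] t by (simp add: mult_ac)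
  also have "\<dots> \<le> 2 * b * C" using mult_right_mono[OF q C] by (simp add: mult_ac)
  finally have "(1 + t) * D \<le> 2 * C" using b0 by (simp add: mult.assoc mult.left_commute)
  then have "(1 + t) * (2 * C - D) \<ge> 2 * t * C" by (simp add: algebra_simps)
  moreover have "2 * t * C \<ge> (1 + t) * (t * C)"
    using t C mult_right_mono[of "1 + t" 2 "t * C"] by (simp add: mult_ac)
  ultimately have "(1 + t) * (t * C) \<le> (1 + t) * (2 * C - D)" by linarith
  then have tC: "t * C \<le> 2 * C - D" using t by simp
  have bond: "cov U [] F (answer (Bond e)) \<le> C"
  proof -
    have "answer (Bond e) = (\<lambda>\<sigma>. (1 - exp (- 2 * \<beta>)) * aligned e \<sigma>)" using answer_Bond by auto
    then have "cov U [] F (answer (Bond e)) = (1 - exp (- 2 * \<beta>)) * C"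
      unfolding C_def by (simp only: covariance_scale)
    also have "\<dots> \<le> 1 * C" using exp_range C by (intro mult_right_mono) auto
    finally show ?thesis by simp
  qed
  \<comment> \<open>Each end costs at most C / b, and b is at least half the squared occupation; two
    ends give the 4 in the constant.\<close>
  have site: "cov U [] F (answer (Site u)) \<le> 2 / occupation\<^sup>2 * C" if "u \<in> e" for u
  proof -
    let ?c = "cov U [] F (answer (Site u))"
    have c: "0 \<le> ?c" by (rule covariance_nonneg[OF fin sub F cone1_answer])
    have "occupation\<^sup>2 / 2 * ?c \<le> b * ?c" using b c by (rule mult_right_mono)
    also have "\<dots> \<le> mean U [] (answer (Site u)) * C"
      unfolding b_def C_def by (rule covariance_site_le[OF fin sub F e that])
    also have "\<dots> \<le> 1 * C" using mean_answer_range C by (intro mult_right_mono) auto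
    finally show ?thesis using occupation_range by (simp add: field_simps)
  qed
  have "cov U [] F (answer (Bond e)) + (\<Sum>u\<in>e. cov U [] F (answer (Site u)))
     \<le> C + (\<Sum>u\<in>e. 2 / occupation\<^sup>2 * C)"
    by (intro add_mono sum_mono bond site)
  also have "\<dots> = (1 + 4 / occupation\<^sup>2) / t * (t * C)"
    using card_bond[OF e] t by (simp add: field_simps)
  also have "\<dots> \<le> (1 + 4 / occupation\<^sup>2) / t * (2 * C - D)"
    using t by (intro mult_left_mono tC) auto
  finally show ?thesis unfolding cov t_def .
qed

end

section \<open>The lattice\<close>

lemma lat_adj_sym: "lat_adj x y \<Longrightarrow> lat_adj y x"
  unfolding lat_adj_def by (simp add: abs_minus_commute)

lemma lat_adj_irrefl: "lat_adj x y \<Longrightarrow> x \<noteq> y"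
  unfolding lat_adj_def by auto

lemma lat_adj_component:
  fixes x y :: "int^'d"
  assumes "lat_adj x y" shows "\<bar>x $ i - y $ i\<bar> \<le> 1"
proof -
  have "\<bar>x $ i - y $ i\<bar> \<le> (\<Sum>i\<in>UNIV. \<bar>x $ i - y $ i\<bar>)" by (rule member_le_sum) auto
  then show ?thesis using assms unfolding lat_adj_def by simp
qed

lemma lat_adj_translate: "lat_adj (x + a) (y + a) \<longleftrightarrow> lat_adj x y"
  unfolding lat_adj_def by simp

lemma box_mono:
  assumes "k \<le> n" shows "box k \<subseteq> box n"
proof
  fix x assume "x \<in> box k"
  then have "\<bar>x $ i\<bar> \<le> int n" for i
    using assms order_trans[of "\<bar>x $ i\<bar>" "int k" "int n"] unfolding box_def by simp
  then show "x \<in> box n" unfolding box_def by simp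
qed

lemma box_adj: "x \<in> box k \<Longrightarrow> lat_adj x y \<Longrightarrow> y \<in> box (Suc k)"
proof -
  assume x: "x \<in> box k" and a: "lat_adj x y"
  have "\<bar>y $ i\<bar> \<le> int (Suc k)" for i
  proof -
    have "\<bar>x $ i\<bar> \<le> int k" using x unfolding box_def by simp
    then show ?thesis using lat_adj_component[OF a, of i] by simp
  qed
  then show ?thesis unfolding box_def by simp
qed

lemma finite_box: "finite (box n :: (int^'d) set)"
proof -
  have "box n \<subseteq> vec_lambda ` (PiE UNIV (\<lambda>_::'d. {- int n..int n}))"
  proof
    fix x :: "int^'d" assume "x \<in> box n"
    then have "vec_nth x \<in> PiE UNIV (\<lambda>_. {- int n..int n})" unfolding box_def by (auto simp: abs_le_iff minus_le_iff)
    then show "x \<in> vec_lambda ` (PiE UNIV (\<lambda>_::'d. {- int n..int n}))"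
      by (metis image_eqI vec_nth_inverse)
  qed
  moreover have "finite (PiE UNIV (\<lambda>_::'d. {- int n..int n}))" by (intro finite_PiE) auto
  ultimately show ?thesis by (meson finite_imageI finite_subset)
qed

definition radius :: "int^'d \<Rightarrow> nat" where
  "radius x = nat (sup_norm x)"

lemma sup_norm_nonneg: "0 \<le> sup_norm (x :: int^'d)"
proof -
  have "\<bar>x $ undefined\<bar> \<le> sup_norm x" unfolding sup_norm_def by (rule Max_ge) auto
  then show ?thesis by linarith
qed

lemma mem_box_radius: "x \<in> box k \<longleftrightarrow> radius x \<le> k"
proof -
  have "sup_norm x \<le> int k \<longleftrightarrow> (\<forall>i. \<bar>x $ i\<bar> \<le> int k)" unfolding sup_norm_def by (subst Max_le_iff) auto
  then show ?thesis unfolding box_def radius_def by auto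
qed

text \<open>Unordered edges with at least one end in U, so internal and boundary edges form a single
  family, each counted once.\<close>

definition touching :: "(int^'d) set \<Rightarrow> (int^'d) set set" where
  "touching U = (\<lambda>(x, y). {x, y}) ` {(x, y). x \<in> U \<and> lat_adj x y}"

lemma finite_neighbours: "finite {y. lat_adj x y}"
proof (rule finite_subset)
  show "{y. lat_adj x y} \<subseteq> box (Suc (radius x))" using box_adj[of x "radius x"] by (auto simp: mem_box_radius)
qed (rule finite_box)

lemma finite_pairs: "finite U \<Longrightarrow> finite {(x, y). x \<in> U \<and> lat_adj x y}"
proof -
  assume "finite U"
  then have "finite (Sigma U (\<lambda>x. {y. lat_adj x y}))" using finite_neighbours by (intro finite_SigmaI) auto
  then show ?thesis by (rule rev_finite_subset) auto
qed

lemma touchingE: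
  assumes "e \<in> touching U"
  obtains x y where "e = {x, y}" "x \<in> U" "lat_adj x y"
  using assms unfolding touching_def by auto

lemma touching_mono: "U' \<subseteq> U \<Longrightarrow> touching U' \<subseteq> touching U"
  unfolding touching_def by auto

lemma touching_restrict: "e \<in> touching U \<Longrightarrow> e \<inter> U' \<noteq> {} \<Longrightarrow> e \<in> touching U'"
proof -
  assume t: "e \<in> touching U" and n: "e \<inter> U' \<noteq> {}"
  obtain x y where e: "e = {x, y}" "lat_adj x y" using t by (rule touchingE)
  then consider "x \<in> U'" | "y \<in> U'" using n by auto
  then show ?thesis
  proof cases
    case 1 then show ?thesis using e unfolding touching_def by force
  next
    case 2
    then have "(y, x) \<in> {(x, y). x \<in> U' \<and> lat_adj x y}" using e lat_adj_sym by auto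
    then show ?thesis unfolding touching_def e by (force simp: insert_commute)
  qed
qed

lemma blume_capel_lattice:
  assumes "finite U" "0 < \<beta>" shows "blume_capel U (touching U) \<beta>"
proof
  show "finite (touching U)" unfolding touching_def using finite_pairs[OF assms(1)] by simp
  show "card e = 2" if "e \<in> touching U" for e using that by (metis card_2_iff lat_adj_irrefl touchingE)
qed (use assms in auto)

section \<open>Gibbs averages on the lattice\<close>

definition energy :: "real \<Rightarrow> real \<Rightarrow> (int^'d) set \<Rightarrow> (int^'d \<Rightarrow> int) \<Rightarrow> real" where
  "energy \<beta> \<Delta> U \<sigma> = \<Delta> * (\<Sum>v\<in>U. (real_of_int (\<sigma> v))\<^sup>2) + \<beta> * (\<Sum>e\<in>touching U. bond e \<sigma>)"

definition gibbs :: "real \<Rightarrow> real \<Rightarrow> (int^'d) set \<Rightarrow> ((int^'d \<Rightarrow> int) \<Rightarrow> real) \<Rightarrow> real" where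
  "gibbs \<beta> \<Delta> U = avg (spins U) (\<lambda>\<sigma>. exp (energy \<beta> \<Delta> U \<sigma>))"

lemma bc_exponent_energy:
  fixes \<sigma> :: "int^'d \<Rightarrow> int"
  shows "bc_exponent \<beta> \<Delta> n \<sigma> = energy \<beta> \<Delta> (box n) \<sigma>"
proof -
  let ?B = "box n :: (int^'d) set"
  let ?P = "{(x, y). x \<in> ?B \<and> lat_adj x y}"
  let ?g = "\<lambda>x y. real_of_int (\<sigma> x * \<sigma> y)"
  \<comment> \<open>Among ordered pairs with first entry in the box an internal edge occurs twice
    and a boundary edge once, which fixes the weights 1/2 and 1.\<close>
  let ?c = "\<lambda>y. if y \<in> ?B then 1/2 else 1 :: real"
  let ?h = "\<lambda>(x, y). ?c y * ?g x y"
  have P: "?P = Sigma ?B (\<lambda>x. {y. lat_adj x y})" by auto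
  have inner: "(\<Sum>y\<in>{y. lat_adj x y}. ?c y * ?g x y)
     = (1/2) * (\<Sum>y\<in>{y. lat_adj x y} \<inter> ?B. ?g x y) + (\<Sum>y\<in>{y. lat_adj x y} - ?B. ?g x y)" for x
  proof -
    have "(\<Sum>y\<in>{y. lat_adj x y}. ?c y * ?g x y)
      = (\<Sum>y\<in>{y. lat_adj x y} \<inter> ?B. ?c y * ?g x y) + (\<Sum>y\<in>{y. lat_adj x y} - ?B. ?c y * ?g x y)"
      by (rule sum.Int_Diff[OF finite_neighbours])
    moreover have "(\<Sum>y\<in>{y. lat_adj x y} \<inter> ?B. ?c y * ?g x y) = (1/2) * (\<Sum>y\<in>{y. lat_adj x y} \<inter> ?B. ?g x y)"
      by (simp add: sum_distrib_left)
    moreover have "(\<Sum>y\<in>{y. lat_adj x y} - ?B. ?c y * ?g x y) = (\<Sum>y\<in>{y. lat_adj x y} - ?B. ?g x y)"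
      by (intro sum.cong) auto
    ultimately show ?thesis by simp
  qed
  have "(\<Sum>p\<in>?P. ?h p) = (\<Sum>x\<in>?B. \<Sum>y\<in>{y. lat_adj x y}. ?c y * ?g x y)"
    unfolding P by (rule sum.Sigma[symmetric]) (simp_all add: finite_neighbours finite_box)
  also have "\<dots> = (1/2) * (\<Sum>x\<in>?B. \<Sum>y\<in>{y. lat_adj x y} \<inter> ?B. ?g x y) + (\<Sum>x\<in>?B. \<Sum>y\<in>{y. lat_adj x y} - ?B. ?g x y)"
    by (simp only: inner sum.distrib sum_distrib_left)
  finally have 1: "(\<Sum>p\<in>?P. ?h p) = (1/2) * (\<Sum>x\<in>?B. \<Sum>y\<in>{y. lat_adj x y} \<inter> ?B. ?g x y) + (\<Sum>x\<in>?B. \<Sum>y\<in>{y. lat_adj x y} - ?B. ?g x y)" .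
  have "(\<Sum>p\<in>?P. ?h p) = (\<Sum>e\<in>touching ?B. \<Sum>p | p \<in> ?P \<and> (case p of (x, y) \<Rightarrow> {x, y}) = e. ?h p)"
    unfolding touching_def by (rule sum.image_gen) (rule finite_pairs[OF finite_box])
  also have "\<dots> = (\<Sum>e\<in>touching ?B. bond e \<sigma>)"
  proof (rule sum.cong[OF refl])
    fix e assume "e \<in> touching ?B"
    then obtain x y where e: "e = {x, y}" "x \<in> ?B" "lat_adj x y" by (rule touchingE)
    have ne: "x \<noteq> y" using lat_adj_irrefl[OF e(3)] .
    have b: "bond e \<sigma> = ?g x y" unfolding bond_two[OF e(1) ne] by simp
    show "(\<Sum>p | p \<in> ?P \<and> (case p of (x, y) \<Rightarrow> {x, y}) = e. ?h p) = bond e \<sigma>"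
    proof (cases "y \<in> ?B")
      case True
      have "{p. p \<in> ?P \<and> (case p of (x, y) \<Rightarrow> {x, y}) = e} = {(x, y), (y, x)}"
      proof (intro equalityI subsetI)
        fix p assume "p \<in> {p. p \<in> ?P \<and> (case p of (x, y) \<Rightarrow> {x, y}) = e}"
        then show "p \<in> {(x, y), (y, x)}" unfolding e(1) by (cases p) (simp add: doubleton_eq_iff)
      next
        fix p assume "p \<in> {(x, y), (y, x)}"
        then consider "p = (x, y)" | "p = (y, x)" by blast
        then show "p \<in> {p. p \<in> ?P \<and> (case p of (x, y) \<Rightarrow> {x, y}) = e}"
          by cases (use e(2,3) True lat_adj_sym[OF e(3)] in \<open>simp_all add: e(1) insert_commute\<close>)
      qed
      then show ?thesis using ne e True b by (simp add: mult.commute)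
    next
      case False
      have "{p. p \<in> ?P \<and> (case p of (x, y) \<Rightarrow> {x, y}) = e} = {(x, y)}"
      proof (intro equalityI subsetI)
        fix p assume "p \<in> {p. p \<in> ?P \<and> (case p of (x, y) \<Rightarrow> {x, y}) = e}"
        then show "p \<in> {(x, y)}" using False unfolding e(1) by (cases p) (auto simp: doubleton_eq_iff)
      next
        fix p assume "p \<in> {(x, y)}"
        then show "p \<in> {p. p \<in> ?P \<and> (case p of (x, y) \<Rightarrow> {x, y}) = e}" using e(2,3) by (simp add: e(1))
      qed
      then show ?thesis using False b by simp
    qed
  qed
  finally have 2: "(\<Sum>p\<in>?P. ?h p) = (\<Sum>e\<in>touching ?B. bond e \<sigma>)" .
  show ?thesis unfolding bc_exponent_def energy_def 2[symmetric] 1 by (simp add: algebra_simps)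
qed

lemma bc_plus_exp_gibbs:
  fixes F :: "(int^'d \<Rightarrow> int) \<Rightarrow> real"
  shows "bc_plus_exp \<beta> \<Delta> n F = gibbs \<beta> \<Delta> (box n) F"
proof -
  have "plus_configs n = spins (box n :: (int^'d) set)" unfolding plus_configs_def spins_def by simp
  then show ?thesis unfolding bc_plus_exp_def gibbs_def avg_def bc_exponent_energy by (simp add: mult.commute)
qed

lemma base_weight_energy:
  assumes "finite U" "0 < \<beta>"
  shows "blume_capel.weight U (touching U) \<beta> \<Delta> [] = (\<lambda>\<sigma>. exp (energy \<beta> \<Delta> U \<sigma>))"
  using blume_capel.weight.simps(1)[OF blume_capel_lattice[OF assms]]
    blume_capel.base_weight_def[OF blume_capel_lattice[OF assms]]
  unfolding energy_def by (simp add: fun_eq_iff)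

lemma energy_restrict:
  assumes fin: "finite U" and sub: "U' \<subseteq> U" and s: "\<sigma> \<in> spins U'"
  shows "energy \<beta> \<Delta> U \<sigma> = energy \<beta> \<Delta> U' \<sigma> + (\<Delta> * card (U - U') + \<beta> * card (touching U - touching U'))"
proof -
  have fT: "finite (touching U)" unfolding touching_def using finite_pairs[OF fin] by simp
  have "(\<Sum>v\<in>U. (real_of_int (\<sigma> v))\<^sup>2) = (\<Sum>v\<in>U - U'. (real_of_int (\<sigma> v))\<^sup>2) + (\<Sum>v\<in>U'. (real_of_int (\<sigma> v))\<^sup>2)"
    by (rule sum.subset_diff[OF sub fin])
  also have "(\<Sum>v\<in>U - U'. (real_of_int (\<sigma> v))\<^sup>2) = card (U - U')"
    using spins_outside[OF s] by simp
  finally have 1: "(\<Sum>v\<in>U. (real_of_int (\<sigma> v))\<^sup>2) = card (U - U') + (\<Sum>v\<in>U'. (real_of_int (\<sigma> v))\<^sup>2)" .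
  have "(\<Sum>e\<in>touching U. bond e \<sigma>) = (\<Sum>e\<in>touching U - touching U'. bond e \<sigma>) + (\<Sum>e\<in>touching U'. bond e \<sigma>)"
    by (rule sum.subset_diff[OF touching_mono[OF sub] fT])
  also have "(\<Sum>e\<in>touching U - touching U'. bond e \<sigma>) = (\<Sum>e\<in>touching U - touching U'. 1)"
  proof (rule sum.cong[OF refl])
    fix e assume "e \<in> touching U - touching U'"
    then have "e \<inter> U' = {}" using touching_restrict by blast
    then show "bond e \<sigma> = 1" unfolding bond_def using spins_outside[OF s] by (intro prod.neutral) auto
  qed
  finally have 2: "(\<Sum>e\<in>touching U. bond e \<sigma>) = card (touching U - touching U') + (\<Sum>e\<in>touching U'. bond e \<sigma>)" by simp
  show ?thesis unfolding energy_def 1 2 by (simp add: algebra_simps)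
qed

text \<open>On configurations that are plus outside U' the two energies differ by a constant, so the
  locale built on U also computes the Gibbs averages of every smaller volume.\<close>

lemma mean_gibbs:
  assumes "finite U" "0 < \<beta>" "U' \<subseteq> U"
  shows "avg (spins U') (blume_capel.weight U (touching U) \<beta> \<Delta> []) F = gibbs \<beta> \<Delta> U' F"
  unfolding base_weight_energy[OF assms(1,2)] gibbs_def
  by (rule avg_cong[where c = "exp (\<Delta> * card (U - U') + \<beta> * card (touching U - touching U'))"])
    (simp_all add: energy_restrict[OF assms(1,3)] exp_add[symmetric])

lemma gibbs_antimono:
  assumes fin: "finite U" and "0 < \<beta>" and sub: "U' \<subseteq> U" and F: "cone1 F"
  shows "gibbs \<beta> \<Delta> U F \<le> gibbs \<beta> \<Delta> U' F"
proof -
  interpret blume_capel U "touching U" \<beta> \<Delta> by (rule blume_capel_lattice[OF assms(1,2)])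
  have fin': "finite U'" using fin sub finite_subset by auto
  have "mean U [] F \<le> mean U' [] F"
    by (rule mean_volume_mono[OF fin _ sub _ _ F]) (use valid_Nil[OF fin'] in auto)
  then show ?thesis using mean_gibbs[OF assms(1,2)] sub by simp
qed

lemma gibbs_partition_pos: "finite U \<Longrightarrow> 0 < (\<Sum>\<sigma>\<in>spins U. exp (energy \<beta> \<Delta> U \<sigma>))"
  using finite_spins[of U] by (intro sum_pos) (auto simp: spins_def intro!: exI[of _ "\<lambda>_. 1"])

lemma gibbs_nonneg:
  assumes "finite U" "0 < \<beta>" "cone1 F" shows "0 \<le> gibbs \<beta> \<Delta> U F"
proof -
  interpret blume_capel U "touching U" \<beta> \<Delta> by (rule blume_capel_lattice[OF assms(1,2)])
  have "0 \<le> mean U [] F"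
    by (rule avg_nonneg[OF weight_ginibre[OF assms(1)] assms(3)]) (use valid_Nil[OF assms(1)] in auto)
  then show ?thesis using mean_gibbs[OF assms(1,2)] by simp
qed

lemma gibbs_cong: "(\<And>\<sigma>. \<sigma> \<in> spins U \<Longrightarrow> F \<sigma> = G \<sigma>) \<Longrightarrow> gibbs \<beta> \<Delta> U F = gibbs \<beta> \<Delta> U G"
  unfolding gibbs_def avg_def by simp

lemma gibbs_outside:
  assumes "finite U" "v \<notin> U" shows "gibbs \<beta> \<Delta> U (\<lambda>\<sigma>. real_of_int (\<sigma> v)) = 1"
proof -
  have "gibbs \<beta> \<Delta> U (\<lambda>\<sigma>. real_of_int (\<sigma> v)) = gibbs \<beta> \<Delta> U (\<lambda>\<sigma>. 1)"
    by (rule gibbs_cong) (simp add: spins_outside[OF _ assms(2)])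
  also have "\<dots> = 1" using gibbs_partition_pos[OF assms(1), of \<beta> \<Delta>] unfolding gibbs_def avg_def by simp
  finally show ?thesis .
qed

lemma gibbs_translate:
  fixes a :: "int^'d"
  shows "gibbs \<beta> \<Delta> ((\<lambda>x. x + a) ` U) (\<lambda>\<sigma>. real_of_int (\<sigma> (v + a))) = gibbs \<beta> \<Delta> U (\<lambda>\<sigma>. real_of_int (\<sigma> v))"
proof -
  let ?t = "\<lambda>x::int^'d. x + a"
  define T where "T = (\<lambda>\<sigma>::int^'d \<Rightarrow> int. \<lambda>v. \<sigma> (v + a))"
  define R where "R = (\<lambda>\<sigma>::int^'d \<Rightarrow> int. \<lambda>v. \<sigma> (v - a))"
  have inj: "inj ?t" by (auto simp: inj_on_def)
  have mem: "x \<in> ?t ` U \<longleftrightarrow> x - a \<in> U" for x by (auto simp: image_iff) (metis diff_add_cancel)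
  have bij: "bij_betw T (spins (?t ` U)) (spins U)"
    by (rule bij_betw_byWitness[where f' = R]) (auto simp: T_def R_def spins_def mem)
  have touch: "touching (?t ` U) = (\<lambda>e. ?t ` e) ` touching U"
  proof (intro equalityI subsetI)
    fix e assume "e \<in> touching (?t ` U)"
    then obtain x y where e: "e = {x, y}" "x \<in> ?t ` U" "lat_adj x y" by (rule touchingE)
    have "lat_adj (x - a) (y - a)" using e(3) lat_adj_translate[of "x - a" a "y - a"] by simp
    then have "{x - a, y - a} \<in> touching U" using e(2) unfolding touching_def mem by force
    moreover have "e = ?t ` {x - a, y - a}" using e by simp
    ultimately show "e \<in> (\<lambda>e. ?t ` e) ` touching U" by blast
  next
    fix e assume "e \<in> (\<lambda>e. ?t ` e) ` touching U"
    then obtain x y where e: "e = {x + a, y + a}" "x \<in> U" "lat_adj x y" by (auto elim!: touchingE)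
    then have "(x + a, y + a) \<in> {(x, y). x \<in> ?t ` U \<and> lat_adj x y}" by (simp add: lat_adj_translate)
    then show "e \<in> touching (?t ` U)" unfolding touching_def e by force
  qed
  have en: "energy \<beta> \<Delta> U (T \<sigma>) = energy \<beta> \<Delta> (?t ` U) \<sigma>" for \<sigma>
  proof -
    have "(\<Sum>v\<in>?t ` U. (real_of_int (\<sigma> v))\<^sup>2) = (\<Sum>v\<in>U. (real_of_int (T \<sigma> v))\<^sup>2)"
      unfolding T_def by (simp add: sum.reindex inj_on_def)
    moreover have "(\<Sum>e\<in>touching (?t ` U). bond e \<sigma>) = (\<Sum>e\<in>touching U. bond (?t ` e) \<sigma>)"
      unfolding touch using inj_image_eq_iff[OF inj] by (subst sum.reindex) (auto simp: inj_on_def)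
    moreover have "bond (?t ` e) \<sigma> = bond e (T \<sigma>)" for e
      unfolding bond_def T_def by (simp add: prod.reindex inj_on_def)
    ultimately show ?thesis unfolding energy_def by simp
  qed
  have "(\<Sum>\<sigma>\<in>spins U. exp (energy \<beta> \<Delta> U \<sigma>)) = (\<Sum>\<sigma>\<in>spins (?t ` U). exp (energy \<beta> \<Delta> (?t ` U) \<sigma>))"
    unfolding en[symmetric] by (rule sum.reindex_bij_betw[OF bij, symmetric])
  moreover have "(\<Sum>\<sigma>\<in>spins U. exp (energy \<beta> \<Delta> U \<sigma>) * real_of_int (\<sigma> v))
     = (\<Sum>\<sigma>\<in>spins (?t ` U). exp (energy \<beta> \<Delta> (?t ` U) \<sigma>) * real_of_int (\<sigma> (v + a)))"
    unfolding en[symmetric] using sum.reindex_bij_betw[OF bij, of "\<lambda>\<sigma>. exp (energy \<beta> \<Delta> U \<sigma>) * real_of_int (\<sigma> v)"]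
    by (simp add: T_def)
  ultimately show ?thesis unfolding gibbs_def avg_def by simp
qed

section \<open>The magnetization, its derivative and the differential inequality\<close>

definition magnet :: "'d::finite itself \<Rightarrow> real \<Rightarrow> nat \<Rightarrow> real \<Rightarrow> real" where
  "magnet d \<Delta> n \<beta> = gibbs \<beta> \<Delta> (box n) (\<lambda>\<sigma>::int^'d \<Rightarrow> int. real_of_int (\<sigma> 0))"

lemma magnet_nonneg: "0 < \<beta> \<Longrightarrow> 0 \<le> magnet d \<Delta> n \<beta>"
  unfolding magnet_def by (rule gibbs_nonneg[OF finite_box _ cone1_coord])

lemma magnet_antimono: "0 < \<beta> \<Longrightarrow> k \<le> n \<Longrightarrow> magnet d \<Delta> n \<beta> \<le> magnet d \<Delta> k \<beta>"
  unfolding magnet_def by (rule gibbs_antimono[OF finite_box _ box_mono cone1_coord])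

text \<open>The box of radius k - \<open>radius y\<close> centred at y fits into the larger box, and
  shrinking the volume raises the magnetization.\<close>

lemma gibbs_spin_le:
  fixes y :: "int^'d"
  assumes "0 < \<beta>" "radius y \<le> k"
  shows "gibbs \<beta> \<Delta> (box k) (\<lambda>\<sigma>. real_of_int (\<sigma> y)) \<le> magnet TYPE('d) \<Delta> (k - radius y) \<beta>"
proof -
  have "(\<lambda>x. x + y) ` box (k - radius y) \<subseteq> box k"
  proof safe
    fix x :: "int^'d" assume x: "x \<in> box (k - radius y)"
    have y: "y \<in> box (radius y)" by (simp add: mem_box_radius)
    have "\<bar>(x + y) $ i\<bar> \<le> int k" for i
    proof -
      have "\<bar>x $ i\<bar> \<le> int (k - radius y)" "\<bar>y $ i\<bar> \<le> int (radius y)" using x y unfolding box_def by auto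
      then show ?thesis using assms(2) abs_triangle_ineq[of "x $ i" "y $ i"] by simp
    qed
    then show "x + y \<in> box k" unfolding box_def by simp
  qed
  then have "gibbs \<beta> \<Delta> (box k) (\<lambda>\<sigma>. real_of_int (\<sigma> y)) \<le> gibbs \<beta> \<Delta> ((\<lambda>x. x + y) ` box (k - radius y)) (\<lambda>\<sigma>. real_of_int (\<sigma> y))"
    by (intro gibbs_antimono[OF finite_box assms(1)] cone1_coord)
  also have "\<dots> = magnet TYPE('d) \<Delta> (k - radius y) \<beta>"
    using gibbs_translate[of \<beta> \<Delta> y "box (k - radius y)" 0] unfolding magnet_def by simp
  finally show ?thesis .
qed

text \<open>Vacating the whole box has positive weight. Strictness at n = 0 is what keeps the factor
  1 - m_0 in the differential inequality positive.\<close>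

lemma magnet_lt_1:
  "magnet TYPE('d::finite) \<Delta> n \<beta> < 1"
proof -
  let ?w = "\<lambda>\<sigma>::int^'d \<Rightarrow> int. exp (energy \<beta> \<Delta> (box n) \<sigma>)"
  define \<sigma>0 where "\<sigma>0 = (\<lambda>v::int^'d. if v \<in> box n then 0 else 1 :: int)"
  have s: "\<sigma>0 \<in> spins (box n)" "\<sigma>0 0 = 0" unfolding \<sigma>0_def spins_def by (auto simp: box_def)
  have "0 < (\<Sum>\<sigma>\<in>spins (box n). ?w \<sigma> * (1 - real_of_int (\<sigma> 0)))"
  proof (rule sum_pos2[OF finite_spins[OF finite_box] s(1)])
    show "0 \<le> ?w \<sigma> * (1 - real_of_int (\<sigma> 0))" if "\<sigma> \<in> spins (box n)" for \<sigma>
      using spins_value[OF that, of 0] by auto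
  qed (simp add: s)
  then have "(\<Sum>\<sigma>\<in>spins (box n). ?w \<sigma> * real_of_int (\<sigma> 0)) < (\<Sum>\<sigma>\<in>spins (box n). ?w \<sigma>)"
    by (simp add: right_diff_distrib sum_subtractf)
  then show ?thesis
    using gibbs_partition_pos[OF finite_box[where 'd = 'd], of \<beta> \<Delta> n] unfolding magnet_def gibbs_def avg_def by simp
qed

definition magnet_deriv :: "'d::finite itself \<Rightarrow> real \<Rightarrow> nat \<Rightarrow> real \<Rightarrow> real" where
  "magnet_deriv d \<Delta> n \<beta> = (\<Sum>e\<in>touching (box n).
     gibbs \<beta> \<Delta> (box n) (\<lambda>\<sigma>::int^'d \<Rightarrow> int. real_of_int (\<sigma> 0) * bond e \<sigma>)
     - gibbs \<beta> \<Delta> (box n) (\<lambda>\<sigma>::int^'d \<Rightarrow> int. real_of_int (\<sigma> 0)) * gibbs \<beta> \<Delta> (box n) (bond e))"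

lemma magnet_has_derivative:
  "(magnet TYPE('d::finite) \<Delta> n has_real_derivative magnet_deriv TYPE('d) \<Delta> n \<beta>) (at \<beta>)"
proof -
  let ?S = "spins (box n :: (int^'d) set)"
  let ?f = "\<lambda>\<sigma>::int^'d \<Rightarrow> int. real_of_int (\<sigma> 0)"
  let ?A = "\<lambda>\<sigma>::int^'d \<Rightarrow> int. \<Sum>v\<in>box n. (real_of_int (\<sigma> v))\<^sup>2"
  let ?B = "\<lambda>\<sigma>::int^'d \<Rightarrow> int. \<Sum>e\<in>touching (box n). bond e \<sigma>"
  let ?w = "\<lambda>b \<sigma>. exp (energy b \<Delta> (box n) \<sigma>)"
  define N where "N = (\<lambda>b. \<Sum>\<sigma>\<in>?S. ?w b \<sigma> * ?f \<sigma>)"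
  define Z where "Z = (\<lambda>b. \<Sum>\<sigma>\<in>?S. ?w b \<sigma>)"
  define N' where "N' = (\<Sum>\<sigma>\<in>?S. ?w \<beta> \<sigma> * (?f \<sigma> * ?B \<sigma>))"
  define Z' where "Z' = (\<Sum>\<sigma>\<in>?S. ?w \<beta> \<sigma> * ?B \<sigma>)"
  have w: "((\<lambda>b. ?w b \<sigma>) has_real_derivative ?w \<beta> \<sigma> * ?B \<sigma>) (at \<beta>)" for \<sigma>
    unfolding energy_def by (auto intro!: derivative_eq_intros)
  have dN: "(N has_real_derivative N') (at \<beta>)"
    unfolding N_def N'_def by (rule DERIV_sum) (rule derivative_eq_intros w refl | simp)+
  have dZ: "(Z has_real_derivative Z') (at \<beta>)"
    unfolding Z_def Z'_def by (rule DERIV_sum) (rule w)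
  have Z: "Z \<beta> \<noteq> 0" unfolding Z_def using gibbs_partition_pos[OF finite_box[where 'd = 'd], of \<beta> \<Delta> n] by linarith
  have m: "magnet TYPE('d) \<Delta> n = (\<lambda>b. N b / Z b)"
    unfolding magnet_def gibbs_def avg_def N_def Z_def by auto
  have "((\<lambda>b. N b / Z b) has_real_derivative (N' * Z \<beta> - N \<beta> * Z') / (Z \<beta> * Z \<beta>)) (at \<beta>)"
    by (rule DERIV_divide[OF dN dZ Z])
  moreover have "(N' * Z \<beta> - N \<beta> * Z') / (Z \<beta> * Z \<beta>) = magnet_deriv TYPE('d) \<Delta> n \<beta>"
  proof -
    have "N' = (\<Sum>e\<in>touching (box n). \<Sum>\<sigma>\<in>?S. ?w \<beta> \<sigma> * (?f \<sigma> * bond e \<sigma>))"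
      unfolding N'_def sum_distrib_left by (rule sum.swap)
    then have 1: "N' / Z \<beta> = (\<Sum>e\<in>touching (box n). gibbs \<beta> \<Delta> (box n) (\<lambda>\<sigma>. ?f \<sigma> * bond e \<sigma>))"
      unfolding gibbs_def avg_def Z_def by (simp add: sum_divide_distrib)
    have "Z' = (\<Sum>e\<in>touching (box n). \<Sum>\<sigma>\<in>?S. ?w \<beta> \<sigma> * bond e \<sigma>)"
      unfolding Z'_def sum_distrib_left by (rule sum.swap)
    then have 2: "Z' / Z \<beta> = (\<Sum>e\<in>touching (box n :: (int^'d) set). gibbs \<beta> \<Delta> (box n) (bond e))"
      unfolding gibbs_def avg_def Z_def by (simp add: sum_divide_distrib)
    have "(N' * Z \<beta> - N \<beta> * Z') / (Z \<beta> * Z \<beta>) = N' / Z \<beta> - (N \<beta> / Z \<beta>) * (Z' / Z \<beta>)"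
      using Z by (simp add: field_simps)
    also have "\<dots> = magnet_deriv TYPE('d) \<Delta> n \<beta>"
      unfolding 1 2 magnet_deriv_def by (simp add: sum_subtractf sum_distrib_left gibbs_def avg_def N_def Z_def)
    finally show ?thesis .
  qed
  ultimately show ?thesis unfolding m by simp
qed

text \<open>The constant of the influence bound with the occupation probability written out, which
  shows that it is the same for all boxes.\<close>

definition rate :: "real \<Rightarrow> real \<Rightarrow> real" where
  "rate \<Delta> \<beta> = (1 + 4 / (2 * exp \<Delta> / (1 + 2 * exp \<Delta>))\<^sup>2) / tanh \<beta>"

lemma sum_reveal_le:
  fixes e :: "(int^'d) set"
  assumes \<beta>: "0 < \<beta>" and e: "e \<in> touching (box n)"
  shows "(\<Sum>k<n. if e \<inter> box k = {} then 0 else \<Sum>v\<in>e. gibbs \<beta> \<Delta> (box k) (\<lambda>\<sigma>. real_of_int (\<sigma> v)))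
     \<le> 2 * (1 + (\<Sum>j<n. magnet TYPE('d) \<Delta> j \<beta>))"
proof -
  let ?M = "\<lambda>j. magnet TYPE('d) \<Delta> j \<beta>"
  \<comment> \<open>For one end v of e: once v is inside the box its magnetization is that of a
    smaller box. Outside, it is 1, but then e meets the box for only one k, the one with k + 1 =
    \<open>radius v\<close>. That single term is the 1 in the bound, and the two ends give the
    factor 2.\<close>
  let ?a = "\<lambda>k v. if radius v \<le> k then ?M (k - radius v) else if Suc k = radius v then 1 else 0"
  obtain x y where xy: "e = {x, y}" "lat_adj x y" using e by (rule touchingE)
  have nn: "0 \<le> ?M j" for j by (rule magnet_nonneg[OF \<beta>])
  have le: "(if e \<inter> box k = {} then 0 else \<Sum>v\<in>e. gibbs \<beta> \<Delta> (box k) (\<lambda>\<sigma>. real_of_int (\<sigma> v))) \<le> (\<Sum>v\<in>e. ?a k v)" for k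
  proof (cases "e \<inter> box k = {}")
    case True
    then show ?thesis by (auto intro!: sum_nonneg nn)
  next
    case False
    have "gibbs \<beta> \<Delta> (box k) (\<lambda>\<sigma>. real_of_int (\<sigma> v)) \<le> ?a k v" if v: "v \<in> e" for v
    proof (cases "radius v \<le> k")
      case True
      then show ?thesis using gibbs_spin_le[OF \<beta> True] by simp
    next
      case out: False
      have "v \<in> box (Suc k)"
        using False xy v box_adj[of x k y] box_adj[of y k x] lat_adj_sym[of x y] box_mono[of k "Suc k"] by auto
      then have "Suc k = radius v" using out by (simp add: mem_box_radius)
      then show ?thesis using gibbs_outside[OF finite_box, of v k] by (simp add: mem_box_radius)
    qed
    then show ?thesis using False by (simp add: sum_mono)
  qed
  have col: "(\<Sum>k<n. ?a k v) \<le> 1 + (\<Sum>j<n. ?M j)" for v :: "int^'d"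
  proof -
    let ?r = "radius v"
    have "(\<Sum>k<n. ?a k v) = (\<Sum>k<n. (if ?r \<le> k then ?M (k - ?r) else 0) + (if Suc k = ?r then 1 else 0))"
      by (intro sum.cong) auto
    also have "\<dots> = (\<Sum>k<n. if ?r \<le> k then ?M (k - ?r) else 0) + (\<Sum>k<n. if Suc k = ?r then 1 else 0)"
      by (rule sum.distrib)
    also have "(\<Sum>k<n. if Suc k = ?r then 1 else 0) \<le> (1::real)"
      by (cases ?r) (auto simp: sum.delta)
    also have "(\<Sum>k<n. if ?r \<le> k then ?M (k - ?r) else 0) \<le> (\<Sum>j<n. ?M j)"
    proof -
      have "(\<Sum>k<n. if ?r \<le> k then ?M (k - ?r) else 0) = (\<Sum>k\<in>{k. k < n \<and> ?r \<le> k}. ?M (k - ?r))"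
        by (rule sum.mono_neutral_cong_right) auto
      also have "\<dots> = (\<Sum>j\<in>(\<lambda>k. k - ?r) ` {k. k < n \<and> ?r \<le> k}. ?M j)"
        by (subst sum.reindex) (auto simp: inj_on_def)
      also have "\<dots> \<le> (\<Sum>j<n. ?M j)" by (rule sum_mono2) (auto intro: nn)
      finally show ?thesis .
    qed
    finally show ?thesis by simp
  qed
  have "(\<Sum>k<n. if e \<inter> box k = {} then 0 else \<Sum>v\<in>e. gibbs \<beta> \<Delta> (box k) (\<lambda>\<sigma>. real_of_int (\<sigma> v)))
     \<le> (\<Sum>k<n. \<Sum>v\<in>e. ?a k v)" by (intro sum_mono le)
  also have "\<dots> = (\<Sum>v\<in>e. \<Sum>k<n. ?a k v)" by (rule sum.swap)
  also have "\<dots> \<le> (\<Sum>v\<in>e. 1 + (\<Sum>j<n. ?M j))" by (intro sum_mono col)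
  also have "\<dots> = 2 * (1 + (\<Sum>j<n. ?M j))" using xy lat_adj_irrefl[OF xy(2)] by simp
  finally show ?thesis .
qed

theorem magnet_differential_inequality:
  assumes \<beta>: "0 < \<beta>"
  shows "real n * magnet TYPE('d::finite) \<Delta> n \<beta> * (1 - magnet TYPE('d) \<Delta> 0 \<beta>)
     \<le> 2 * (1 + (\<Sum>j<n. magnet TYPE('d) \<Delta> j \<beta>)) * (rate \<Delta> \<beta> * magnet_deriv TYPE('d) \<Delta> n \<beta>)"
proof -
  let ?L = "box n :: (int^'d) set"
  let ?f = "\<lambda>\<sigma>::int^'d \<Rightarrow> int. real_of_int (\<sigma> 0)"
  let ?M = "\<lambda>j. magnet TYPE('d) \<Delta> j \<beta>"
  interpret blume_capel ?L "touching ?L" \<beta> \<Delta> by (rule blume_capel_lattice[OF finite_box \<beta>])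
  have f: "cone1 ?f" by (rule cone1_coord)
  let ?c = "\<lambda>e. cov ?L [] ?f (bond e)"
  have cnn: "0 \<le> ?c e" for e by (rule covariance_nonneg[OF finite_box subset_refl f cone1_bond])
  have mean: "mean (box k) [] F = gibbs \<beta> \<Delta> (box k) F" if "k \<le> n" for k F
    by (rule mean_gibbs[OF finite_box \<beta> box_mono[OF that]])
  have rate: "rate \<Delta> \<beta> = (1 + 4 / occupation\<^sup>2) / tanh \<beta>"
    unfolding rate_def occupation_def by simp
  have rate0: "0 \<le> rate \<Delta> \<beta>" unfolding rate using \<beta> by simp
  have rnn: "0 \<le> reveal (box k) e" if "k \<le> n" for k e
    unfolding reveal_def mean[OF that] using gibbs_nonneg[OF finite_box \<beta> cone1_coord] by (auto intro!: sum_nonneg)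
  have step: "?M n * (1 - ?M 0) \<le> (\<Sum>e\<in>touching ?L. reveal (box k) e * (rate \<Delta> \<beta> * ?c e))" if k: "k < n" for k
  proof -
    \<comment> \<open>The largest magnetization m_0 replaces m_k, making the left side independent
      of k before averaging.\<close>
    have "?M n * (1 - ?M 0) \<le> ?M n * (1 - ?M k)"
      using magnet_nonneg[OF \<beta>] magnet_antimono[OF \<beta>, of 0 k] by (intro mult_left_mono) auto
    also have "\<dots> = mean ?L [] ?f * (1 - mean (box k) [] ?f)"
      using k by (simp add: mean magnet_def del: weight.simps)
    also have "\<dots> \<le> (\<Sum>e\<in>touching ?L. reveal (box k) e *
       (cov ?L [] ?f (answer (Bond e)) + (\<Sum>u\<in>e. cov ?L [] ?f (answer (Site u)))))"
      by (rule exploration_inequality[OF finite_box box_mono subset_refl]) (use k in simp)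
    also have "\<dots> \<le> (\<Sum>e\<in>touching ?L. reveal (box k) e * (rate \<Delta> \<beta> * ?c e))"
      unfolding rate using k by (intro sum_mono mult_left_mono influence_le_bond[OF finite_box subset_refl f] rnn) auto
    finally show ?thesis .
  qed
  have "real n * ?M n * (1 - ?M 0) = (\<Sum>k<n. ?M n * (1 - ?M 0))" by simp
  also have "\<dots> \<le> (\<Sum>k<n. \<Sum>e\<in>touching ?L. reveal (box k) e * (rate \<Delta> \<beta> * ?c e))"
    by (intro sum_mono step) simp
  also have "\<dots> = (\<Sum>e\<in>touching ?L. (\<Sum>k<n. reveal (box k) e) * (rate \<Delta> \<beta> * ?c e))"
    by (subst sum.swap) (simp add: sum_distrib_right)
  also have "\<dots> \<le> (\<Sum>e\<in>touching ?L. (2 * (1 + (\<Sum>j<n. ?M j))) * (rate \<Delta> \<beta> * ?c e))"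
  proof (intro sum_mono mult_right_mono mult_nonneg_nonneg rate0 cnn)
    fix e assume e: "e \<in> touching ?L"
    have "(\<Sum>k<n. reveal (box k) e) = (\<Sum>k<n. if e \<inter> box k = {} then 0 else \<Sum>v\<in>e. gibbs \<beta> \<Delta> (box k) (\<lambda>\<sigma>. real_of_int (\<sigma> v)))"
      unfolding reveal_def by (intro sum.cong refl) (simp add: mean del: weight.simps)
    then show "(\<Sum>k<n. reveal (box k) e) \<le> 2 * (1 + (\<Sum>j<n. ?M j))"
      using sum_reveal_le[OF \<beta> e] by simp
  qed
  also have "\<dots> = 2 * (1 + (\<Sum>j<n. ?M j)) * (rate \<Delta> \<beta> * (\<Sum>e\<in>touching ?L. ?c e))"
    by (simp add: sum_distrib_left)
  also have "(\<Sum>e\<in>touching ?L. ?c e) = magnet_deriv TYPE('d) \<Delta> n \<beta>"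
    unfolding magnet_deriv_def cov_def mean[OF order_refl] ..
  finally show ?thesis .
qed

section \<open>From the differential inequality to exponential decay\<close>

text \<open>Dividing by n and summing over n makes the right-hand side telescope into the logarithm of the
  partial sums, while the left-hand side stays o(log n). Hence the partial sums are at most of order
  the square root of n slightly to the left of b; integrating twice more gives first stretched
  exponential and then exponential decay.\<close>

locale sharpness_ode =
  fixes f f' :: "nat \<Rightarrow> real \<Rightarrow> real" and a b c :: real
  assumes ab: "a < b" and c: "0 < c"
    and deriv: "t \<in> {a..b} \<Longrightarrow> (f n has_real_derivative f' n t) (at t)"
    and range: "t \<in> {a..b} \<Longrightarrow> 0 \<le> f n t \<and> f n t \<le> 1"
    and ineq: "t \<in> {a..b} \<Longrightarrow> c * real n * f n t \<le> (1 + (\<Sum>j<n. f j t)) * f' n t"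
    and lim: "(\<lambda>n. f n b) \<longlonglongrightarrow> 0"
begin

definition S :: "nat \<Rightarrow> real \<Rightarrow> real" where
  "S n t = 1 + (\<Sum>j<n. f j t)"

lemma S_ge_1: "t \<in> {a..b} \<Longrightarrow> 1 \<le> S n t"
  unfolding S_def using range by (simp add: sum_nonneg)

lemma deriv_nonneg: "t \<in> {a..b} \<Longrightarrow> 0 \<le> f' n t"
proof -
  assume t: "t \<in> {a..b}"
  have "0 \<le> c * real n * f n t" using c range[OF t] by simp
  also have "\<dots> \<le> S n t * f' n t" using ineq[OF t] unfolding S_def .
  finally show ?thesis using S_ge_1[OF t, of n] by (simp add: zero_le_mult_iff)
qed

lemma f_mono:
  assumes "a \<le> s" "s \<le> t" "t \<le> b" shows "f n s \<le> f n t"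
proof (rule DERIV_nonneg_imp_nondecreasing[OF assms(2)])
  fix u assume "s \<le> u" "u \<le> t"
  then have "u \<in> {a..b}" using assms by auto
  then show "\<exists>y. (f n has_real_derivative y) (at u) \<and> 0 \<le> y" using deriv deriv_nonneg by blast
qed

lemma S_mono: "a \<le> s \<Longrightarrow> s \<le> t \<Longrightarrow> t \<le> b \<Longrightarrow> S n s \<le> S n t"
  unfolding S_def using f_mono by (simp add: sum_mono)

text \<open>While S_n stays below B the inequality reads f_n' \<ge> (c n / B) f_n; integrating from
  s to t and using f_n \<le> 1 at t gives the exponential.\<close>

lemma decay:
  assumes "a \<le> s" "s \<le> t" "t \<le> b" and B: "S n t \<le> B"
  shows "f n s \<le> exp (- (c * real n / B * (t - s)))"
proof -
  define l where "l = c * real n / B"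
  have B1: "1 \<le> B" using S_ge_1[of t n] assms by auto
  have "f n s * exp (- l * s) \<le> f n t * exp (- l * t)"
  proof (rule DERIV_nonneg_imp_nondecreasing[OF assms(2)])
    fix u assume u: "s \<le> u" "u \<le> t"
    then have uab: "u \<in> {a..b}" using assms by auto
    have "S n u \<le> B" using S_mono[of u t n] u assms by auto
    then have "c * real n * f n u \<le> B * f' n u"
      using ineq[OF uab, of n] mult_right_mono[of "S n u" B "f' n u"] deriv_nonneg[OF uab, of n] unfolding S_def by linarith
    then have le: "l * f n u \<le> f' n u" using B1 unfolding l_def by (simp add: field_simps)
    have "((\<lambda>u. f n u * exp (- l * u)) has_real_derivative (f' n u - l * f n u) * exp (- l * u)) (at u)"
      by (rule derivative_eq_intros deriv[OF uab] refl | simp add: algebra_simps)+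
    then show "\<exists>y. ((\<lambda>u. f n u * exp (- l * u)) has_real_derivative y) (at u) \<and> 0 \<le> y"
      using le by (intro exI[of _ "(f' n u - l * f n u) * exp (- l * u)"]) simp
  qed
  also have "\<dots> \<le> 1 * exp (- l * t)" using range[of t n] assms by (intro mult_right_mono) auto
  finally have "f n s \<le> exp (- l * t) / exp (- l * s)" by (simp add: pos_le_divide_eq)
  also have "\<dots> = exp (- (l * (t - s)))" by (simp add: exp_diff[symmetric] algebra_simps)
  finally show ?thesis unfolding l_def .
qed

text \<open>By ln (1 + x) \<le> x, each increment of ln S_i is at most f_i / S_i, hence at most f_i'
  / (c i). The ln 2 bounds the first term of the telescope, since S_1 = 1 + f_0 \<le> 2.\<close>

lemma log_bound:
  assumes "a \<le> s" "s < b"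
  shows "c * (b - s) * (ln (S (Suc n) s) - ln 2) \<le> (\<Sum>i=1..n. f i b / real i)"
proof -
  define L where "L = c * (ln (S (Suc n) s) - ln 2)"
  let ?g = "\<lambda>t. (\<Sum>i=1..n. f i t / real i) - L * t"
  have "?g s \<le> ?g b"
  proof (rule DERIV_nonneg_imp_nondecreasing[of s b])
    fix t assume st: "s \<le> t" "t \<le> b"
    then have t: "t \<in> {a..b}" using assms by auto
    have S1: "S (Suc 0) t \<le> 2" using range[OF t, of 0] unfolding S_def by simp
    have tele: "(\<Sum>i=1..n. ln (S (Suc i) t) - ln (S i t)) = ln (S (Suc n) t) - ln (S (Suc 0) t)"
      by (induction n) auto
    have step: "c * (ln (S (Suc i) t) - ln (S i t)) \<le> f' i t / real i" if i: "i \<in> {1..n}" for i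
    proof -
      have Si: "1 \<le> S i t" by (rule S_ge_1[OF t])
      have fi: "0 \<le> f i t" using range[OF t] by simp
      have "S (Suc i) t / S i t = 1 + f i t / S i t" using Si by (simp add: S_def[of "Suc i"] S_def[of i, symmetric] add.assoc[symmetric] add_divide_distrib)
      then have "ln (S (Suc i) t) - ln (S i t) = ln (1 + f i t / S i t)"
        using Si S_ge_1[OF t, of "Suc i"] ln_div[of "S (Suc i) t" "S i t"] by simp
      also have "\<dots> \<le> f i t / S i t" using Si fi by (intro ln_add_one_self_le_self) simp
      finally have "c * (ln (S (Suc i) t) - ln (S i t)) \<le> c * (f i t / S i t)"
        using c by (intro mult_left_mono) auto
      also have "\<dots> \<le> f' i t / real i"
        using ineq[OF t, of i] Si i unfolding S_def[symmetric] by (simp add: field_simps)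
      finally show ?thesis .
    qed
    have "L \<le> c * (ln (S (Suc n) t) - ln (S (Suc 0) t))"
    proof -
      have "ln (S (Suc n) s) \<le> ln (S (Suc n) t)"
        using S_mono[of s t "Suc n"] S_ge_1[of s "Suc n"] st assms by (intro ln_mono) auto
      moreover have "ln (S (Suc 0) t) \<le> ln 2" using S1 S_ge_1[OF t, of "Suc 0"] by simp
      ultimately show ?thesis unfolding L_def using c by (intro mult_left_mono) auto
    qed
    also have "\<dots> = (\<Sum>i=1..n. c * (ln (S (Suc i) t) - ln (S i t)))"
      unfolding tele[symmetric] by (simp add: sum_distrib_left)
    also have "\<dots> \<le> (\<Sum>i=1..n. f' i t / real i)" by (intro sum_mono step)
    finally have "0 \<le> (\<Sum>i=1..n. f' i t / real i) - L" by simp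
    moreover have "(?g has_real_derivative (\<Sum>i=1..n. f' i t / real i) - L) (at t)"
      by (rule DERIV_diff[OF DERIV_sum[OF DERIV_cdivide[OF deriv[OF t]]]])
        (rule derivative_eq_intros refl | simp)+
    ultimately show "\<exists>y. (?g has_real_derivative y) (at t) \<and> 0 \<le> y" by blast
  qed (use assms in simp)
  moreover have "0 \<le> (\<Sum>i=1..n. f i s / real i)" using range assms by (intro sum_nonneg) auto
  ultimately have "L * (b - s) \<le> (\<Sum>i=1..n. f i b / real i)" by (simp add: algebra_simps)
  then show ?thesis unfolding L_def by (simp add: mult_ac)
qed

text \<open>The finitely many terms before f_i(b) drops below \<epsilon> contribute a constant; the
  rest is at most \<epsilon> times a harmonic sum.\<close>

lemma harmonic_average:
  assumes \<epsilon>: "0 < \<epsilon>"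
  obtains K where "\<And>n. 0 < n \<Longrightarrow> (\<Sum>i=1..n. f i b / real i) \<le> K + \<epsilon> * ln (real n)"
proof -
  obtain N where N: "\<And>i. N \<le> i \<Longrightarrow> f i b < \<epsilon>"
    using order_tendstoD(2)[OF lim \<epsilon>] unfolding eventually_sequentially by blast
  have bb: "b \<in> {a..b}" using ab by simp
  have le: "f i b / real i \<le> \<epsilon> * inverse (real i) + (if i < N then 1 else 0)" if "i \<in> {1..n}" for i n
  proof (cases "i < N")
    case True
    have "f i b / real i \<le> 1" using that range[OF bb, of i] by (simp add: divide_le_eq_1)
    then show ?thesis using True \<epsilon> by (simp add: add_increasing)
  next
    case False
    then show ?thesis using N[of i] that by (simp add: field_simps)
  qed
  have "(\<Sum>i=1..n. f i b / real i) \<le> (real N + \<epsilon>) + \<epsilon> * ln (real n)" if n: "0 < n" for n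
  proof -
    have "(\<Sum>i=1..n. f i b / real i) \<le> (\<Sum>i=1..n. \<epsilon> * inverse (real i) + (if i < N then 1 else 0))"
      by (intro sum_mono le)
    also have "\<dots> = \<epsilon> * harm n + (\<Sum>i=1..n. if i < N then 1 else 0)"
      unfolding harm_def by (simp add: sum.distrib sum_distrib_left)
    also have "(\<Sum>i=1..n. if i < N then 1 else (0::real)) \<le> real N"
    proof -
      have "(\<Sum>i=1..n. if i < N then 1 else (0::real)) = real (card {i \<in> {1..n}. i < N})"
        by (subst sum.inter_filter[symmetric]) auto
      also have "card {i \<in> {1..n}. i < N} \<le> card {..<N}" by (intro card_mono) auto
      finally show ?thesis by simp
    qed
    also have "\<epsilon> * harm n \<le> \<epsilon> * (ln (real n) + 1)" using euler_mascheroni_sequence_decreasing[of 1 n] n \<epsilon> by (intro mult_left_mono) (auto simp: harm_def)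
    finally show ?thesis by (simp add: algebra_simps)
  qed
  then show thesis by (rule that)
qed

theorem exponential_decay: "\<exists>\<kappa>>0. \<forall>n. f n a \<le> exp (- \<kappa> * real n)"
proof -
  define h where "h = (b - a) / 3"
  define s where "s = a + h"
  define t where "t = a + 2 * h"
  have h: "0 < h" using ab unfolding h_def by simp
  have st: "a < s" "s < t" "t < b" "b - t = h" "t - s = h" "s - a = h"
    using h unfolding s_def t_def h_def by (auto simp: field_simps)
  \<comment> \<open>The value \<epsilon> = c h / 2 is chosen so that dividing by c h leaves the
    exponent 1/2, hence partial sums of order sqrt n at t.\<close>
  obtain K where K: "\<And>n. 0 < n \<Longrightarrow> (\<Sum>i=1..n. f i b / real i) \<le> K + (c * h / 2) * ln (real n)"
    using harmonic_average[of "c * h / 2"] c h by auto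
  define B where "B = exp (K / (c * h) + ln 2)"
  have B: "0 < B" unfolding B_def by simp
  have Sqrt: "S n t \<le> B * sqrt (real n)" if n: "0 < n" for n
  proof -
    have tab: "t \<in> {a..b}" using st by simp
    have "c * h * (ln (S (Suc n) t) - ln 2) \<le> K + (c * h / 2) * ln (real n)"
      using log_bound[of t n] K[OF n] st by simp
    then have "ln (S (Suc n) t) \<le> (K / (c * h) + ln 2) + ln (real n) / 2"
      using c h by (simp add: field_simps)
    then have "S (Suc n) t \<le> exp ((K / (c * h) + ln 2) + ln (real n) / 2)"
      using S_ge_1[OF tab, of "Suc n"] by (metis exp_le_cancel_iff exp_ln less_le_trans zero_less_one)
    also have "\<dots> = B * sqrt (real n)"
      unfolding B_def exp_add using n by (simp add: ln_sqrt[symmetric])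
    finally show ?thesis using range[OF tab, of n] unfolding S_def by simp
  qed
  define \<kappa> where "\<kappa> = c / B * h"
  have \<kappa>: "0 < \<kappa>" unfolding \<kappa>_def using c B h by simp
  \<comment> \<open>From exp x \<ge> (x / 4)^4 with x = \<kappa> sqrt n: the fourth power turns the
    stretched exponential into a summable n^(-2), and 256 = 4^4.\<close>
  define D where "D = 256 / \<kappa> ^ 4"
  have poly: "f n s \<le> D * inverse (real n ^ 2)" if n: "0 < n" for n
  proof -
    have "f n s \<le> exp (- (c * real n / (B * sqrt (real n)) * (t - s)))"
      by (rule decay[OF _ _ _ Sqrt[OF n]]) (use st in auto)
    also have "c * real n / (B * sqrt (real n)) * (t - s) = \<kappa> * sqrt (real n)"
      unfolding \<kappa>_def st using n B by (simp add: field_simps)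
    finally have 1: "f n s \<le> inverse (exp (\<kappa> * sqrt (real n)))" by (simp add: exp_minus)
    have "(\<kappa> * sqrt (real n) / 4) ^ 4 \<le> (1 + \<kappa> * sqrt (real n) / real 4) ^ 4"
      using \<kappa> by (intro power_mono) auto
    also have "\<dots> \<le> exp (\<kappa> * sqrt (real n))"
      using \<kappa> order_trans[of "- real 4" 0 "\<kappa> * sqrt (real n)"] by (intro exp_ge_one_plus_x_over_n_power_n) auto
    finally have 2: "(\<kappa> * sqrt (real n) / 4) ^ 4 \<le> exp (\<kappa> * sqrt (real n))" .
    have sq: "sqrt (real n) ^ 4 = real n ^ 2" using power_mult[of "sqrt (real n)" 2 2] by simp
    have 3: "(\<kappa> * sqrt (real n) / 4) ^ 4 = \<kappa> ^ 4 * real n ^ 2 / 256"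
      by (simp only: power_divide power_mult_distrib sq) simp
    have "inverse (exp (\<kappa> * sqrt (real n))) \<le> inverse (\<kappa> ^ 4 * real n ^ 2 / 256)"
      using 2 \<kappa> n unfolding 3 by (intro le_imp_inverse_le) auto
    also have "inverse (\<kappa> ^ 4 * real n ^ 2 / 256) = D * inverse (real n ^ 2)"
      unfolding D_def by (simp add: field_simps)
    finally show ?thesis using 1 by linarith
  qed
  have D: "0 \<le> D" unfolding D_def by simp
  have summ: "summable (\<lambda>n. inverse (real n ^ 2))" by (rule inverse_power_summable) simp
  \<comment> \<open>One unit is the 1 in the definition of S, the other bounds the term j = 0, where
    the estimate by n^(-2) does not apply.\<close>
  define M where "M = 2 + D * (\<Sum>n. inverse (real n ^ 2))"
  have bounded: "S n s \<le> M" for n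
  proof -
    have sab: "s \<in> {a..b}" using st by simp
    have "f j s \<le> (if j = 0 then 1 else 0) + D * inverse (real j ^ 2)" for j
      using poly[of j] range[OF sab, of j] D by (cases "j = 0") auto
    then have "(\<Sum>j<n. f j s) \<le> (\<Sum>j<n. (if j = 0 then 1 else 0) + D * inverse (real j ^ 2))" by (intro sum_mono)
    also have "\<dots> = (\<Sum>j<n. if j = 0 then 1 else 0) + D * (\<Sum>j<n. inverse (real j ^ 2))"
      by (simp add: sum.distrib sum_distrib_left)
    also have "(\<Sum>j<n. if j = 0 then 1 else 0) \<le> (1::real)" by (simp add: sum.delta)
    also have "D * (\<Sum>j<n. inverse (real j ^ 2)) \<le> D * (\<Sum>n. inverse (real n ^ 2))"
      by (intro mult_left_mono sum_le_suminf[OF summ] D) auto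
    finally show ?thesis unfolding S_def M_def by simp
  qed
  have M: "0 < M" using bounded[of 0] unfolding S_def by simp
  have "f n a \<le> exp (- (c * h / M) * real n)" for n
  proof -
    have "f n a \<le> exp (- (c * real n / M * (s - a)))" by (rule decay[OF _ _ _ bounded]) (use st in auto)
    then show ?thesis unfolding st by (simp add: mult_ac)
  qed
  moreover have "0 < c * h / M" using c h M by simp
  ultimately show ?thesis by blast
qed

end

section \<open>Exponential decay of the magnetization and of the two-point function\<close>

lemma rate_antimono: "0 < a \<Longrightarrow> a \<le> b \<Longrightarrow> rate \<Delta> b \<le> rate \<Delta> a"
  unfolding rate_def by (intro divide_left_mono) (auto intro: add_nonneg_nonneg)

lemma rate_pos: "0 < a \<Longrightarrow> 0 < rate \<Delta> a"
  unfolding rate_def by (intro divide_pos_pos add_pos_nonneg) auto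

text \<open>The sign is read off the differential inequality itself: its left side is nonnegative
  and the factor of the derivative is positive.\<close>

lemma magnet_deriv_nonneg: 
  assumes "0 < \<beta>" shows "0 \<le> magnet_deriv TYPE('d::finite) \<Delta> n \<beta>"
proof -
  have "0 \<le> real n * magnet TYPE('d) \<Delta> n \<beta> * (1 - magnet TYPE('d) \<Delta> 0 \<beta>)"
    using magnet_nonneg[OF assms, of "TYPE('d)" \<Delta> n] magnet_lt_1[where 'd = 'd, of \<Delta> 0 \<beta>] by simp
  also note magnet_differential_inequality[OF assms, of n \<Delta>, where 'd = 'd]
  finally have "0 \<le> 2 * (1 + (\<Sum>j<n. magnet TYPE('d) \<Delta> j \<beta>)) * rate \<Delta> \<beta> * magnet_deriv TYPE('d) \<Delta> n \<beta>"
    by (simp add: mult.assoc)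
  moreover have "0 < 2 * (1 + (\<Sum>j<n. magnet TYPE('d) \<Delta> j \<beta>)) * rate \<Delta> \<beta>"
    using rate_pos[OF assms] by (intro mult_pos_pos add_pos_nonneg sum_nonneg magnet_nonneg[OF assms]) auto
  ultimately show ?thesis by (simp only: zero_le_mult_iff) auto
qed

theorem magnet_exponential_decay:
  assumes \<beta>: "0 < \<beta>" "\<beta> < b" and lim: "(\<lambda>n. magnet TYPE('d::finite) \<Delta> n b) \<longlonglongrightarrow> 0"
  shows "\<exists>\<kappa>>0. \<forall>n. magnet TYPE('d) \<Delta> n \<beta> \<le> exp (- \<kappa> * real n)"
proof -
  let ?m = "magnet TYPE('d) \<Delta>"
  let ?m' = "magnet_deriv TYPE('d) \<Delta>"
  have pos: "0 < t" if "t \<in> {\<beta>..b}" for t using that \<beta> by auto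
  have zero: "?m 0 t \<le> ?m 0 b" if t: "t \<in> {\<beta>..b}" for t
  proof (rule DERIV_nonneg_imp_nondecreasing[where f = "?m 0"])
    fix u assume "t \<le> u" "u \<le> b"
    then have "0 < u" using t \<beta> by auto
    then show "\<exists>y. (?m 0 has_real_derivative y) (at u) \<and> 0 \<le> y"
      using magnet_has_derivative magnet_deriv_nonneg by blast
  qed (use t in simp)
  have lt: "?m 0 b < 1" by (rule magnet_lt_1)
  \<comment> \<open>Uniform over the interval: \<open>rate\<close> decreases in its argument, so its
    value at \<beta> is the largest, while m_0 increases, so 1 - m_0 is smallest at b.\<close>
  define c where "c = (1 - ?m 0 b) / (2 * rate \<Delta> \<beta>)"
  have R: "0 < rate \<Delta> \<beta>" by (rule rate_pos[OF \<beta>(1)])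
  interpret sharpness_ode ?m ?m' \<beta> b c
  proof
    show "\<beta> < b" "0 < c" using \<beta> lt R unfolding c_def by auto
    show "(\<lambda>n. ?m n b) \<longlonglongrightarrow> 0" by (rule lim)
    fix t n assume t: "t \<in> {\<beta>..b}"
    show "(?m n has_real_derivative ?m' n t) (at t)" by (rule magnet_has_derivative)
    show "0 \<le> ?m n t \<and> ?m n t \<le> 1"
      using magnet_nonneg[OF pos[OF t], of "TYPE('d)" \<Delta> n] magnet_lt_1[where 'd = 'd, of \<Delta> n t] by simp
    have S: "0 < 1 + (\<Sum>j<n. ?m j t)" by (intro add_pos_nonneg sum_nonneg magnet_nonneg pos[OF t]) auto
    have "real n * ?m n t * (1 - ?m 0 b) \<le> real n * ?m n t * (1 - ?m 0 t)"
      using zero[OF t] magnet_nonneg[OF pos[OF t], of "TYPE('d)" \<Delta> n] by (intro mult_left_mono) auto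
    also have "\<dots> \<le> 2 * (1 + (\<Sum>j<n. ?m j t)) * (rate \<Delta> t * ?m' n t)"
      by (rule magnet_differential_inequality[OF pos[OF t]])
    also have "\<dots> \<le> 2 * (1 + (\<Sum>j<n. ?m j t)) * (rate \<Delta> \<beta> * ?m' n t)"
      using S rate_antimono[OF \<beta>(1), of t \<Delta>] t magnet_deriv_nonneg[OF pos[OF t], where 'd = 'd, of \<Delta> n]
      by (intro mult_left_mono mult_right_mono) auto
    finally show "c * real n * ?m n t \<le> (1 + (\<Sum>j<n. ?m j t)) * ?m' n t"
      using R unfolding c_def by (simp add: field_simps)
  qed
  show ?thesis by (rule exponential_decay)
qed

text \<open>Monotonicity in the box and nonnegativity give convergence, so the \<open>lim\<close> in
  the definition is a genuine limit.\<close>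

lemma magnet_tendsto:
  assumes "0 < \<beta>" shows "(\<lambda>n. magnet TYPE('d::finite) \<Delta> n \<beta>) \<longlonglongrightarrow> bc_plus_magnetization TYPE('d) \<beta> \<Delta>"
proof -
  have eq: "bc_plus_exp \<beta> \<Delta> n (\<lambda>\<sigma>::int^'d \<Rightarrow> int. real_of_int (\<sigma> 0)) = magnet TYPE('d) \<Delta> n \<beta>" for n
    unfolding bc_plus_exp_gibbs magnet_def ..
  have "convergent (\<lambda>n. magnet TYPE('d) \<Delta> n \<beta>)"
    using magnet_nonneg[OF assms] magnet_antimono[OF assms]
    by (intro Bseq_monoseq_convergent decseq_imp_monoseq decseq_bounded[of _ 0]) (auto simp: decseq_def)
  then show ?thesis unfolding bc_plus_magnetization_def eq by (simp add: convergent_LIMSEQ_iff)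
qed

text \<open>Finite-volume correlations decrease to the limit, so a bound in any single box suffices;
  the box may even leave x outside.\<close>

lemma two_point_le:
  fixes x :: "int^'d"
  assumes "0 < \<beta>" and N: "gibbs \<beta> \<Delta> (box N) (\<lambda>\<sigma>. real_of_int (\<sigma> 0) * real_of_int (\<sigma> x)) \<le> B"
  shows "bc_plus_two_point \<beta> \<Delta> 0 x \<le> B"
proof -
  let ?F = "\<lambda>\<sigma>::int^'d \<Rightarrow> int. real_of_int (\<sigma> 0) * real_of_int (\<sigma> x)"
  have F: "cone1 ?F" by (intro cone1_mult cone1_coord)
  have anti: "gibbs \<beta> \<Delta> (box n) ?F \<le> gibbs \<beta> \<Delta> (box k) ?F" if "k \<le> n" for k n
    by (rule gibbs_antimono[OF finite_box assms(1) box_mono[OF that] F])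
  have "convergent (\<lambda>n. gibbs \<beta> \<Delta> (box n) ?F)"
    using gibbs_nonneg[OF finite_box assms(1) F] anti
    by (intro Bseq_monoseq_convergent decseq_imp_monoseq decseq_bounded[of _ 0]) (auto simp: decseq_def)
  then have "(\<lambda>n. gibbs \<beta> \<Delta> (box n) ?F) \<longlonglongrightarrow> bc_plus_two_point \<beta> \<Delta> 0 x"
    unfolding bc_plus_two_point_def bc_plus_exp_gibbs by (simp add: convergent_LIMSEQ_iff)
  moreover have "\<forall>n\<ge>N. gibbs \<beta> \<Delta> (box n) ?F \<le> B" using anti N order_trans by blast
  ultimately show ?thesis by (intro LIMSEQ_le_const2) auto
qed

theorem theorem1p3:
  fixes \<beta> \<Delta> :: real
  assumes "CARD('d::finite) \<ge> 2"
    and "\<beta> > 0"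
    and "ereal \<beta> < bc_beta_c TYPE('d) \<Delta>"
  shows "\<exists>c>0. \<forall>x::int^'d. bc_plus_two_point \<beta> \<Delta> 0 x \<le> exp (- c * real_of_int (sup_norm x))"
proof -
  let ?m = "magnet TYPE('d) \<Delta>"
  \<comment> \<open>Decay at \<beta> is deduced from vanishing magnetization at a strictly larger
    parameter, so room below the critical value is used up here.\<close>
  obtain b where b: "\<beta> < b" "ereal b < bc_beta_c TYPE('d) \<Delta>"
    using ereal_dense2[OF assms(3)] by auto
  have bpos: "0 < b" using b assms by simp
  have "\<not> 0 < bc_plus_magnetization TYPE('d) b \<Delta>"
  proof
    assume "0 < bc_plus_magnetization TYPE('d) b \<Delta>"
    then have "bc_beta_c TYPE('d) \<Delta> \<le> ereal b" unfolding bc_beta_c_def using bpos by (intro Inf_lower) auto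
    then show False using b(2) by simp
  qed
  moreover have "0 \<le> bc_plus_magnetization TYPE('d) b \<Delta>"
    using magnet_nonneg[OF bpos] by (intro LIMSEQ_le_const[OF magnet_tendsto[OF bpos]]) auto
  ultimately have "(\<lambda>n. ?m n b) \<longlonglongrightarrow> 0" using magnet_tendsto[OF bpos, where 'd = 'd, of \<Delta>] by simp
  then obtain \<kappa> where \<kappa>: "0 < \<kappa>" "\<And>n. ?m n \<beta> \<le> exp (- \<kappa> * real n)"
    using magnet_exponential_decay[OF assms(2) b(1)] by blast
  \<comment> \<open>The bound has no prefactor, so \<kappa> alone does not suffice when x has norm 1
    and the box has radius 0; there m_0 < 1 is used. The maximum with 1/2 keeps q positive, as its
    logarithm requires.\<close>
  define q where "q = max (1/2) (?m 0 \<beta>)"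
  have q: "0 < q" "q < 1" unfolding q_def using magnet_lt_1[where 'd = 'd, of \<Delta> 0 \<beta>] by auto
  \<comment> \<open>Halving \<kappa> absorbs the shift from n to n + 1, since n + 1 \<le> 2 n for n
    \<ge> 1; the second entry handles n = 0.\<close>
  define c where "c = min (\<kappa> / 2) (- ln q)"
  have c: "0 < c" "c \<le> \<kappa> / 2" "c \<le> - ln q" unfolding c_def using \<kappa> q by auto
  have decay: "?m n \<beta> \<le> exp (- c * real (Suc n))" for n
  proof (cases "n = 0")
    case True
    have "?m 0 \<beta> \<le> exp (ln q)" using q unfolding q_def by simp
    also have "\<dots> \<le> exp (- c)" using c by simp
    finally show ?thesis using True by simp
  next
    case False
    have "c * real (Suc n) \<le> \<kappa> / 2 * real (Suc n)" using c by (intro mult_right_mono) auto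
    also have "\<dots> \<le> \<kappa> / 2 * (2 * real n)" using False \<kappa> by (intro mult_left_mono) auto
    finally have "c * real (Suc n) \<le> \<kappa> * real n" by simp
    then show ?thesis using \<kappa>(2)[of n] order_trans by fastforce
  qed
  have "bc_plus_two_point \<beta> \<Delta> 0 x \<le> exp (- c * real_of_int (sup_norm x))" for x :: "int^'d"
  proof (cases "radius x")
    case 0
    then have "sup_norm x = 0" using sup_norm_nonneg[of x] unfolding radius_def by simp
    moreover have "gibbs \<beta> \<Delta> (box 0) (\<lambda>\<sigma>. real_of_int (\<sigma> 0) * real_of_int (\<sigma> x)) \<le> 1"
    proof -
      have "(\<Sum>\<sigma>\<in>spins (box 0). exp (energy \<beta> \<Delta> (box 0) \<sigma>) * (real_of_int (\<sigma> 0) * real_of_int (\<sigma> x)))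
        \<le> (\<Sum>\<sigma>\<in>spins (box 0 :: (int^'d) set). exp (energy \<beta> \<Delta> (box 0) \<sigma>))"
      proof (rule sum_mono)
        fix \<sigma> :: "int^'d \<Rightarrow> int" assume s: "\<sigma> \<in> spins (box 0)"
        have "real_of_int (\<sigma> 0) * real_of_int (\<sigma> x) \<le> 1"
          using spins_value[OF s, of 0] spins_value[OF s, of x] by auto
        then show "exp (energy \<beta> \<Delta> (box 0) \<sigma>) * (real_of_int (\<sigma> 0) * real_of_int (\<sigma> x)) \<le> exp (energy \<beta> \<Delta> (box 0) \<sigma>)"
          by (simp add: mult_left_le)
      qed
      then show ?thesis
        using gibbs_partition_pos[OF finite_box[where 'd = 'd], of \<beta> \<Delta> 0] unfolding gibbs_def avg_def by simp
    qed
    ultimately show ?thesis using two_point_le[OF assms(2)] by simp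
  next
    case (Suc r)
    \<comment> \<open>In the box of radius one less than the norm of x the spin at x is frozen at 1,
      so the correlation is the magnetization at the origin.\<close>
    have out: "x \<notin> box r" using Suc by (simp add: mem_box_radius)
    have "gibbs \<beta> \<Delta> (box r) (\<lambda>\<sigma>. real_of_int (\<sigma> 0) * real_of_int (\<sigma> x)) = ?m r \<beta>"
      unfolding magnet_def by (rule gibbs_cong) (simp add: spins_outside[OF _ out])
    then have "bc_plus_two_point \<beta> \<Delta> 0 x \<le> ?m r \<beta>" by (intro two_point_le[OF assms(2), of \<Delta> r]) simp
    also have "\<dots> \<le> exp (- c * real (Suc r))" by (rule decay)
    also have "real (Suc r) = real_of_int (sup_norm x)"
      using Suc sup_norm_nonneg[of x] unfolding radius_def by (metis of_int_of_nat_eq nat_0_le)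
    finally show ?thesis .
  qed
  then show ?thesis using c(1) by blast
qed

end
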